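(* Let $\pi : (M^{2n+s}, g)\to (N^{2n}, g')$ be the canonical submersion of an $\mathcal{S}$-manifold $(M^{2n+s},\phi,\xi_i,\eta_j,g)$, with horizontal distribution $\mathcal{H}=\mathrm{Im}(\phi)$. The Riemannian Ricci tensors $\mathrm{Ric}^g$ and $\mathrm{Ric}^{g'}$ are related by $$\mathrm{Ric}^{g}(X, Y)=\pi^*\mathrm{Ric}^{g'}(X, Y)-2s\,g(X, Y),\quad X, Y\in\mathcal{H}.$$ Therefore, the Riemannian scalar curvatures $\mathrm{Scal}^g$, $\mathrm{Scal}^{g'}$ and the scalar curvature $\mathrm{Scal}^{\nabla}$ of the characteristic connection $\nabla$ on $M$ are related by $$\mathrm{Scal}^{g'}=\mathrm{Scal}^{g} +2ns=\mathrm{Scal}^{\nabla}+8ns.$$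
   Context: A metric $f$-manifold $(M^{2n+s},\phi,\xi_i,\eta_j,g)$ is a smooth connected manifold of dimension $2n+s$ with an endomorphism $\phi$ of $TM$ of constant rank $2n$, global vector fields $\xi_1,\dots,\xi_s$, 1-forms $\eta_1,\dots,\eta_s$ and a Riemannian metric $g$ such that $\mathrm{Ker}(\phi)=\langle\xi_1,\dots,\xi_s\rangle$, $\eta_i(\xi_j)=\delta_{ij}$, $\eta_i\circ\phi=0$, $\phi^2=-\mathrm{Id}+\sum_{i=1}^s\eta_i\otimes\xi_i$, and $g(\phi X,\phi Y)=g(X,Y)-\sum_{i=1}^s\eta_i(X)\eta_i(Y)$. Set $F(X,Y)=g(X,\phi Y)$ and $N^{(1)}=N_\phi+\sum_i d\eta_i\otimes\xi_i$, where $N_\phi(X,Y)=[\phi X,\phi Y]+\phi^2[X,Y]-\phi[X,\phi Y]-\phi[\phi X,Y]$ and $d\eta(X,Y)=X\eta(Y)-Y\eta(X)-\eta([X,Y])$. It is an $\mathcal{S}$-manifold if $s\ge1$, $2F=d\eta_j$ for all $j$, and $N^{(1)}=0$. The canonical submersion $\pi:M^{2n+s}\to N^{2n}$ is the locally defined Riemannian submersion with horizontal distribution $\mathcal{H}=\mathcal{D}=\mathrm{Im}(\phi)$ and vertical distribution $\mathcal{V}=\mathcal{D}^\perp=\mathrm{Ker}(\phi)$ (which is integrable): restricting to a sufficiently small open subset of $M$, $N$ is the smooth leaf space of the foliation tangent to $\mathcal{V}$ and $\pi$ is the quotient map; $g'$ is defined by $g'(X,Y)\circ\pi=g(X^h,Y^h)$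 with $X^h$ the horizontal lift. Functions on $N$ are compared with functions on $M$ via $\pi$. The characteristic connection of an $\mathcal{S}$-manifold is the metric connection $\nabla=\nabla^g+\frac12T$, i.e. $\nabla_XY=\nabla^g_XY+\frac12T(X,Y)$ with $\nabla^g$ the Levi-Civita connection, with totally skew-symmetric torsion $T=\sum_{i}\eta_i\wedge d\eta_i$, equivalently $T(X,Y)=2\sum_{i}\{F(X,Y)\xi_i-\eta_i(X)\phi(Y)+\eta_i(Y)\phi(X)\}$. Curvature convention: $R(X,Y)Z=\nabla_X\nabla_YZ-\nabla_Y\nabla_XZ-\nabla_{[X,Y]}Z$, $\mathrm{Ric}(U,V)=\sum_{a}g(R(U,e_a)e_a,V)$ and $\mathrm{Scal}=\sum_a\mathrm{Ric}(e_a,e_a)$ for a local orthonormal frame $\{e_a\}$. *)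

theory Defs
  imports "HOL-Analysis.Analysis" "HOL-Library.Function_Algebras"
begin

section \<open>Pointwise real vector space structure on functions\<close>

text \<open>Tangent vectors are functionals on real-valued functions, hence vectors of a function space.\<close>

instantiation "fun" :: (type, real_vector) real_vector
begin

definition scaleR_fun :: "real \<Rightarrow> ('a \<Rightarrow> 'b) \<Rightarrow> 'a \<Rightarrow> 'b" where
  "scaleR_fun c f = (\<lambda>x. c *\<^sub>R f x)"

instance
  by standard (simp_all add: scaleR_fun_def plus_fun_def fun_eq_iff scaleR_add_right scaleR_add_left)

end

definition linear_on :: "'v::real_vector set \<Rightarrow> ('v \<Rightarrow> 'w::real_vector) \<Rightarrow> bool" where
  "linear_on V f \<longleftrightarrow> (\<forall>u\<in>V. \<forall>v\<in>V. f (u + v) = f u + f v) \<and> (\<forall>c. \<forall>v\<in>V. f (c *\<^sub>R v) = c *\<^sub>R f v)"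


section \<open>Smooth functions on open subsets of Euclidean spaces\<close>

text \<open>As in \<^const>\<open>Euclidean_space\<close>, the points of \<open>\<real>\<^sup>m\<close> are the sequences vanishing from
  index \<open>m\<close> on, so that the dimension is a natural number (possibly \<open>0\<close>).\<close>

definition partial :: "nat \<Rightarrow> ((nat \<Rightarrow> real) \<Rightarrow> real) \<Rightarrow> (nat \<Rightarrow> real) \<Rightarrow> real" where
  "partial i F y = deriv (\<lambda>t. F (y(i := t))) (y i)"

text \<open>\<open>Ck m k V F\<close>: all iterated partial derivatives of \<open>F\<close> of order at most \<open>k\<close> exist and are
  continuous on the open subset \<open>V\<close> of \<open>\<real>\<^sup>m\<close>.\<close>

primrec Ck :: "nat \<Rightarrow> nat \<Rightarrow> (nat \<Rightarrow> real) set \<Rightarrow> ((nat \<Rightarrow> real) \<Rightarrow> real) \<Rightarrow> bool" where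
  "Ck m 0 V F \<longleftrightarrow> continuous_on V F"
| "Ck m (Suc k) V F \<longleftrightarrow> continuous_on V F \<and>
     (\<forall>i<m. (\<forall>y\<in>V. (\<lambda>t. F (y(i := t))) differentiable (at (y i))) \<and> Ck m k V (partial i F))"

definition smooth_Rn :: "nat \<Rightarrow> (nat \<Rightarrow> real) set \<Rightarrow> ((nat \<Rightarrow> real) \<Rightarrow> real) \<Rightarrow> bool" where
  "smooth_Rn m V F \<longleftrightarrow> (\<forall>k. Ck m k V F)"


section \<open>Smooth manifolds\<close>

text \<open>The points of a manifold are all the elements of a type; second countability and the
  Hausdorff property are imposed as type classes.\<close>

record 'a manifold =
  mdim :: nat
  charts :: "('a set \<times> ('a \<Rightarrow> nat \<Rightarrow> real)) set"

definition smooth_manifold ::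
    "'a::{t2_space,second_countable_topology} manifold \<Rightarrow> bool" where
  "smooth_manifold M \<longleftrightarrow>
     (\<Union>(U, x)\<in>charts M. U) = UNIV \<and>
     (\<forall>(U, x)\<in>charts M. open U \<and>
        (\<exists>V. openin (Euclidean_space (mdim M)) V \<and>
             homeomorphic_map (top_of_set U) (subtopology (Euclidean_space (mdim M)) V) x)) \<and>
     (\<forall>(U, x)\<in>charts M. \<forall>(V, y)\<in>charts M. \<forall>j<mdim M.
        smooth_Rn (mdim M) (x ` (U \<inter> V)) (\<lambda>z. y (inv_into U x z) j))"

definition smooth_fun :: "'a::topological_space manifold \<Rightarrow> 'a set \<Rightarrow> ('a \<Rightarrow> real) \<Rightarrow> bool" where
  "smooth_fun M W f \<longleftrightarrow> open W \<and>
     (\<forall>(U, x)\<in>charts M. smooth_Rn (mdim M) (x ` (U \<inter> W)) (f \<circ> inv_into U x))"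

definition smooth_at :: "'a::topological_space manifold \<Rightarrow> 'a \<Rightarrow> ('a \<Rightarrow> real) \<Rightarrow> bool" where
  "smooth_at M p f \<longleftrightarrow> (\<exists>W. p \<in> W \<and> smooth_fun M W f)"

text \<open>A tangent vector at \<open>p\<close> is a derivation \<open>\<Sum> a\<^sub>i \<partial>/\<partial>x\<^sub>i\<close> on germs of smooth functions at \<open>p\<close>.
  Since HOL functions are total, it is set to \<open>0\<close> on functions that are not smooth near \<open>p\<close>.\<close>

type_synonym 'a tvec = "('a \<Rightarrow> real) \<Rightarrow> real"

definition tangent_space :: "'a::topological_space manifold \<Rightarrow> 'a \<Rightarrow> 'a tvec set" where
  "tangent_space M p =
     {v. \<exists>(U, x)\<in>charts M. p \<in> U \<and>
        (\<exists>a. v = (\<lambda>f. if smooth_at M p f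
                      then \<Sum>i<mdim M. a i * partial i (f \<circ> inv_into U x) (x p) else 0))}"

text \<open>Local vector fields: only the values on the open set \<open>W\<close> matter.\<close>

definition vector_field :: "'a::topological_space manifold \<Rightarrow> 'a set \<Rightarrow> ('a \<Rightarrow> 'a tvec) \<Rightarrow> bool" where
  "vector_field M W X \<longleftrightarrow> open W \<and> (\<forall>p\<in>W. X p \<in> tangent_space M p) \<and>
     (\<forall>V f. V \<subseteq> W \<and> smooth_fun M V f \<longrightarrow> smooth_fun M V (\<lambda>p. X p f))"

definition lie_bracket ::
    "'a::topological_space manifold \<Rightarrow> ('a \<Rightarrow> 'a tvec) \<Rightarrow> ('a \<Rightarrow> 'a tvec) \<Rightarrow> 'a \<Rightarrow> 'a tvec" where
  "lie_bracket M X Y p =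
     (\<lambda>f. if smooth_at M p f then X p (\<lambda>q. Y q f) - Y p (\<lambda>q. X q f) else 0)"

definition one_form :: "'a::topological_space manifold \<Rightarrow> ('a \<Rightarrow> 'a tvec \<Rightarrow> real) \<Rightarrow> bool" where
  "one_form M \<eta> \<longleftrightarrow> (\<forall>p. linear_on (tangent_space M p) (\<eta> p)) \<and>
     (\<forall>W X. vector_field M W X \<longrightarrow> smooth_fun M W (\<lambda>p. \<eta> p (X p)))"

definition ext_deriv ::
    "'a::topological_space manifold \<Rightarrow> ('a \<Rightarrow> 'a tvec \<Rightarrow> real) \<Rightarrow> ('a \<Rightarrow> 'a tvec) \<Rightarrow> ('a \<Rightarrow> 'a tvec)
       \<Rightarrow> 'a \<Rightarrow> real" where
  "ext_deriv M \<eta> X Y p =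
     X p (\<lambda>q. \<eta> q (Y q)) - Y p (\<lambda>q. \<eta> q (X q)) - \<eta> p (lie_bracket M X Y p)"

definition endomorphism :: "'a::topological_space manifold \<Rightarrow> ('a \<Rightarrow> 'a tvec \<Rightarrow> 'a tvec) \<Rightarrow> bool" where
  "endomorphism M \<phi> \<longleftrightarrow>
     (\<forall>p. linear_on (tangent_space M p) (\<phi> p) \<and> \<phi> p ` tangent_space M p \<subseteq> tangent_space M p) \<and>
     (\<forall>W X. vector_field M W X \<longrightarrow> vector_field M W (\<lambda>p. \<phi> p (X p)))"

definition ker_at :: "'a::topological_space manifold \<Rightarrow> ('a \<Rightarrow> 'a tvec \<Rightarrow> 'a tvec) \<Rightarrow> 'a \<Rightarrow> 'a tvec set" where
  "ker_at M \<phi> p = {v \<in> tangent_space M p. \<phi> p v = 0}"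

definition im_at :: "'a::topological_space manifold \<Rightarrow> ('a \<Rightarrow> 'a tvec \<Rightarrow> 'a tvec) \<Rightarrow> 'a \<Rightarrow> 'a tvec set" where
  "im_at M \<phi> p = \<phi> p ` tangent_space M p"


section \<open>Riemannian metrics, connections and curvature\<close>

type_synonym 'a metric = "'a \<Rightarrow> 'a tvec \<Rightarrow> 'a tvec \<Rightarrow> real"
type_synonym 'a connection = "('a \<Rightarrow> 'a tvec) \<Rightarrow> ('a \<Rightarrow> 'a tvec) \<Rightarrow> 'a \<Rightarrow> 'a tvec"

definition riemannian_metric :: "'a::topological_space manifold \<Rightarrow> 'a metric \<Rightarrow> bool" where
  "riemannian_metric M g \<longleftrightarrow>
     (\<forall>p. (\<forall>u\<in>tangent_space M p. linear_on (tangent_space M p) (g p u)) \<and>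
          (\<forall>u\<in>tangent_space M p. \<forall>v\<in>tangent_space M p. g p u v = g p v u) \<and>
          (\<forall>u\<in>tangent_space M p. u \<noteq> 0 \<longrightarrow> g p u u > 0)) \<and>
     (\<forall>W X Y. vector_field M W X \<and> vector_field M W Y \<longrightarrow> smooth_fun M W (\<lambda>p. g p (X p) (Y p)))"

text \<open>A connection acts on vector fields defined on arbitrary open sets, compatibly with
  restriction (as every connection on global vector fields does, being a local operator).\<close>

definition affine_connection :: "'a::topological_space manifold \<Rightarrow> 'a connection \<Rightarrow> bool" where
  "affine_connection M D \<longleftrightarrow>
     (\<forall>W X Y. vector_field M W X \<and> vector_field M W Y \<longrightarrow> vector_field M W (D X Y)) \<and>
     (\<forall>W X Y X' Y'. vector_field M W X \<and> vector_field M W Y \<and>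
        (\<forall>p\<in>W. X' p = X p \<and> Y' p = Y p) \<longrightarrow> (\<forall>p\<in>W. D X' Y' p = D X Y p)) \<and>
     (\<forall>W X Y Z. vector_field M W X \<and> vector_field M W Y \<and> vector_field M W Z \<longrightarrow>
        (\<forall>p\<in>W. D (X + Y) Z p = D X Z p + D Y Z p \<and> D X (Y + Z) p = D X Y p + D X Z p)) \<and>
     (\<forall>W f X Y. smooth_fun M W f \<and> vector_field M W X \<and> vector_field M W Y \<longrightarrow>
        (\<forall>p\<in>W. D (\<lambda>q. f q *\<^sub>R X q) Y p = f p *\<^sub>R D X Y p \<and>
                D X (\<lambda>q. f q *\<^sub>R Y q) p = X p f *\<^sub>R Y p + f p *\<^sub>R D X Y p))"

definition levi_civita :: "'a::topological_space manifold \<Rightarrow> 'a metric \<Rightarrow> 'a connection \<Rightarrow> bool" where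
  "levi_civita M g D \<longleftrightarrow> affine_connection M D \<and>
     (\<forall>W X Y. vector_field M W X \<and> vector_field M W Y \<longrightarrow>
        (\<forall>p\<in>W. D X Y p - D Y X p = lie_bracket M X Y p)) \<and>
     (\<forall>W X Y Z. vector_field M W X \<and> vector_field M W Y \<and> vector_field M W Z \<longrightarrow>
        (\<forall>p\<in>W. X p (\<lambda>q. g q (Y q) (Z q)) = g p (D X Y p) (Z p) + g p (Y p) (D X Z p)))"

definition curvature ::
    "'a::topological_space manifold \<Rightarrow> 'a connection \<Rightarrow> ('a \<Rightarrow> 'a tvec) \<Rightarrow> ('a \<Rightarrow> 'a tvec)
       \<Rightarrow> ('a \<Rightarrow> 'a tvec) \<Rightarrow> 'a \<Rightarrow> 'a tvec" where
  "curvature M D X Y Z = D X (D Y Z) - D Y (D X Z) - D (lie_bracket M X Y) Z"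

definition orthonormal_frame ::
    "'a::topological_space manifold \<Rightarrow> 'a metric \<Rightarrow> 'a set \<Rightarrow> (nat \<Rightarrow> 'a \<Rightarrow> 'a tvec) \<Rightarrow> bool" where
  "orthonormal_frame M g W e \<longleftrightarrow> (\<forall>a<mdim M. vector_field M W (e a)) \<and>
     (\<forall>p\<in>W. \<forall>a<mdim M. \<forall>b<mdim M. g p (e a p) (e b p) = (if a = b then 1 else 0))"

text \<open>\<open>Ric(u,v) = \<Sum>\<^sub>a g(R(u,e\<^sub>a)e\<^sub>a,v)\<close> at \<open>p\<close>, and its trace. The values depend neither on the local
  orthonormal frame nor on the local vector field \<open>X\<close> extending \<open>u\<close>.\<close>

definition ricci ::
    "'a::topological_space manifold \<Rightarrow> 'a metric \<Rightarrow> 'a connection \<Rightarrow> 'a \<Rightarrow> 'a tvec \<Rightarrow> 'a tvec \<Rightarrow> real" where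
  "ricci M g D p u v =
     (THE r. \<exists>W e X. open W \<and> p \<in> W \<and> orthonormal_frame M g W e \<and> vector_field M W X \<and> X p = u \<and>
        r = (\<Sum>a<mdim M. g p (curvature M D X (e a) (e a) p) v))"

definition scal :: "'a::topological_space manifold \<Rightarrow> 'a metric \<Rightarrow> 'a connection \<Rightarrow> 'a \<Rightarrow> real" where
  "scal M g D p =
     (THE r. \<exists>W e. open W \<and> p \<in> W \<and> orthonormal_frame M g W e \<and>
        r = (\<Sum>a<mdim M. ricci M g D p (e a p) (e a p)))"


section \<open>Metric f-manifolds and S-manifolds\<close>

definition metric_f_manifold ::
    "'a::{t2_space,second_countable_topology} manifold \<Rightarrow> nat \<Rightarrow> nat \<Rightarrow> ('a \<Rightarrow> 'a tvec \<Rightarrow> 'a tvec)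
       \<Rightarrow> (nat \<Rightarrow> 'a \<Rightarrow> 'a tvec) \<Rightarrow> (nat \<Rightarrow> 'a \<Rightarrow> 'a tvec \<Rightarrow> real) \<Rightarrow> 'a metric \<Rightarrow> bool" where
  "metric_f_manifold M n s \<phi> \<xi> \<eta> g \<longleftrightarrow>
     smooth_manifold M \<and> connected (UNIV :: 'a set) \<and> mdim M = 2 * n + s \<and>
     endomorphism M \<phi> \<and> (\<forall>i\<in>{1..s}. vector_field M UNIV (\<xi> i)) \<and> (\<forall>i\<in>{1..s}. one_form M (\<eta> i)) \<and>
     riemannian_metric M g \<and>
     (\<forall>p. dim (im_at M \<phi> p) = 2 * n \<and>
          ker_at M \<phi> p = span ((\<lambda>i. \<xi> i p) ` {1..s}) \<and>
          (\<forall>i\<in>{1..s}. \<forall>j\<in>{1..s}. \<eta> i p (\<xi> j p) = (if i = j then 1 else 0)) \<and>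
          (\<forall>i\<in>{1..s}. \<forall>v\<in>tangent_space M p. \<eta> i p (\<phi> p v) = 0) \<and>
          (\<forall>v\<in>tangent_space M p. \<phi> p (\<phi> p v) = - v + (\<Sum>i=1..s. \<eta> i p v *\<^sub>R \<xi> i p)) \<and>
          (\<forall>u\<in>tangent_space M p. \<forall>v\<in>tangent_space M p.
             g p (\<phi> p u) (\<phi> p v) = g p u v - (\<Sum>i=1..s. \<eta> i p u * \<eta> i p v)))"

definition fundamental_form :: "'a metric \<Rightarrow> ('a \<Rightarrow> 'a tvec \<Rightarrow> 'a tvec) \<Rightarrow> 'a metric" where
  "fundamental_form g \<phi> p u v = g p u (\<phi> p v)"

definition nijenhuis ::
    "'a::topological_space manifold \<Rightarrow> ('a \<Rightarrow> 'a tvec \<Rightarrow> 'a tvec) \<Rightarrow> ('a \<Rightarrow> 'a tvec) \<Rightarrow> ('a \<Rightarrow> 'a tvec)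
       \<Rightarrow> 'a \<Rightarrow> 'a tvec" where
  "nijenhuis M \<phi> X Y p =
     lie_bracket M (\<lambda>q. \<phi> q (X q)) (\<lambda>q. \<phi> q (Y q)) p
     + \<phi> p (\<phi> p (lie_bracket M X Y p))
     - \<phi> p (lie_bracket M X (\<lambda>q. \<phi> q (Y q)) p)
     - \<phi> p (lie_bracket M (\<lambda>q. \<phi> q (X q)) Y p)"

definition S_manifold ::
    "'a::{t2_space,second_countable_topology} manifold \<Rightarrow> nat \<Rightarrow> nat \<Rightarrow> ('a \<Rightarrow> 'a tvec \<Rightarrow> 'a tvec)
       \<Rightarrow> (nat \<Rightarrow> 'a \<Rightarrow> 'a tvec) \<Rightarrow> (nat \<Rightarrow> 'a \<Rightarrow> 'a tvec \<Rightarrow> real) \<Rightarrow> 'a metric \<Rightarrow> bool" where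
  "S_manifold M n s \<phi> \<xi> \<eta> g \<longleftrightarrow> metric_f_manifold M n s \<phi> \<xi> \<eta> g \<and> s \<ge> 1 \<and>
     (\<forall>W X Y. vector_field M W X \<and> vector_field M W Y \<longrightarrow>
        (\<forall>p\<in>W. (\<forall>j\<in>{1..s}. 2 * fundamental_form g \<phi> p (X p) (Y p) = ext_deriv M (\<eta> j) X Y p) \<and>
                nijenhuis M \<phi> X Y p + (\<Sum>i=1..s. ext_deriv M (\<eta> i) X Y p *\<^sub>R \<xi> i p) = 0))"

text \<open>The vector-valued form of the totally skew-symmetric torsion \<open>\<Sum>\<^sub>i \<eta>\<^sub>i \<and> d\<eta>\<^sub>i\<close>.\<close>

definition char_torsion ::
    "nat \<Rightarrow> ('a \<Rightarrow> 'a tvec \<Rightarrow> 'a tvec) \<Rightarrow> (nat \<Rightarrow> 'a \<Rightarrow> 'a tvec) \<Rightarrow> (nat \<Rightarrow> 'a \<Rightarrow> 'a tvec \<Rightarrow> real)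
       \<Rightarrow> 'a metric \<Rightarrow> 'a \<Rightarrow> 'a tvec \<Rightarrow> 'a tvec \<Rightarrow> 'a tvec" where
  "char_torsion s \<phi> \<xi> \<eta> g p u v =
     2 *\<^sub>R (\<Sum>i=1..s. fundamental_form g \<phi> p u v *\<^sub>R \<xi> i p - \<eta> i p u *\<^sub>R \<phi> p v + \<eta> i p v *\<^sub>R \<phi> p u)"

definition char_connection ::
    "nat \<Rightarrow> ('a \<Rightarrow> 'a tvec \<Rightarrow> 'a tvec) \<Rightarrow> (nat \<Rightarrow> 'a \<Rightarrow> 'a tvec) \<Rightarrow> (nat \<Rightarrow> 'a \<Rightarrow> 'a tvec \<Rightarrow> real)
       \<Rightarrow> 'a metric \<Rightarrow> 'a connection \<Rightarrow> 'a connection" where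
  "char_connection s \<phi> \<xi> \<eta> g Dg X Y p =
     Dg X Y p + (1 / 2) *\<^sub>R char_torsion s \<phi> \<xi> \<eta> g p (X p) (Y p)"


section \<open>The canonical submersion\<close>

definition smooth_map_on ::
    "'a::topological_space manifold \<Rightarrow> 'a set \<Rightarrow> 'b::topological_space manifold \<Rightarrow> ('a \<Rightarrow> 'b) \<Rightarrow> bool" where
  "smooth_map_on M U N \<pi> \<longleftrightarrow> open U \<and> continuous_on U \<pi> \<and>
     (\<forall>V h. smooth_fun N V h \<longrightarrow> smooth_fun M (U \<inter> \<pi> -` V) (h \<circ> \<pi>))"

text \<open>The differential of \<open>\<pi>\<close> at \<open>p\<close>.\<close>

definition tangent_map :: "'b::topological_space manifold \<Rightarrow> ('a \<Rightarrow> 'b) \<Rightarrow> 'a \<Rightarrow> 'a tvec \<Rightarrow> 'b tvec" where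
  "tangent_map N \<pi> p v = (\<lambda>h. if smooth_at N (\<pi> p) h then v (h \<circ> \<pi>) else 0)"

text \<open>For an integrable distribution \<open>E\<close>, two points of the open set \<open>U\<close> lie in the same leaf of
  the induced foliation of \<open>U\<close> iff they are joined in \<open>U\<close> by a differentiable curve tangent
  to \<open>E\<close>.\<close>

definition same_leaf ::
    "'a::topological_space manifold \<Rightarrow> ('a \<Rightarrow> 'a tvec set) \<Rightarrow> 'a set \<Rightarrow> 'a \<Rightarrow> 'a \<Rightarrow> bool" where
  "same_leaf M E U p q \<longleftrightarrow>
     (\<exists>\<gamma>. path \<gamma> \<and> path_image \<gamma> \<subseteq> U \<and> pathstart \<gamma> = p \<and> pathfinish \<gamma> = q \<and>
        (\<forall>t\<in>{0..1}. \<exists>v\<in>E (\<gamma> t). \<forall>h. smooth_at M (\<gamma> t) h \<longrightarrow>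
            ((h \<circ> \<gamma>) has_real_derivative v h) (at t within {0..1})))"

text \<open>\<open>N\<close> is the leaf space of the foliation of \<open>U\<close> tangent to \<open>Ker \<phi>\<close>, with the smooth structure
  (unique up to diffeomorphism) that makes the quotient map a submersion; the last condition
  says \<open>g'(x,y) = g(x\<^sup>h,y\<^sup>h)\<close> for the horizontal lifts in \<open>Im \<phi>\<close>.\<close>

definition canonical_submersion ::
    "'a::{t2_space,second_countable_topology} manifold \<Rightarrow> ('a \<Rightarrow> 'a tvec \<Rightarrow> 'a tvec) \<Rightarrow> 'a metric
       \<Rightarrow> 'a set \<Rightarrow> 'b::{t2_space,second_countable_topology} manifold \<Rightarrow> 'b metric \<Rightarrow> nat
       \<Rightarrow> ('a \<Rightarrow> 'b) \<Rightarrow> bool" where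
  "canonical_submersion M \<phi> g U N g' n \<pi> \<longleftrightarrow>
     smooth_manifold N \<and> mdim N = 2 * n \<and> riemannian_metric N g' \<and>
     smooth_map_on M U N \<pi> \<and> \<pi> ` U = UNIV \<and>
     (\<forall>p\<in>U. \<forall>q\<in>U. \<pi> p = \<pi> q \<longleftrightarrow> same_leaf M (ker_at M \<phi>) U p q) \<and>
     (\<forall>p\<in>U. tangent_map N \<pi> p ` tangent_space M p = tangent_space N (\<pi> p) \<and>
        {v \<in> tangent_space M p. tangent_map N \<pi> p v = 0} = ker_at M \<phi> p \<and>
        (\<forall>u\<in>im_at M \<phi> p. \<forall>v\<in>im_at M \<phi> p.
           g' (\<pi> p) (tangent_map N \<pi> p u) (tangent_map N \<pi> p v) = g p u v))"

end

theory Submission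
  imports Defs
begin

text \<open>Everything is computed in a local orthonormal frame of \<open>M\<close> that consists of the
  horizontal lifts \<open>e\<^sub>a\<close> of an orthonormal frame of \<open>N\<close> and of the fields \<open>\<xi>\<^sub>i\<close>. Write
  \<open>F\<^sub>a\<^sub>b = g(e\<^sub>a, \<phi> e\<^sub>b)\<close>. The brackets \<open>[e\<^sub>a, \<xi>\<^sub>i]\<close> and \<open>[\<xi>\<^sub>i, \<xi>\<^sub>j]\<close> vanish, because they project
  to \<open>0\<close> on \<open>N\<close> and \<open>d\<eta>\<^sub>j = 2F\<close>, while \<open>[e\<^sub>a, e\<^sub>b]\<close> is the lift of the bracket on \<open>N\<close> minus
  \<open>2F\<^sub>a\<^sub>b (\<xi>\<^sub>1 + \<dots> + \<xi>\<^sub>s)\<close>. By the Koszul formula the coefficients of the Levi-Civita connection of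
  \<open>M\<close> are those of \<open>N\<close> and \<open>\<plusminus>F\<^sub>a\<^sub>b\<close>; those of the characteristic connection are the ones of \<open>N\<close> and,
  for the derivative of \<open>e\<^sub>a\<close> along \<open>\<xi>\<^sub>i\<close>, \<open>2F\<^sub>a\<^sub>b\<close>. Since \<open>F\<^sup>2 = -Id\<close> on the horizontal distribution and \<open>\<xi>\<^sub>i(F\<^sub>a\<^sub>b) = 0\<close>
  (normality), the traces of the curvature come out as \<open>Ric' - 3s + s\<close> on \<open>\<H>\<close>, as \<open>2n\<close> on each \<open>\<xi>\<^sub>i\<close>,
  and for the characteristic connection as \<open>Ric' - 4s\<close> on \<open>\<H>\<close> and \<open>0\<close> on each \<open>\<xi>\<^sub>i\<close>.\<close>


section \<open>Calculus on open subsets of Euclidean space\<close>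

text \<open>\<open>ricci\<close> and \<open>scal\<close> are definite descriptions ranging over all
  local orthonormal frames and all extensions of the given vector. A computation in one frame
  therefore says something about them only once the curvature is known to be linear over smooth
  functions in its three arguments and its trace to be independent of the frame. That argument needs
  brackets of vector fields to be vector fields; this is read off from torsion-freeness, which
  writes [X,Y] as a difference of covariant derivatives. The second obstacle is the smooth frame of
  horizontal lifts, which is built without a local section of \<pi>: vectors are lifted at one point
  only, extended, projected with \<open>\<phi>^2\<close>, orthonormalised, and finally corrected by
  a smooth orthogonal matrix so that they project to the chosen frame of \<open>N\<close>. The 3 in
  \<open>-3s\<close> is 1 from a product of two connection coefficients plus 2 from a bracket. For
  the characteristic connection the product disappears and the derivative along each \<xi> doubles,
  which gives 4.\<close>

definition cube :: "nat \<Rightarrow> (nat \<Rightarrow> real) \<Rightarrow> real \<Rightarrow> (nat \<Rightarrow> real) set" where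
  "cube m y e = {z. (\<forall>i\<ge>m. z i = 0) \<and> (\<forall>i<m. \<bar>z i - y i\<bar> < e)}"

lemma Euclidean_space_eq_top_of_set:
  "Euclidean_space m = top_of_set {x. \<forall>i\<ge>m. x i = 0}"
  by (simp add: Euclidean_space_def euclidean_product_topology)

lemma openin_Euclidean_space_zero:
  "openin (Euclidean_space m) V \<Longrightarrow> y \<in> V \<Longrightarrow> m \<le> i \<Longrightarrow> y i = 0"
  using openin_subset[of "Euclidean_space m" V] by (auto simp: topspace_Euclidean_space)

text \<open>Basic open sets of the product topology restrict every coordinate, but those from index
  \<open>m\<close> on are 0 throughout the subspace, so a minimum over finitely many radii
  suffices.\<close>

lemma openin_Euclidean_space_cube:
  assumes V: "openin (Euclidean_space m) V" and y: "y \<in> V"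
  shows "\<exists>e>0. cube m y e \<subseteq> V"
proof -
  obtain T where T: "open T" "V = {x. \<forall>i\<ge>m. x i = 0} \<inter> T"
    using V unfolding Euclidean_space_eq_top_of_set openin_open by auto
  have "openin (product_topology (\<lambda>i. euclidean) UNIV) T"
    using T(1) by (simp add: open_fun_def)
  from product_topology_open_contains_basis[OF this, of y] y T obtain X where
    X: "y \<in> PiE UNIV X" "\<And>i. open (X i)" "PiE UNIV X \<subseteq> T"
    by auto
  have "\<exists>e>0. ball (y i) e \<subseteq> X i" for i
    using X(1,2) open_contains_ball[of "X i"] by (auto simp: PiE_def)
  then obtain e where e: "\<And>i. e i > 0" "\<And>i. ball (y i) (e i) \<subseteq> X i" by metis
  \<comment> \<open>The 1 keeps the set nonempty when \<open>m = 0\<close>.\<close>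
  define d where "d = Min (insert 1 (e ` {..<m}))"
  have d: "d > 0" "\<And>i. i < m \<Longrightarrow> d \<le> e i" unfolding d_def using e(1) by auto
  have "cube m y d \<subseteq> V"
  proof
    fix z assume z: "z \<in> cube m y d"
    have "z i \<in> X i" for i
    proof (cases "i < m")
      case True
      then have "\<bar>z i - y i\<bar> < e i" using z d(2)[OF True] by (force simp: cube_def)
      then show ?thesis using e(2)[of i] by (auto simp: dist_real_def ball_def abs_minus_commute)
    next
      case False
      then have "z i = y i" using z y T(2) by (auto simp: cube_def)
      then show ?thesis using X(1) by auto
    qed
    then show "z \<in> V" using X(3) T(2) z by (auto simp: cube_def)
  qed
  then show ?thesis using d(1) by blast
qed

lemma openin_Euclidean_space_upd:
  assumes V: "openin (Euclidean_space m) V" and y: "y \<in> V" and i: "i < m"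
  shows "eventually (\<lambda>t. y(i := t) \<in> V) (nhds (y i))"
proof -
  obtain e where e: "e > 0" "cube m y e \<subseteq> V" using openin_Euclidean_space_cube[OF V y] by blast
  have "y(i := t) \<in> cube m y e" if "dist t (y i) < e" for t
    using that e(1) i openin_Euclidean_space_zero[OF V y] by (auto simp: cube_def dist_real_def)
  then show ?thesis unfolding eventually_nhds_metric using e by blast
qed

lemma continuous_on_cube:
  assumes V: "openin (Euclidean_space m) V" and y: "y \<in> V" and F: "continuous_on V F" and e: "e > 0"
  shows "\<exists>d>0. cube m y d \<subseteq> V \<and> (\<forall>z\<in>cube m y d. \<bar>F z - F y\<bar> < (e::real))"
proof -
  have "openin (top_of_set V) (V \<inter> F -` ball (F y) e)"
    using F by (simp add: continuous_on_open_gen continuous_openin_preimage_gen)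
  then have "openin (Euclidean_space m) (V \<inter> F -` ball (F y) e)"
    using V unfolding Euclidean_space_eq_top_of_set by (rule openin_trans)
  from openin_Euclidean_space_cube[OF this, of y] y e obtain d where
    "d > 0" "cube m y d \<subseteq> V \<inter> F -` ball (F y) e" by auto
  then show ?thesis by (intro exI[of _ d]) (auto simp: dist_real_def abs_minus_commute)
qed

lemma partial_eqI: "((\<lambda>t. F (y(i := t))) has_real_derivative d) (at (y i)) \<Longrightarrow> partial i F y = d"
  by (simp add: partial_def DERIV_imp_deriv)

lemma has_partial:
  "(\<lambda>t. F (y(i := t))) differentiable (at (y i)) \<Longrightarrow>
   ((\<lambda>t. F (y(i := t))) has_real_derivative partial i F y) (at (y i))"
  by (simp add: partial_def DERIV_deriv_iff_real_differentiable)

text \<open>The way from \<open>y\<close> to \<open>z\<close> is broken into axis-parallel edges,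
  and the mean value theorem is applied along each of them. The bound on \<open>\<zeta> j\<close>
  forces the intermediate points to converge to \<open>y\<close> together with
  \<open>z\<close>.\<close>

lemma partial_telescope:
  assumes y: "y \<in> cube m c e" and z: "z \<in> cube m c e" and V: "cube m c e \<subseteq> V"
    and F: "\<And>i w. i < m \<Longrightarrow> w \<in> V \<Longrightarrow> (\<lambda>t. F (w(i := t))) differentiable (at (w i))"
  shows "\<exists>\<zeta>. (\<forall>j<m. \<zeta> j \<in> cube m c e \<and> (\<forall>i. \<bar>\<zeta> j i - y i\<bar> \<le> \<bar>z i - y i\<bar>)) \<and>
     F z - F y = (\<Sum>j<m. (z j - y j) * partial j F (\<zeta> j))"
proof -
  \<comment> \<open>Corner of the edge path after \<open>k\<close> steps: the first \<open>k\<close>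
    coordinates have already been moved to \<open>z\<close>.\<close>
  define w where "w k = (\<lambda>j. if j < k then z j else y j)" for k :: nat
  have "\<exists>\<zeta>. \<zeta> \<in> cube m c e \<and> (\<forall>i. \<bar>\<zeta> i - y i\<bar> \<le> \<bar>z i - y i\<bar>) \<and>
     F (w (Suc k)) - F (w k) = (z k - y k) * partial k F \<zeta>" if k: "k < m" for k
  proof -
    define f where "f t = F ((w k)(k := t))" for t
    have in_cube: "(w k)(k := t) \<in> cube m c e" if "t \<in> closed_segment (y k) (z k)" for t
    proof -
      have "\<bar>t - c k\<bar> < e"
        using y z that k unfolding cube_def closed_segment_eq_real_ivl
        by (auto split: if_splits dest!: spec[of _ k])
      then show ?thesis using y z k by (auto simp: cube_def w_def)
    qed
    have df: "(f has_real_derivative partial k F ((w k)(k := t))) (at t)"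
      if "t \<in> closed_segment (y k) (z k)" for t
      using has_partial[OF F[OF k, of "(w k)(k := t)"]] in_cube[OF that] V
      unfolding f_def by (simp del: fun_upd_apply add: fun_upd_same subset_iff)
    have "\<exists>t\<in>closed_segment (y k) (z k). f (z k) - f (y k) = (z k - y k) * partial k F ((w k)(k := t))"
    proof (cases "y k" "z k" rule: linorder_cases)
      case less
      then have "\<exists>t>y k. t < z k \<and> f (z k) - f (y k) = (z k - y k) * partial k F ((w k)(k := t))"
        by (intro MVT2 df) (auto simp: closed_segment_eq_real_ivl)
      then show ?thesis using less by (auto simp: closed_segment_eq_real_ivl)
    next
      case equal
      then show ?thesis by auto
    next
      case greater
      then have "\<exists>t>z k. t < y k \<and> f (y k) - f (z k) = (y k - z k) * partial k F ((w k)(k := t))"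
        by (intro MVT2 df) (auto simp: closed_segment_eq_real_ivl)
      then obtain t where "t > z k" "t < y k" "f (y k) - f (z k) = (y k - z k) * partial k F ((w k)(k := t))"
        by auto
      then show ?thesis using greater
        by (intro bexI[of _ t]) (auto simp: closed_segment_eq_real_ivl algebra_simps)
    qed
    then obtain t where t: "t \<in> closed_segment (y k) (z k)"
      "f (z k) - f (y k) = (z k - y k) * partial k F ((w k)(k := t))" by blast
    have "(w k)(k := z k) = w (Suc k)" "(w k)(k := y k) = w k"
      by (auto simp: w_def fun_eq_iff less_Suc_eq)
    then have "F (w (Suc k)) - F (w k) = (z k - y k) * partial k F ((w k)(k := t))"
      using t(2) by (simp add: f_def)
    moreover have "\<bar>((w k)(k := t)) i - y i\<bar> \<le> \<bar>z i - y i\<bar>" for i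
      using t(1) unfolding closed_segment_eq_real_ivl by (auto simp: w_def split: if_splits)
    ultimately show ?thesis using in_cube[OF t(1)] by blast
  qed
  then obtain \<zeta> where \<zeta>: "\<And>k. k < m \<Longrightarrow> \<zeta> k \<in> cube m c e \<and> (\<forall>i. \<bar>\<zeta> k i - y i\<bar> \<le> \<bar>z i - y i\<bar>) \<and>
     F (w (Suc k)) - F (w k) = (z k - y k) * partial k F (\<zeta> k)" by metis
  have "w m = z" "w 0 = y" using y z by (auto simp: w_def cube_def fun_eq_iff)
  then have "F z - F y = (\<Sum>k<m. F (w (Suc k)) - F (w k))"
    using sum_lessThan_telescope[of "\<lambda>k. F (w k)" m] by simp
  also have "\<dots> = (\<Sum>j<m. (z j - y j) * partial j F (\<zeta> j))" using \<zeta> by (intro sum.cong) auto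
  finally show ?thesis using \<zeta> by blast
qed

text \<open>Divide the telescoped increment by \<open>t - t0\<close>. The evaluation points are
  squeezed to \<open>h t0\<close>, so continuity of the first partials yields the limit; no total
  derivative enters.\<close>

lemma has_real_derivative_chain_partial:
  assumes V: "openin (Euclidean_space m) V"
    and F: "\<And>i w. i < m \<Longrightarrow> w \<in> V \<Longrightarrow> (\<lambda>t. F (w(i := t))) differentiable (at (w i))"
    and cont: "\<And>i. i < m \<Longrightarrow> continuous_on V (partial i F)"
    and h0: "h t0 \<in> V" and hz: "eventually (\<lambda>t. \<forall>i\<ge>m. h t i = 0) (at t0)"
    and h: "\<And>j. j < m \<Longrightarrow> ((\<lambda>t. h t j) has_real_derivative d j) (at t0)"
  shows "((\<lambda>t. F (h t)) has_real_derivative (\<Sum>j<m. partial j F (h t0) * d j)) (at t0)"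
proof -
  have h_cube: "eventually (\<lambda>t. h t \<in> cube m (h t0) e) (at t0)" if "e > 0" for e
  proof -
    have "eventually (\<lambda>t. \<bar>h t j - h t0 j\<bar> < e) (at t0)" if "j < m" for j
    proof -
      have "((\<lambda>t. h t j) \<longlongrightarrow> h t0 j) (at t0)"
        using DERIV_isCont[OF h[OF that]] unfolding isCont_def .
      then show ?thesis using \<open>e > 0\<close> by (auto dest: tendstoD simp: dist_real_def)
    qed
    then have "eventually (\<lambda>t. \<forall>j\<in>{..<m}. \<bar>h t j - h t0 j\<bar> < e) (at t0)"
      by (intro eventually_ball_finite) auto
    with hz show ?thesis by eventually_elim (auto simp: cube_def)
  qed
  obtain e where e: "e > 0" "cube m (h t0) e \<subseteq> V" using openin_Euclidean_space_cube[OF V h0] by blast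
  have h0c: "h t0 \<in> cube m (h t0) e" using e(1) openin_Euclidean_space_zero[OF V h0] by (auto simp: cube_def)
  define Q where "Q t \<zeta> \<longleftrightarrow>
      (\<forall>j<m. \<zeta> j \<in> cube m (h t0) e \<and> (\<forall>i. \<bar>\<zeta> j i - h t0 i\<bar> \<le> \<bar>h t i - h t0 i\<bar>)) \<and>
      F (h t) - F (h t0) = (\<Sum>j<m. (h t j - h t0 j) * partial j F (\<zeta> j))" for t \<zeta>
  have "\<exists>\<zeta>. h t \<in> cube m (h t0) e \<longrightarrow> Q t \<zeta>" for t
    using partial_telescope[OF h0c _ e(2) F, of "h t"] unfolding Q_def by blast
  then obtain \<zeta> where "\<And>t. h t \<in> cube m (h t0) e \<longrightarrow> Q t (\<zeta> t)" by metis
  then have \<zeta>: "\<And>t. h t \<in> cube m (h t0) e \<Longrightarrow>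
      (\<forall>j<m. \<zeta> t j \<in> cube m (h t0) e \<and> (\<forall>i. \<bar>\<zeta> t j i - h t0 i\<bar> \<le> \<bar>h t i - h t0 i\<bar>)) \<and>
     F (h t) - F (h t0) = (\<Sum>j<m. (h t j - h t0 j) * partial j F (\<zeta> t j))"
    unfolding Q_def by blast
  have lim: "((\<lambda>t. partial j F (\<zeta> t j)) \<longlongrightarrow> partial j F (h t0)) (at t0)" if j: "j < m" for j
  proof (rule tendstoI)
    fix \<epsilon> :: real assume "\<epsilon> > 0"
    then obtain \<delta> where \<delta>: "\<delta> > 0" "\<forall>z\<in>cube m (h t0) \<delta>. \<bar>partial j F z - partial j F (h t0)\<bar> < \<epsilon>"
      using continuous_on_cube[OF V h0 cont[OF j]] by blast
    from h_cube[OF \<delta>(1)] h_cube[OF e(1)]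
    show "eventually (\<lambda>t. dist (partial j F (\<zeta> t j)) (partial j F (h t0)) < \<epsilon>) (at t0)"
    proof eventually_elim
      case (elim t)
      have "\<zeta> t j \<in> cube m (h t0) \<delta>"
        unfolding cube_def
      proof (intro CollectI conjI allI impI)
        fix i assume "m \<le> i" then show "\<zeta> t j i = 0" using \<zeta>[OF elim(2)] j by (auto simp: cube_def)
      next
        fix i assume "i < m"
        have "\<bar>\<zeta> t j i - h t0 i\<bar> \<le> \<bar>h t i - h t0 i\<bar>" using \<zeta>[OF elim(2)] j by auto
        also have "\<dots> < \<delta>" using elim(1) \<open>i < m\<close> by (auto simp: cube_def)
        finally show "\<bar>\<zeta> t j i - h t0 i\<bar> < \<delta>" .
      qed
      then show ?case using \<delta>(2) by (auto simp: dist_real_def)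
    qed
  qed
  have "((\<lambda>t. \<Sum>j<m. partial j F (\<zeta> t j) * ((h t j - h t0 j) / (t - t0)))
      \<longlongrightarrow> (\<Sum>j<m. partial j F (h t0) * d j)) (at t0)"
    using h by (intro tendsto_sum tendsto_mult lim) (auto simp: has_field_derivative_iff)
  moreover have "eventually (\<lambda>t. (\<Sum>j<m. partial j F (\<zeta> t j) * ((h t j - h t0 j) / (t - t0)))
      = (F (h t) - F (h t0)) / (t - t0)) (at t0)"
    using h_cube[OF e(1)]
  proof eventually_elim
    case (elim t)
    show ?case using \<zeta>[OF elim] by (auto simp: sum_divide_distrib intro!: sum.cong)
  qed
  ultimately show ?thesis
    unfolding has_field_derivative_iff by (rule Lim_transform_eventually)
qed

section \<open>Closure properties of functions of class C^k\<close>

lemma Ck_continuous: "Ck m k V F \<Longrightarrow> continuous_on V F"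
  by (cases k) auto

lemma Ck_subset: "Ck m k V F \<Longrightarrow> V' \<subseteq> V \<Longrightarrow> Ck m k V' F"
  by (induction k arbitrary: F) (auto intro: continuous_on_subset)

lemma Ck_Suc_imp: "Ck m (Suc k) V F \<Longrightarrow> Ck m k V F"
  by (induction k arbitrary: F) auto

lemma eventually_upd_eq:
  assumes V: "openin (Euclidean_space m) V" and eq: "\<And>y. y \<in> V \<Longrightarrow> F y = G y"
    and "y \<in> V" "i < m"
  shows "eventually (\<lambda>t. F (y(i := t)) = G (y(i := t))) (nhds (y i))"
  using openin_Euclidean_space_upd[OF V \<open>y \<in> V\<close> \<open>i < m\<close>] by eventually_elim (rule eq)

lemma partial_cong:
  assumes "openin (Euclidean_space m) V" "\<And>y. y \<in> V \<Longrightarrow> F y = G y" "y \<in> V" "i < m"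
  shows "partial i F y = partial i G y"
  unfolding partial_def
  by (rule deriv_cong_ev[OF eventually_upd_eq[OF assms(1) _ assms(3,4)]]) (use assms(2) in auto)

lemma Ck_cong:
  assumes V: "openin (Euclidean_space m) V"
  shows "(\<And>y. y \<in> V \<Longrightarrow> F y = G y) \<Longrightarrow> Ck m k V F \<Longrightarrow> Ck m k V G"
proof (induction k arbitrary: F G)
  case 0
  then show ?case using continuous_on_cong[OF refl, of V F G] by simp
next
  case (Suc k)
  have "continuous_on V G" using Suc.prems continuous_on_cong[OF refl, of V F G] by simp
  moreover have "(\<lambda>t. G (y(i := t))) differentiable (at (y i))" if "i < m" "y \<in> V" for i y
  proof -
    have "((\<lambda>t. F (y(i := t))) has_real_derivative partial i F y) (at (y i))"
      using Suc.prems that by (intro has_partial) auto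
    then have "((\<lambda>t. G (y(i := t))) has_real_derivative partial i F y) (at (y i))"
      using DERIV_cong_ev[OF refl eventually_upd_eq[OF V _ that(2,1), of F G] refl] Suc.prems(1) by blast
    then show ?thesis using real_differentiable_def by blast
  qed
  moreover have "Ck m k V (partial i G)" if "i < m" for i
    using Suc.IH[of "partial i F" "partial i G"] partial_cong[OF V Suc.prems(1)] Suc.prems(2) that by auto
  ultimately show ?case by simp
qed

text \<open>\<open>F'\<close> is the formula delivered by the differentiation rules. It is tied to
  \<open>partial i F\<close> only on \<open>V\<close>, and \<open>Ck_cong\<close> carries the
  regularity across that agreement.\<close>

lemma Ck_SucI:
  assumes V: "openin (Euclidean_space m) V" and "continuous_on V F"
    and d: "\<And>i y. i < m \<Longrightarrow> y \<in> V \<Longrightarrow> ((\<lambda>t. F (y(i := t))) has_real_derivative F' i y) (at (y i))"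
    and F': "\<And>i. i < m \<Longrightarrow> Ck m k V (F' i)"
  shows "Ck m (Suc k) V F"
proof -
  have "Ck m k V (partial i F)" if "i < m" for i
    by (rule Ck_cong[OF V _ F'[OF that]]) (metis d[OF that] partial_eqI)
  then show ?thesis using assms(2) d by (auto simp: real_differentiable_def)
qed

lemma Ck_SucD:
  assumes "Ck m (Suc k) V F" "i < m"
  shows "y \<in> V \<Longrightarrow> ((\<lambda>t. F (y(i := t))) has_real_derivative partial i F y) (at (y i))"
    and "Ck m k V (partial i F)"
  using assms by (auto intro: has_partial)

lemma Ck_const [simp]: "openin (Euclidean_space m) V \<Longrightarrow> Ck m k V (\<lambda>y. c)"
proof (induction k arbitrary: c)
  case (Suc k)
  show ?case by (rule Ck_SucI[OF Suc.prems, where F'="\<lambda>_ _. 0"]) (auto intro!: Suc)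
qed auto

lemma Ck_add:
  "openin (Euclidean_space m) V \<Longrightarrow> Ck m k V F \<Longrightarrow> Ck m k V G \<Longrightarrow> Ck m k V (\<lambda>y. F y + G y)"
proof (induction k arbitrary: F G)
  case (Suc k)
  show ?case
    by (rule Ck_SucI[OF Suc.prems(1), where F'="\<lambda>i y. partial i F y + partial i G y"])
       (use Suc.prems in \<open>auto intro!: continuous_on_add DERIV_add Suc.IH simp del: Ck.simps fun_upd_apply
          intro: Ck_continuous Ck_SucD\<close>)
qed (auto intro: continuous_on_add)

lemma Ck_mult:
  "openin (Euclidean_space m) V \<Longrightarrow> Ck m k V F \<Longrightarrow> Ck m k V G \<Longrightarrow> Ck m k V (\<lambda>y. F y * G y)"
proof (induction k arbitrary: F G)
  case (Suc k)
  show ?case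
  proof (rule Ck_SucI[OF Suc.prems(1), where F'="\<lambda>i y. partial i F y * G y + partial i G y * F y"])
    fix i y assume iy: "i < m" "y \<in> V"
    show "((\<lambda>t. F (y(i := t)) * G (y(i := t))) has_real_derivative
        partial i F y * G y + partial i G y * F y) (at (y i))"
      using DERIV_mult[OF Ck_SucD(1)[OF Suc.prems(2) iy] Ck_SucD(1)[OF Suc.prems(3) iy]]
      by (simp del: fun_upd_apply)
  next
    show "continuous_on V (\<lambda>y. F y * G y)"
      by (intro continuous_on_mult Ck_continuous[OF Suc.prems(2)] Ck_continuous[OF Suc.prems(3)])
  next
    fix i assume i: "i < m"
    show "Ck m k V (\<lambda>y. partial i F y * G y + partial i G y * F y)"
      by (intro Ck_add Suc.prems(1) Suc.IH Ck_SucD(2)[OF Suc.prems(2) i] Ck_SucD(2)[OF Suc.prems(3) i]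
          Ck_Suc_imp[OF Suc.prems(2)] Ck_Suc_imp[OF Suc.prems(3)])
  qed
qed (auto intro: continuous_on_mult)

text \<open>The exponent is general because differentiation lowers it by one. The instance wanted
  later is -1/2, which normalises vectors in \<open>gram_schmidt\<close>.\<close>

lemma Ck_powr:
  "openin (Euclidean_space m) V \<Longrightarrow> (\<And>y. y \<in> V \<Longrightarrow> F y > 0) \<Longrightarrow> Ck m k V F \<Longrightarrow>
   Ck m k V (\<lambda>y. F y powr a)"
proof (induction k arbitrary: a)
  case 0
  then show ?case by (auto intro!: continuous_on_powr simp: less_imp_neq[symmetric])
next
  case (Suc k)
  show ?case
  proof (rule Ck_SucI[OF Suc.prems(1), where F'="\<lambda>i y. (a * F y powr (a - 1)) * partial i F y"])
    show "continuous_on V (\<lambda>y. F y powr a)"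
      using Suc.prems by (auto intro!: continuous_on_powr simp: less_imp_neq[symmetric])
    fix i y assume iy: "i < m" "y \<in> V"
    show "((\<lambda>t. F (y(i := t)) powr a) has_real_derivative
        (a * F y powr (a - 1)) * partial i F y) (at (y i))"
      using DERIV_fun_powr[OF Ck_SucD(1)[OF Suc.prems(3) iy], of a] Suc.prems(2)[OF iy(2)]
      by (simp del: fun_upd_apply)
  next
    fix i assume i: "i < m"
    show "Ck m k V (\<lambda>y. (a * F y powr (a - 1)) * partial i F y)"
      using Suc.prems(2) i
      by (intro Ck_mult[OF Suc.prems(1)] Ck_const[OF Suc.prems(1)] Ck_SucD(2)[OF Suc.prems(3)]
          Suc.IH[OF Suc.prems(1) _ Ck_Suc_imp[OF Suc.prems(3)]])
  qed
qed

lemma Ck_sum: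
  assumes "openin (Euclidean_space m) V" "\<And>j. j \<in> A \<Longrightarrow> Ck m k V (F j)"
  shows "Ck m k V (\<lambda>y. \<Sum>j\<in>A. F j y)"
  using assms(2) by (induction A rule: infinite_finite_induct) (auto intro!: Ck_const Ck_add assms(1))

text \<open>Induction on the order: the chain rule expresses the first partials of the composite by
  \<open>partial j G\<close> after \<open>H\<close> and by first partials of the coordinates of
  \<open>H\<close>, which all have order \<open>k\<close>.\<close>

lemma Ck_compose:
  assumes V: "openin (Euclidean_space m) V" and V': "openin (Euclidean_space m') V'"
    and HV: "\<And>y. y \<in> V \<Longrightarrow> H y \<in> V'"
  shows "(\<And>j. j < m' \<Longrightarrow> Ck m k V (\<lambda>y. H y j)) \<Longrightarrow> Ck m' k V' G \<Longrightarrow> Ck m k V (\<lambda>y. G (H y))"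
proof -
  \<comment> \<open>\<open>H\<close> takes values in sequences, so its coordinates from index
    \<open>m'\<close> on must be continuous too; they vanish on \<open>V\<close>.\<close>
  have cont: "continuous_on V (\<lambda>y. G (H y))"
    if "\<And>j. j < m' \<Longrightarrow> continuous_on V (\<lambda>y. H y j)" "continuous_on V' G" for G :: "_ \<Rightarrow> real"
  proof -
    have "continuous_on V (\<lambda>y. H y j)" for j
    proof (cases "j < m'")
      case False
      then have "\<And>y. y \<in> V \<Longrightarrow> H y j = 0" using HV openin_Euclidean_space_zero[OF V'] by auto
      then show ?thesis using continuous_on_cong[OF refl, of V "\<lambda>y. H y j" "\<lambda>y. 0"] by simp
    qed (use that in auto)
    then have "continuous_on V H" by (rule continuous_on_coordinatewise_then_product)
    then show ?thesis using continuous_on_compose2[OF that(2)] HV by blast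
  qed
  show "(\<And>j. j < m' \<Longrightarrow> Ck m k V (\<lambda>y. H y j)) \<Longrightarrow> Ck m' k V' G \<Longrightarrow> Ck m k V (\<lambda>y. G (H y))"
  proof (induction k arbitrary: G)
    case 0
    then show ?case using cont by simp
  next
    case (Suc k)
    show ?case
    proof (rule Ck_SucI[OF V,
        where F'="\<lambda>i y. \<Sum>j<m'. partial j G (H y) * partial i (\<lambda>y. H y j) y"])
      show "continuous_on V (\<lambda>y. G (H y))"
        by (rule cont) (use Suc.prems in \<open>blast intro: Ck_continuous\<close>)+
    next
      fix i y assume iy: "i < m" "y \<in> V"
      have "eventually (\<lambda>t. \<forall>j\<ge>m'. H (y(i := t)) j = 0) (at (y i))"
        using openin_Euclidean_space_upd[OF V iy(2,1)] unfolding eventually_nhds_conv_at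
        by (auto elim!: eventually_mono intro: openin_Euclidean_space_zero[OF V' HV])
      moreover have "(\<lambda>t. G (w(j := t))) differentiable (at (w j))" if "j < m'" "w \<in> V'" for j w
        using Ck_SucD(1)[OF Suc.prems(2) that] real_differentiable_def by blast
      moreover have "continuous_on V' (partial j G)" if "j < m'" for j
        using Ck_SucD(2)[OF Suc.prems(2) that] by (rule Ck_continuous)
      ultimately show "((\<lambda>t. G (H (y(i := t)))) has_real_derivative
          (\<Sum>j<m'. partial j G (H y) * partial i (\<lambda>y. H y j) y)) (at (y i))"
        using has_real_derivative_chain_partial[OF V', of G "\<lambda>t. H (y(i := t))" "y i"
            "\<lambda>j. partial i (\<lambda>y. H y j) y"]
          Ck_SucD(1)[OF Suc.prems(1) iy] HV[OF iy(2)] by simp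
    next
      fix i assume i: "i < m"
      show "Ck m k V (\<lambda>y. \<Sum>j<m'. partial j G (H y) * partial i (\<lambda>y. H y j) y)"
        using i Suc.prems
        by (intro Ck_sum[OF V] Ck_mult[OF V] Suc.IH[of "partial _ G"] Ck_Suc_imp[OF Suc.prems(1)]
            Ck_SucD(2)[OF Suc.prems(2)] Ck_SucD(2)[OF Suc.prems(1)]) auto
    qed
  qed
qed

lemma Ck_local:
  assumes "\<And>y. y \<in> V \<Longrightarrow> \<exists>V'. openin (Euclidean_space m) V' \<and> y \<in> V' \<and> V' \<subseteq> V \<and> Ck m k V' F"
    and VE: "V \<subseteq> topspace (Euclidean_space m)"
  shows "Ck m k V F"
proof -
  have loc: "continuous_on V F"
    if "\<And>y. y \<in> V \<Longrightarrow> \<exists>V'. openin (Euclidean_space m) V' \<and> y \<in> V' \<and> V' \<subseteq> V \<and> continuous_on V' F"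
    for F :: "_ \<Rightarrow> real"
    unfolding continuous_on_eq_continuous_within
  proof
    fix y assume "y \<in> V"
    from that[OF this] obtain V' where
      V': "openin (Euclidean_space m) V'" "y \<in> V'" "V' \<subseteq> V" "continuous_on V' F" by blast
    then obtain T where T: "open T" "V' = {x. \<forall>i\<ge>m. x i = 0} \<inter> T"
      unfolding Euclidean_space_eq_top_of_set openin_open by auto
    \<comment> \<open>\<open>V\<close> lies in the coordinate subspace and \<open>V'\<close> is the
      part of that subspace inside \<open>T\<close>, so \<open>V\<close> and \<open>V'\<close>
      coincide within \<open>T\<close>.\<close>
    have "at y within V = at y within V'"
      by (rule at_within_nhd[of y T]) (use T V' VE in \<open>auto simp: topspace_Euclidean_space\<close>)
    then show "continuous (at y within V) F"
      using V' by (simp add: continuous_on_eq_continuous_within)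
  qed
  show ?thesis using assms(1)
  proof (induction k arbitrary: F)
    case 0
    then show ?case using loc[of F] by simp
  next
    case (Suc k)
    have "continuous_on V F" by (rule loc) (use Suc.prems in fastforce)
    moreover have "(\<lambda>t. F (y(i := t))) differentiable (at (y i))" if "i < m" "y \<in> V" for i y
      using Suc.prems[OF that(2)] that(1) by auto
    moreover have "Ck m k V (partial i F)" if "i < m" for i
      by (rule Suc.IH) (use Suc.prems that in fastforce)
    ultimately show ?case by simp
  qed
qed

section \<open>Charts and tangent spaces\<close>

lemma scaleR_fun_apply [simp]: "(c *\<^sub>R f) x = c *\<^sub>R f x"
  by (simp add: scaleR_fun_def)

lemma sum_fun_apply: "(\<Sum>i\<in>A. F i) x = (\<Sum>i\<in>A. F i x)"
  by (induction A rule: infinite_finite_induct) auto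

lemma linear_on_sum:
  assumes "subspace V" "linear_on V f" "\<And>a. a \<in> A \<Longrightarrow> X a \<in> V"
  shows "f (\<Sum>a\<in>A. X a) = (\<Sum>a\<in>A. f (X a))"
proof -
  have add: "f (u + v) = f u + f v" if "u \<in> V" "v \<in> V" for u v
    using assms(2) that unfolding linear_on_def by blast
  have "f 0 = 0" using add[of 0 0] subspace_0[OF assms(1)] by simp
  then show ?thesis using assms(3)
  proof (induction A rule: infinite_finite_induct)
    case (insert a A)
    have "f (X a + (\<Sum>a\<in>A. X a)) = f (X a) + f (\<Sum>a\<in>A. X a)"
      by (rule add) (use insert.prems in \<open>auto intro: subspace_sum[OF assms(1)]\<close>)
    then show ?case using insert by (simp del: plus_fun_apply)
  qed auto
qed

locale smooth_mfd =
  fixes M :: "'a::{t2_space,second_countable_topology} manifold"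
  assumes smooth_manifold: "smooth_manifold M"
begin

lemmas smooth_manifoldD = smooth_manifold[unfolded smooth_manifold_def]

lemma chart_cover: "\<exists>U x. (U, x) \<in> charts M \<and> p \<in> U"
proof -
  have "p \<in> (\<Union>(U, x)\<in>charts M. U)" using conjunct1[OF smooth_manifoldD] by simp
  then show ?thesis by auto
qed

lemma chart_open: "(U, x) \<in> charts M \<Longrightarrow> open U"
  using bspec[OF conjunct1[OF conjunct2[OF smooth_manifoldD]]] by fastforce

lemma chart_homeomorphic:
  assumes "(U, x) \<in> charts M"
  obtains V where "openin (Euclidean_space (mdim M)) V"
    "homeomorphic_map (top_of_set U) (subtopology (Euclidean_space (mdim M)) V) x"
  using bspec[OF conjunct1[OF conjunct2[OF smooth_manifoldD]] assms] by auto

lemma chart_inj: "(U, x) \<in> charts M \<Longrightarrow> inj_on x U"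
  using chart_homeomorphic homeomorphic_imp_injective_map by (metis topspace_euclidean_subtopology)

lemma chart_inv [simp]: "(U, x) \<in> charts M \<Longrightarrow> p \<in> U \<Longrightarrow> inv_into U x (x p) = p"
  by (simp add: chart_inj)

lemma chart_image_open:
  assumes "(U, x) \<in> charts M" "open W"
  shows "openin (Euclidean_space (mdim M)) (x ` (U \<inter> W))"
proof -
  obtain V where V: "openin (Euclidean_space (mdim M)) V"
    "homeomorphic_map (top_of_set U) (subtopology (Euclidean_space (mdim M)) V) x"
    using chart_homeomorphic[OF assms(1)] .
  have "openin (subtopology (Euclidean_space (mdim M)) V) (x ` (U \<inter> W))"
    using homeomorphic_imp_open_map[OF V(2)] openin_open_Int[OF assms(2), of U]
    unfolding open_map_def by blast
  then show ?thesis using openin_trans_full V(1) by blast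
qed

lemma chart_continuous:
  assumes "(U, x) \<in> charts M"
  shows "continuous_on U x"
proof -
  obtain V where V: "openin (Euclidean_space (mdim M)) V"
    "homeomorphic_map (top_of_set U) (subtopology (Euclidean_space (mdim M)) V) x"
    using chart_homeomorphic[OF assms(1)] .
  have "continuous_map (top_of_set U) euclidean x"
    using homeomorphic_imp_continuous_map[OF V(2)]
    unfolding Euclidean_space_eq_top_of_set subtopology_subtopology
    by (rule continuous_map_into_fulltopology)
  then show ?thesis by (simp add: continuous_map_iff_continuous)
qed

lemma chart_transition:
  assumes "(U, x) \<in> charts M" "(V, y) \<in> charts M" "j < mdim M"
  shows "Ck (mdim M) k (x ` (U \<inter> V)) (\<lambda>z. y (inv_into U x z) j)"
proof -
  have "\<forall>(V, y)\<in>charts M. \<forall>j<mdim M.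
      smooth_Rn (mdim M) (x ` (U \<inter> V)) (\<lambda>z. y (inv_into U x z) j)"
    using bspec[OF conjunct2[OF conjunct2[OF smooth_manifoldD]] assms(1)] by simp
  from bspec[OF this assms(2)] assms(3) show ?thesis by (simp add: smooth_Rn_def)
qed

section \<open>Smooth functions on a manifold\<close>

lemma smooth_funD:
  assumes "smooth_fun M W f" "(U, x) \<in> charts M"
  shows "Ck (mdim M) k (x ` (U \<inter> W)) (f \<circ> inv_into U x)"
  using assms unfolding smooth_fun_def smooth_Rn_def by blast

lemma smooth_fun_open: "smooth_fun M W f \<Longrightarrow> open W"
  by (simp add: smooth_fun_def)

lemma smooth_funI:
  assumes "open W" "\<And>U x k. (U, x) \<in> charts M \<Longrightarrow> Ck (mdim M) k (x ` (U \<inter> W)) (\<lambda>z. f (inv_into U x z))"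
  shows "smooth_fun M W f"
  using assms unfolding smooth_fun_def smooth_Rn_def comp_def by blast

text \<open>Smoothness is demanded in all charts of the atlas. Composition with the transition maps
  passes it from one suitable chart around each point to every other chart, and
  \<open>Ck_local\<close> glues the pieces.\<close>

lemma smooth_fun_chartI:
  assumes "open W"
    and ex: "\<And>p. p \<in> W \<Longrightarrow> \<exists>U x W'. (U, x) \<in> charts M \<and> p \<in> U \<and> open W' \<and> p \<in> W' \<and>
       (\<forall>k. Ck (mdim M) k (x ` (U \<inter> W')) (\<lambda>z. f (inv_into U x z)))"
  shows "smooth_fun M W f"
proof (rule smooth_funI[OF assms(1)])
  fix V y k assume V: "(V, y) \<in> charts M"
  show "Ck (mdim M) k (y ` (V \<inter> W)) (\<lambda>z. f (inv_into V y z))"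
  proof (rule Ck_local)
    show "y ` (V \<inter> W) \<subseteq> topspace (Euclidean_space (mdim M))"
      using chart_image_open[OF V assms(1)] openin_subset by blast
    fix z assume "z \<in> y ` (V \<inter> W)"
    then obtain q where q: "q \<in> V" "q \<in> W" "z = y q" by auto
    from ex[OF q(2)] obtain U x W' where U: "(U, x) \<in> charts M" "q \<in> U" "open W'" "q \<in> W'"
      "\<And>k. Ck (mdim M) k (x ` (U \<inter> W')) (\<lambda>z. f (inv_into U x z))" by blast
    define S where "S = y ` (V \<inter> (U \<inter> (W' \<inter> W)))"
    have S: "openin (Euclidean_space (mdim M)) S"
      unfolding S_def by (intro chart_image_open[OF V] open_Int chart_open[OF U(1)] U(3) assms(1))
    have "Ck (mdim M) k S (\<lambda>z. f (inv_into U x (x (inv_into V y z))))"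
    proof (rule Ck_compose[OF S chart_image_open[OF U(1,3)] _ _ U(5)])
      fix z assume "z \<in> S" then show "x (inv_into V y z) \<in> x ` (U \<inter> W')"
        using V by (auto simp: S_def)
    next
      fix j assume "j < mdim M"
      then show "Ck (mdim M) k S (\<lambda>z. x (inv_into V y z) j)"
        by (rule Ck_subset[OF chart_transition[OF V U(1)]]) (auto simp: S_def)
    qed
    then have "Ck (mdim M) k S (\<lambda>z. f (inv_into V y z))"
      by (rule Ck_cong[OF S, rotated]) (use V U(1) in \<open>auto simp: S_def\<close>)
    then show "\<exists>V'. openin (Euclidean_space (mdim M)) V' \<and> z \<in> V' \<and> V' \<subseteq> y ` (V \<inter> W) \<and>
        Ck (mdim M) k V' (\<lambda>z. f (inv_into V y z))"
      using S q U(2,4) by (intro exI[of _ S] conjI) (auto simp: S_def)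
  qed
qed

lemma smooth_fun_local:
  assumes "open W" "\<And>p. p \<in> W \<Longrightarrow> \<exists>W'. p \<in> W' \<and> smooth_fun M W' f"
  shows "smooth_fun M W f"
proof (rule smooth_fun_chartI[OF assms(1)])
  fix p assume "p \<in> W"
  then obtain W' where W': "p \<in> W'" "smooth_fun M W' f" using assms(2) by blast
  obtain U x where U: "(U, x) \<in> charts M" "p \<in> U" using chart_cover by blast
  then show "\<exists>U x W'. (U, x) \<in> charts M \<and> p \<in> U \<and> open W' \<and> p \<in> W' \<and>
       (\<forall>k. Ck (mdim M) k (x ` (U \<inter> W')) (\<lambda>z. f (inv_into U x z)))"
    using W' smooth_funD[OF W'(2) U(1)] smooth_fun_open[OF W'(2)] unfolding comp_def by blast
qed

lemma smooth_fun_subset: "smooth_fun M W f \<Longrightarrow> open W' \<Longrightarrow> W' \<subseteq> W \<Longrightarrow> smooth_fun M W' f"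
  by (rule smooth_fun_local) auto

lemma smooth_fun_cong:
  assumes "smooth_fun M W f" "\<And>p. p \<in> W \<Longrightarrow> f p = h p"
  shows "smooth_fun M W h"
proof (rule smooth_funI)
  show W: "open W" using assms(1) by (rule smooth_fun_open)
  fix U x k assume U: "(U, x) \<in> charts M"
  show "Ck (mdim M) k (x ` (U \<inter> W)) (\<lambda>z. h (inv_into U x z))"
    by (rule Ck_cong[OF chart_image_open[OF U W] _ smooth_funD[OF assms(1) U]])
       (use U assms(2) in auto)
qed

lemma smooth_fun_const: "open W \<Longrightarrow> smooth_fun M W (\<lambda>p. c)"
  by (intro smooth_funI Ck_const chart_image_open)

lemma smooth_fun_add:
  assumes "smooth_fun M W f" "smooth_fun M W h"
  shows "smooth_fun M W (\<lambda>p. f p + h p)"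
  using smooth_funD[OF assms(1)] smooth_funD[OF assms(2)] smooth_fun_open[OF assms(1)]
  by (intro smooth_funI Ck_add chart_image_open) (auto simp: comp_def)

lemma smooth_fun_mult:
  assumes "smooth_fun M W f" "smooth_fun M W h"
  shows "smooth_fun M W (\<lambda>p. f p * h p)"
  using smooth_funD[OF assms(1)] smooth_funD[OF assms(2)] smooth_fun_open[OF assms(1)]
  by (intro smooth_funI Ck_mult chart_image_open) (auto simp: comp_def)

lemma smooth_fun_powr:
  assumes "smooth_fun M W f" "\<And>p. p \<in> W \<Longrightarrow> f p > 0"
  shows "smooth_fun M W (\<lambda>p. f p powr a)"
  using smooth_funD[OF assms(1)] smooth_fun_open[OF assms(1)] assms(2)
  by (intro smooth_funI Ck_powr chart_image_open) (auto simp: comp_def)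

lemma smooth_fun_sum:
  assumes "open W" "\<And>a. a \<in> A \<Longrightarrow> smooth_fun M W (f a)"
  shows "smooth_fun M W (\<lambda>p. \<Sum>a\<in>A. f a p)"
  using assms(2)
  by (induction A rule: infinite_finite_induct) (auto intro: smooth_fun_const smooth_fun_add assms(1))

lemma smooth_fun_continuous:
  assumes "smooth_fun M W f"
  shows "continuous_on W f"
proof -
  have W: "open W" using assms by (rule smooth_fun_open)
  have "isCont f p" if p: "p \<in> W" for p
  proof -
    obtain U x where U: "(U, x) \<in> charts M" "p \<in> U" using chart_cover by blast
    have "continuous_on (U \<inter> W) (\<lambda>q. (f \<circ> inv_into U x) (x q))"
      by (rule continuous_on_compose2[OF Ck_continuous[OF smooth_funD[OF assms U(1), of 0]]
            continuous_on_subset[OF chart_continuous[OF U(1)]]]) auto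
    then have "continuous_on (U \<inter> W) f"
      using U(1) continuous_on_cong[OF refl, of "U \<inter> W" f "\<lambda>q. (f \<circ> inv_into U x) (x q)"] by simp
    then show ?thesis
      using continuous_on_eq_continuous_at[of "U \<inter> W" f] chart_open[OF U(1)] W U(2) p by auto
  qed
  then show ?thesis using W continuous_on_eq_continuous_at by blast
qed

lemma smooth_fun_coordinate:
  assumes "(U, x) \<in> charts M" "j < mdim M"
  shows "smooth_fun M U (\<lambda>q. x q j)"
  using smooth_funI[OF chart_open[OF assms(1)], of "\<lambda>q. x q j"] assms chart_transition[of _ _ U x j]
  by (metis (no_types, lifting))

lemma smooth_atI: "smooth_fun M W f \<Longrightarrow> p \<in> W \<Longrightarrow> smooth_at M p f"
  by (auto simp: smooth_at_def)

lemma smooth_at_cong: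
  assumes "open W" "p \<in> W" "\<And>q. q \<in> W \<Longrightarrow> f q = h q" "smooth_at M p f"
  shows "smooth_at M p h"
proof -
  obtain V where "p \<in> V" "smooth_fun M V f" using assms(4) by (auto simp: smooth_at_def)
  then have "smooth_fun M (V \<inter> W) f" using assms(1) smooth_fun_subset[of V f "V \<inter> W"] smooth_fun_open by blast
  then have "smooth_fun M (V \<inter> W) h" by (rule smooth_fun_cong) (use assms(3) in auto)
  then show ?thesis using \<open>p \<in> V\<close> assms(2) by (intro smooth_atI[of "V \<inter> W"]) auto
qed

lemma smooth_at_common:
  assumes "smooth_at M p f" "smooth_at M p h"
  obtains V where "p \<in> V" "smooth_fun M V f" "smooth_fun M V h"
proof -
  obtain V W where V: "p \<in> V" "smooth_fun M V f" and W: "p \<in> W" "smooth_fun M W h"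
    using assms unfolding smooth_at_def by blast
  have VW: "open (V \<inter> W)" using smooth_fun_open[OF V(2)] smooth_fun_open[OF W(2)] by (rule open_Int)
  show ?thesis
    by (rule that[OF _ smooth_fun_subset[OF V(2) VW] smooth_fun_subset[OF W(2) VW]])
      (use V W in auto)
qed

lemma smooth_at_add: "smooth_at M p f \<Longrightarrow> smooth_at M p h \<Longrightarrow> smooth_at M p (\<lambda>q. f q + h q)"
  by (erule (1) smooth_at_common) (auto intro: smooth_atI smooth_fun_add)

lemma smooth_at_mult: "smooth_at M p f \<Longrightarrow> smooth_at M p h \<Longrightarrow> smooth_at M p (\<lambda>q. f q * h q)"
  by (erule (1) smooth_at_common) (auto intro: smooth_atI smooth_fun_mult)

lemma smooth_at_partial:
  assumes "smooth_at M p f" "(U, x) \<in> charts M" "p \<in> U" "i < mdim M"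
  shows "((\<lambda>t. f (inv_into U x ((x p)(i := t)))) has_real_derivative
     partial i (f \<circ> inv_into U x) (x p)) (at (x p i))"
proof -
  obtain V where V: "p \<in> V" "smooth_fun M V f" using assms(1) by (auto simp: smooth_at_def)
  have "x p \<in> x ` (U \<inter> V)" using V assms by auto
  from Ck_SucD(1)[OF smooth_funD[OF V(2) assms(2), of "Suc 0"] assms(4) this] show ?thesis
    by (simp add: comp_def)
qed

section \<open>Coordinate vectors and the tangent space\<close>

definition coord_vec :: "'a set \<Rightarrow> ('a \<Rightarrow> nat \<Rightarrow> real) \<Rightarrow> nat \<Rightarrow> 'a \<Rightarrow> 'a tvec" where
  "coord_vec U x i p = (\<lambda>f. if smooth_at M p f then partial i (f \<circ> inv_into U x) (x p) else 0)"

lemma tangent_space_coord_vec: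
  "tangent_space M p =
     {v. \<exists>(U, x)\<in>charts M. p \<in> U \<and> (\<exists>a. v = (\<Sum>i<mdim M. a i *\<^sub>R coord_vec U x i p))}"
proof -
  have "(\<lambda>f. if smooth_at M p f then \<Sum>i<mdim M. a i * partial i (f \<circ> inv_into U x) (x p) else 0) =
    (\<Sum>i<mdim M. a i *\<^sub>R coord_vec U x i p)" for a U x
    by (auto simp: fun_eq_iff sum_fun_apply coord_vec_def)
  then show ?thesis unfolding tangent_space_def by simp
qed

text \<open>Near \<open>y p\<close> a function read in \<open>y\<close> is the function read in
  \<open>x\<close> composed with the transition map, so this is the chain rule; for functions not
  smooth at \<open>p\<close> both sides take the default 0. It frees the description of the tangent
  space from the existentially chosen chart.\<close>

lemma coord_vec_change:
  assumes U: "(U, x) \<in> charts M" "p \<in> U" and V: "(V, y) \<in> charts M" "p \<in> V" and i: "i < mdim M"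
  shows "coord_vec V y i p =
    (\<Sum>j<mdim M. partial i (\<lambda>z. x (inv_into V y z) j) (y p) *\<^sub>R coord_vec U x j p)"
proof
  fix f
  show "coord_vec V y i p f =
    (\<Sum>j<mdim M. partial i (\<lambda>z. x (inv_into V y z) j) (y p) *\<^sub>R coord_vec U x j p) f"
  proof (cases "smooth_at M p f")
    case True
    then obtain W where W: "p \<in> W" "smooth_fun M W f" by (auto simp: smooth_at_def)
    define T where "T = x ` (U \<inter> W)"
    have T: "openin (Euclidean_space (mdim M)) T"
      unfolding T_def by (rule chart_image_open[OF U(1) smooth_fun_open[OF W(2)]])
    define S where "S = y ` (V \<inter> (U \<inter> W))"
    have S: "openin (Euclidean_space (mdim M)) S"
      unfolding S_def using chart_open[OF U(1)] smooth_fun_open[OF W(2)] by (intro chart_image_open[OF V(1)]) auto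
    have pS: "y p \<in> S" using U V W by (auto simp: S_def)
    have near: "eventually (\<lambda>t. (y p)(i := t) \<in> S) (nhds (y p i))"
      by (rule openin_Euclidean_space_upd[OF S pS i])
    let ?h = "\<lambda>t. x (inv_into V y ((y p)(i := t)))"
    have hT: "?h t \<in> T" if inS: "(y p)(i := t) \<in> S" for t
    proof -
      obtain q where "q \<in> V" "q \<in> U" "q \<in> W" "(y p)(i := t) = y q"
        using inS unfolding S_def by blast
      then show ?thesis using V(1) by (auto simp: T_def)
    qed
    have "eventually (\<lambda>t. \<forall>j\<ge>mdim M. ?h t j = 0) (at (y p i))"
      using near unfolding eventually_nhds_conv_at
      by (auto elim!: eventually_mono intro: openin_Euclidean_space_zero[OF T hT])
    moreover have "(\<lambda>t. (f \<circ> inv_into U x) (w(j := t))) differentiable (at (w j))"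
      if "j < mdim M" "w \<in> T" for j w
      using Ck_SucD(1)[OF smooth_funD[OF W(2) U(1), of "Suc 0"] that(1), of w] that(2)
      unfolding T_def real_differentiable_def by blast
    moreover have "continuous_on T (partial j (f \<circ> inv_into U x))" if "j < mdim M" for j
      using Ck_continuous[OF Ck_SucD(2)[OF smooth_funD[OF W(2) U(1), of "Suc 0"] that]]
      unfolding T_def .
    moreover have "((\<lambda>t. ?h t j) has_real_derivative partial i (\<lambda>z. x (inv_into V y z) j) (y p)) (at (y p i))"
      if "j < mdim M" for j
      using Ck_SucD(1)[OF chart_transition[OF V(1) U(1) that, of "Suc 0"] i, of "y p"] U V by simp
    moreover have "?h (y p i) \<in> T" using hT[of "y p i"] pS by simp
    ultimately have d: "((\<lambda>t. (f \<circ> inv_into U x) (?h t)) has_real_derivative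
      (\<Sum>j<mdim M. partial j (f \<circ> inv_into U x) (?h (y p i)) *
         partial i (\<lambda>z. x (inv_into V y z) j) (y p))) (at (y p i))"
      by (intro has_real_derivative_chain_partial[OF T]) (auto simp del: fun_upd_apply comp_apply)
    have ev: "eventually (\<lambda>t. (f \<circ> inv_into U x) (?h t) = (f \<circ> inv_into V y) ((y p)(i := t))) (nhds (y p i))"
      using near
    proof eventually_elim
      case (elim t)
      then obtain q where "q \<in> V" "q \<in> U" "q \<in> W" "(y p)(i := t) = y q"
        unfolding S_def by blast
      then show ?case using U(1) V(1) by simp
    qed
    have "((\<lambda>t. (f \<circ> inv_into V y) ((y p)(i := t))) has_real_derivative
      (\<Sum>j<mdim M. partial j (f \<circ> inv_into U x) (?h (y p i)) *
         partial i (\<lambda>z. x (inv_into V y z) j) (y p))) (at (y p i))"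
      using d unfolding DERIV_cong_ev[OF refl ev refl] .
    from partial_eqI[OF this] show ?thesis
      using True V by (simp add: coord_vec_def sum_fun_apply mult.commute comp_def)
  qed (simp add: coord_vec_def sum_fun_apply)
qed

lemma tangent_space_chart:
  assumes U: "(U, x) \<in> charts M" "p \<in> U"
  shows "tangent_space M p = {v. \<exists>a. v = (\<Sum>i<mdim M. a i *\<^sub>R coord_vec U x i p)}"
proof -
  have "\<exists>b. (\<Sum>i<mdim M. a i *\<^sub>R coord_vec V y i p) = (\<Sum>i<mdim M. b i *\<^sub>R coord_vec U x i p)"
    if V: "(V, y) \<in> charts M" "p \<in> V" for V y a
  proof -
    let ?c = "\<lambda>i j. partial i (\<lambda>z. x (inv_into V y z) j) (y p)"
    have "(\<Sum>i<mdim M. a i *\<^sub>R coord_vec V y i p) =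
      (\<Sum>i<mdim M. \<Sum>j<mdim M. (a i * ?c i j) *\<^sub>R coord_vec U x j p)"
      by (intro sum.cong refl) (simp add: coord_vec_change[OF U V] scaleR_sum_right)
    also have "\<dots> = (\<Sum>j<mdim M. (\<Sum>i<mdim M. a i * ?c i j) *\<^sub>R coord_vec U x j p)"
      by (subst sum.swap) (simp add: scaleR_sum_left)
    finally show ?thesis by (intro exI[of _ "\<lambda>j. \<Sum>i<mdim M. a i * ?c i j"])
  qed
  then show ?thesis using U unfolding tangent_space_coord_vec by blast
qed

lemma coord_vec_in: "(U, x) \<in> charts M \<Longrightarrow> p \<in> U \<Longrightarrow> i < mdim M \<Longrightarrow> coord_vec U x i p \<in> tangent_space M p"
  unfolding tangent_space_chart
  by (auto intro!: exI[of _ "\<lambda>j. if j = i then 1 else 0"] simp: if_distrib[of "\<lambda>c. c *\<^sub>R _"] cong: if_cong)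

lemma tangent_space_span:
  assumes U: "(U, x) \<in> charts M" "p \<in> U"
  shows "tangent_space M p = span ((\<lambda>i. coord_vec U x i p) ` {..<mdim M})"
proof
  show "tangent_space M p \<subseteq> span ((\<lambda>i. coord_vec U x i p) ` {..<mdim M})"
    unfolding tangent_space_chart[OF U] by (auto intro!: span_sum span_scale intro: span_base)
  have "subspace (tangent_space M p)"
    unfolding subspace_def
  proof (intro conjI ballI allI)
    show "0 \<in> tangent_space M p" unfolding tangent_space_chart[OF U] by (auto intro: exI[of _ "\<lambda>_. 0"])
    fix v assume "v \<in> tangent_space M p"
    then obtain a where a: "v = (\<Sum>i<mdim M. a i *\<^sub>R coord_vec U x i p)"
      unfolding tangent_space_chart[OF U] by blast
    show "c *\<^sub>R v \<in> tangent_space M p" for c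
      unfolding tangent_space_chart[OF U] a by (auto intro!: exI[of _ "\<lambda>i. c * a i"] simp: scaleR_sum_right)
    fix w assume "w \<in> tangent_space M p"
    then obtain b where b: "w = (\<Sum>i<mdim M. b i *\<^sub>R coord_vec U x i p)"
      unfolding tangent_space_chart[OF U] by blast
    show "v + w \<in> tangent_space M p"
      unfolding tangent_space_chart[OF U] a b
      by (auto intro!: exI[of _ "\<lambda>i. a i + b i"] simp: scaleR_add_left sum.distrib)
  qed
  then show "span ((\<lambda>i. coord_vec U x i p) ` {..<mdim M}) \<subseteq> tangent_space M p"
    by (intro span_minimal) (auto intro: coord_vec_in[OF U])
qed

lemma subspace_tangent_space: "subspace (tangent_space M p)"
  using tangent_space_span chart_cover subspace_span by metis

lemmas tangent_add = subspace_add[OF subspace_tangent_space]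
lemmas tangent_diff = subspace_diff[OF subspace_tangent_space]
lemmas tangent_neg = subspace_neg[OF subspace_tangent_space]
lemmas tangent_scale = subspace_scale[OF subspace_tangent_space]
lemmas tangent_sum = subspace_sum[OF subspace_tangent_space]
lemmas tangent_zero = subspace_0[OF subspace_tangent_space]

text \<open>The coordinate functions are dual to the coordinate vectors. This recovers coefficients
  in \<open>tangent_expand\<close> and gives independence in
  \<open>orthonormal_frame_exists\<close>.\<close>

lemma coord_vec_coordinate:
  assumes U: "(U, x) \<in> charts M" "p \<in> U" and i: "i < mdim M" "j < mdim M"
  shows "coord_vec U x i p (\<lambda>q. x q j) = (if i = j then 1 else 0)"
proof -
  have sm: "smooth_at M p (\<lambda>q. x q j)"
    by (rule smooth_atI[OF smooth_fun_coordinate[OF U(1) i(2)] U(2)])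
  have "eventually (\<lambda>t. (x p)(i := t) \<in> x ` (U \<inter> UNIV)) (nhds (x p i))"
    by (rule openin_Euclidean_space_upd[OF chart_image_open[OF U(1) open_UNIV] _ i(1)]) (use U in auto)
  then have ev: "eventually (\<lambda>t. ((x p)(i := t)) j = ((\<lambda>q. x q j) \<circ> inv_into U x) ((x p)(i := t))) (nhds (x p i))"
  proof eventually_elim
    case (elim t)
    then obtain q where q: "q \<in> U" "(x p)(i := t) = x q" by blast
    show ?case unfolding q(2) using q(1) U(1) by simp
  qed
  have "((\<lambda>t. ((x p)(i := t)) j) has_real_derivative (if i = j then 1 else 0)) (at (x p i))"
    by (cases "i = j") auto
  then have "((\<lambda>t. ((\<lambda>q. x q j) \<circ> inv_into U x) ((x p)(i := t))) has_real_derivative (if i = j then 1 else 0)) (at (x p i))"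
    using DERIV_cong_ev[OF refl ev refl] by blast
  from partial_eqI[OF this] show ?thesis using sm by (simp add: coord_vec_def comp_def)
qed

lemma tangent_expand:
  assumes U: "(U, x) \<in> charts M" "p \<in> U" and v: "v \<in> tangent_space M p"
  shows "v = (\<Sum>i<mdim M. v (\<lambda>q. x q i) *\<^sub>R coord_vec U x i p)"
proof -
  obtain a where a: "v = (\<Sum>i<mdim M. a i *\<^sub>R coord_vec U x i p)"
    using v unfolding tangent_space_chart[OF U] by blast
  have "v (\<lambda>q. x q j) = a j" if "j < mdim M" for j
  proof -
    have "v (\<lambda>q. x q j) = (\<Sum>i<mdim M. if i = j then a i else 0)"
      unfolding a sum_fun_apply
      by (intro sum.cong refl) (simp add: coord_vec_coordinate[OF U _ that])
    then show ?thesis using that by simp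
  qed
  then show ?thesis by (subst a) (auto intro!: sum.cong)
qed

text \<open>Locality, additivity and the Leibniz rule are linear in the tangent vector; with this
  they reduce to one-variable rules for partial derivatives.\<close>

lemma tangent_induct [consumes 1]:
  assumes v: "v \<in> tangent_space M p"
    and "P 0" "\<And>v w. P v \<Longrightarrow> P w \<Longrightarrow> P (v + w)" "\<And>c v. P v \<Longrightarrow> P (c *\<^sub>R v)"
    and coord: "\<And>U x i. (U, x) \<in> charts M \<Longrightarrow> p \<in> U \<Longrightarrow> i < mdim M \<Longrightarrow> P (coord_vec U x i p)"
  shows "P v"
proof -
  obtain U x where U: "(U, x) \<in> charts M" "p \<in> U" using chart_cover by blast
  have "subspace {v. P v}" using assms(2-4) by (simp add: subspace_def)
  then have "span ((\<lambda>i. coord_vec U x i p) ` {..<mdim M}) \<subseteq> {v. P v}"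
    using coord[OF U] by (intro span_minimal) auto
  then show ?thesis using v tangent_space_span[OF U] by auto
qed

section \<open>Tangent vectors as local derivations\<close>

lemma tangent_not_smooth: "v \<in> tangent_space M p \<Longrightarrow> \<not> smooth_at M p f \<Longrightarrow> v f = 0"
  by (induction v rule: tangent_induct) (auto simp: coord_vec_def)

lemma tangent_cong:
  assumes v: "v \<in> tangent_space M p" and W: "open W" "p \<in> W" and eq: "\<And>q. q \<in> W \<Longrightarrow> f q = h q"
  shows "v f = v h"
  using v
proof (induction v rule: tangent_induct)
  fix U x i assume U: "(U, x) \<in> charts M" "p \<in> U" and i: "i < mdim M"
  have "smooth_at M p f \<longleftrightarrow> smooth_at M p h"
    using smooth_at_cong[OF W, of f h] smooth_at_cong[OF W, of h f] eq by auto
  moreover have "partial i (f \<circ> inv_into U x) (x p) = partial i (h \<circ> inv_into U x) (x p)"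
    by (rule partial_cong[OF chart_image_open[OF U(1) W(1)]]) (use U W eq i in auto)
  ultimately show "coord_vec U x i p f = coord_vec U x i p h" by (simp add: coord_vec_def)
qed auto

lemma tangent_fun_add:
  assumes v: "v \<in> tangent_space M p" and f: "smooth_at M p f" and h: "smooth_at M p h"
  shows "v (\<lambda>q. f q + h q) = v f + v h"
  using v
proof (induction v rule: tangent_induct)
  fix U x i assume U: "(U, x) \<in> charts M" "p \<in> U" and i: "i < mdim M"
  show "coord_vec U x i p (\<lambda>q. f q + h q) = coord_vec U x i p f + coord_vec U x i p h"
    using DERIV_add[OF smooth_at_partial[OF f U i] smooth_at_partial[OF h U i]] f h smooth_at_add[OF f h]
    by (auto simp: coord_vec_def intro!: partial_eqI)
qed (auto simp: algebra_simps)

lemma tangent_fun_mult: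
  assumes v: "v \<in> tangent_space M p" and f: "smooth_at M p f" and h: "smooth_at M p h"
  shows "v (\<lambda>q. f q * h q) = v f * h p + f p * v h"
  using v
proof (induction v rule: tangent_induct)
  fix U x i assume U: "(U, x) \<in> charts M" "p \<in> U" and i: "i < mdim M"
  show "coord_vec U x i p (\<lambda>q. f q * h q) = coord_vec U x i p f * h p + f p * coord_vec U x i p h"
    using DERIV_mult[OF smooth_at_partial[OF f U i] smooth_at_partial[OF h U i]]
      f h smooth_at_mult[OF f h] U
    by (auto simp: coord_vec_def mult.commute intro!: partial_eqI)
qed (auto simp: algebra_simps)

lemma tangent_fun_const: "v \<in> tangent_space M p \<Longrightarrow> v (\<lambda>q. c) = 0"
proof (induction v rule: tangent_induct)
  fix U x i show "coord_vec U x i p (\<lambda>q. c) = 0"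
    by (auto simp: coord_vec_def intro!: partial_eqI)
qed auto

end

section \<open>Vector fields and metrics\<close>

lemma linear_on_add: "linear_on V f \<Longrightarrow> u \<in> V \<Longrightarrow> v \<in> V \<Longrightarrow> f (u + v) = f u + f v"
  and linear_on_scale: "linear_on V f \<Longrightarrow> v \<in> V \<Longrightarrow> f (c *\<^sub>R v) = c *\<^sub>R f v"
  unfolding linear_on_def by blast+

context smooth_mfd
begin

lemma vf_open: "vector_field M W X \<Longrightarrow> open W"
  and vf_tangent: "vector_field M W X \<Longrightarrow> p \<in> W \<Longrightarrow> X p \<in> tangent_space M p"
  unfolding vector_field_def by blast+

lemma vf_apply: "vector_field M W X \<Longrightarrow> smooth_fun M V f \<Longrightarrow> V \<subseteq> W \<Longrightarrow> smooth_fun M V (\<lambda>p. X p f)"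
  unfolding vector_field_def by blast

lemma vector_fieldI:
  assumes "open W" "\<And>p. p \<in> W \<Longrightarrow> X p \<in> tangent_space M p"
    "\<And>V f. V \<subseteq> W \<Longrightarrow> smooth_fun M V f \<Longrightarrow> smooth_fun M V (\<lambda>p. X p f)"
  shows "vector_field M W X"
  using assms unfolding vector_field_def by blast

lemma vf_subset:
  assumes "vector_field M W X" "open W'" "W' \<subseteq> W"
  shows "vector_field M W' X"
  using assms by (intro vector_fieldI) (auto intro: vf_tangent vf_apply)

lemma vf_cong:
  assumes "vector_field M W X" "\<And>p. p \<in> W \<Longrightarrow> X p = Y p"
  shows "vector_field M W Y"
proof (rule vector_fieldI)
  show "open W" using assms(1) by (rule vf_open)
  show "Y p \<in> tangent_space M p" if "p \<in> W" for p using vf_tangent[OF assms(1) that] assms(2)[OF that] by simp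
  fix V f assume V: "V \<subseteq> W" "smooth_fun M V f"
  show "smooth_fun M V (\<lambda>p. Y p f)"
    by (rule smooth_fun_cong[OF vf_apply[OF assms(1) V(2,1)]]) (use V(1) assms(2) in auto)
qed

lemma vf_add: "vector_field M W X \<Longrightarrow> vector_field M W Y \<Longrightarrow> vector_field M W (\<lambda>q. X q + Y q)"
proof (rule vector_fieldI)
  assume X: "vector_field M W X" and Y: "vector_field M W Y"
  show "open W" using X by (rule vf_open)
  show "X p + Y p \<in> tangent_space M p" if "p \<in> W" for p
    using vf_tangent[OF X that] vf_tangent[OF Y that] by (rule tangent_add)
  fix V f assume V: "V \<subseteq> W" "smooth_fun M V f"
  show "smooth_fun M V (\<lambda>p. (X p + Y p) f)"
    using smooth_fun_add[OF vf_apply[OF X V(2,1)] vf_apply[OF Y V(2,1)]] by simp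
qed

lemma vf_scale:
  assumes "smooth_fun M W f" "vector_field M W X"
  shows "vector_field M W (\<lambda>q. f q *\<^sub>R X q)"
proof (rule vector_fieldI)
  show "open W" using assms(2) by (rule vf_open)
  show "f p *\<^sub>R X p \<in> tangent_space M p" if "p \<in> W" for p
    using vf_tangent[OF assms(2) that] by (rule tangent_scale)
  fix V h assume V: "V \<subseteq> W" "smooth_fun M V h"
  show "smooth_fun M V (\<lambda>p. (f p *\<^sub>R X p) h)"
    using smooth_fun_mult[OF smooth_fun_subset[OF assms(1) smooth_fun_open[OF V(2)] V(1)]
        vf_apply[OF assms(2) V(2,1)]] by simp
qed

lemma vf_zero: "open W \<Longrightarrow> vector_field M W (\<lambda>q. 0)"
  by (rule vector_fieldI) (auto intro: tangent_zero smooth_fun_const smooth_fun_open)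

lemma vf_sum:
  assumes "open W" "\<And>a. a \<in> A \<Longrightarrow> vector_field M W (X a)"
  shows "vector_field M W (\<lambda>q. \<Sum>a\<in>A. X a q)"
  using assms(2)
  by (induction A rule: infinite_finite_induct) (auto intro: vf_zero[OF assms(1)] vf_add simp del: plus_fun_apply)

lemma vf_cscale:
  assumes "vector_field M W X"
  shows "vector_field M W (\<lambda>q. c *\<^sub>R X q)"
  using vf_scale[OF smooth_fun_const[OF vf_open[OF assms]] assms] .

lemma vf_diff:
  assumes "vector_field M W X" "vector_field M W Y"
  shows "vector_field M W (\<lambda>q. X q - Y q)"
  using vf_add[OF assms(1) vf_cscale[OF assms(2), of "-1"]] by simp

lemma vf_lincomb:
  assumes "open W" "\<And>a. a \<in> A \<Longrightarrow> smooth_fun M W (c a)" "\<And>a. a \<in> A \<Longrightarrow> vector_field M W (X a)"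
  shows "vector_field M W (\<lambda>q. \<Sum>a\<in>A. c a q *\<^sub>R X a q)"
  by (rule vf_sum[OF assms(1) vf_scale[OF assms(2,3)]])

lemma vf_apply_at:
  assumes "vector_field M W X" "p \<in> W" "smooth_at M p f"
  shows "smooth_at M p (\<lambda>q. X q f)"
proof -
  obtain V where V: "p \<in> V" "smooth_fun M V f" using assms(3) unfolding smooth_at_def by blast
  have "smooth_fun M (V \<inter> W) f"
    by (rule smooth_fun_subset[OF V(2)]) (use smooth_fun_open[OF V(2)] vf_open[OF assms(1)] in auto)
  from vf_apply[OF assms(1) this] have "smooth_fun M (V \<inter> W) (\<lambda>q. X q f)" by simp
  then show ?thesis by (rule smooth_atI) (use V(1) assms(2) in simp)
qed

lemma vf_coord_vec:
  assumes U: "(U, x) \<in> charts M" and i: "i < mdim M"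
  shows "vector_field M U (coord_vec U x i)"
proof (rule vector_fieldI)
  show "open U" using U by (rule chart_open)
  show "coord_vec U x i p \<in> tangent_space M p" if "p \<in> U" for p using coord_vec_in[OF U that i] .
  fix V f assume V: "V \<subseteq> U" "smooth_fun M V f"
  show "smooth_fun M V (\<lambda>p. coord_vec U x i p f)"
  proof (rule smooth_fun_chartI[OF smooth_fun_open[OF V(2)]])
    fix p assume p: "p \<in> V"
    have "Ck (mdim M) k (x ` (U \<inter> V)) (\<lambda>z. coord_vec U x i (inv_into U x z) f)" for k
    proof (rule Ck_cong[OF chart_image_open[OF U smooth_fun_open[OF V(2)]] _ Ck_SucD(2)[OF smooth_funD[OF V(2) U] i]])
      fix z assume "z \<in> x ` (U \<inter> V)"
      then obtain q where "q \<in> U" "q \<in> V" "z = x q" by blast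
      then show "partial i (f \<circ> inv_into U x) z = coord_vec U x i (inv_into U x z) f"
        using U smooth_atI[OF V(2)] by (simp add: coord_vec_def)
    qed
    then show "\<exists>U' x' W'. (U', x') \<in> charts M \<and> p \<in> U' \<and> open W' \<and> p \<in> W' \<and>
       (\<forall>k. Ck (mdim M) k (x' ` (U' \<inter> W')) (\<lambda>z. coord_vec U x i (inv_into U' x' z) f))"
      using U V(1) p smooth_fun_open[OF V(2)] by blast
  qed
qed

text \<open>Constant coefficients with respect to one chart extend all the vectors over a single
  common domain.\<close>

lemma vf_extend_common:
  assumes "\<And>a. a < (k::nat) \<Longrightarrow> u a \<in> tangent_space M p"
  shows "\<exists>W X. open W \<and> p \<in> W \<and> (\<forall>a<k. vector_field M W (X a) \<and> X a p = u a)"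
proof -
  obtain U x where U: "(U, x) \<in> charts M" "p \<in> U" using chart_cover by blast
  have "vector_field M U (\<lambda>q. \<Sum>i<mdim M. u a (\<lambda>q. x q i) *\<^sub>R coord_vec U x i q)" for a
    by (intro vf_sum vf_cscale vf_coord_vec chart_open[OF U(1)] U(1)) auto
  moreover have "(\<Sum>i<mdim M. u a (\<lambda>q. x q i) *\<^sub>R coord_vec U x i p) = u a" if "a < k" for a
    using tangent_expand[OF U assms[OF that]] by simp
  ultimately show ?thesis using U(2) chart_open[OF U(1)]
    by (intro exI[of _ U] exI[of _ "\<lambda>a q. \<Sum>i<mdim M. u a (\<lambda>q. x q i) *\<^sub>R coord_vec U x i q"])
      simp
qed

section \<open>Calculus of Lie brackets\<close>

lemma lie_bracket_apply:
  "smooth_at M p f \<Longrightarrow> lie_bracket M X Y p f = X p (\<lambda>q. Y q f) - Y p (\<lambda>q. X q f)"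
  by (simp add: lie_bracket_def)

lemma lie_bracket_antisym: "lie_bracket M X Y p = - lie_bracket M Y X p"
  by (auto simp: lie_bracket_def fun_eq_iff)

lemma lie_bracket_cong:
  assumes W: "open W" "p \<in> W" and X: "X p \<in> tangent_space M p" and Y: "Y p \<in> tangent_space M p"
    and eq: "\<And>q. q \<in> W \<Longrightarrow> X q = X' q" "\<And>q. q \<in> W \<Longrightarrow> Y q = Y' q"
  shows "lie_bracket M X Y p = lie_bracket M X' Y' p"
proof -
  have "X p (\<lambda>q. Y q f) = X p (\<lambda>q. Y' q f)" "Y p (\<lambda>q. X q f) = Y p (\<lambda>q. X' q f)" for f
    by (auto intro!: tangent_cong[OF X W] tangent_cong[OF Y W] simp: eq)
  then show ?thesis using eq W(2) by (simp add: lie_bracket_def fun_eq_iff)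
qed

lemma lie_bracket_add_left:
  assumes "vector_field M W X" "vector_field M W Y" "vector_field M W Z" "p \<in> W"
  shows "lie_bracket M (\<lambda>q. X q + Y q) Z p = lie_bracket M X Z p + lie_bracket M Y Z p"
proof
  fix f
  show "lie_bracket M (\<lambda>q. X q + Y q) Z p f = (lie_bracket M X Z p + lie_bracket M Y Z p) f"
  proof (cases "smooth_at M p f")
    case True
    then have "Z p (\<lambda>q. X q f + Y q f) = Z p (\<lambda>q. X q f) + Z p (\<lambda>q. Y q f)"
      by (intro tangent_fun_add[OF vf_tangent[OF assms(3,4)]] vf_apply_at[OF assms(1,4)] vf_apply_at[OF assms(2,4)])
    then show ?thesis using True by (simp add: lie_bracket_def)
  qed (simp add: lie_bracket_def)
qed

lemma lie_bracket_scale_left: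
  assumes h: "smooth_fun M W h" and "vector_field M W X" "vector_field M W Y" "p \<in> W"
  shows "lie_bracket M (\<lambda>q. h q *\<^sub>R X q) Y p = h p *\<^sub>R lie_bracket M X Y p - Y p h *\<^sub>R X p"
proof
  fix f
  show "lie_bracket M (\<lambda>q. h q *\<^sub>R X q) Y p f = (h p *\<^sub>R lie_bracket M X Y p - Y p h *\<^sub>R X p) f"
  proof (cases "smooth_at M p f")
    case True
    have "Y p (\<lambda>q. h q * X q f) = Y p h * X p f + h p * Y p (\<lambda>q. X q f)"
      using tangent_fun_mult[OF vf_tangent[OF assms(3,4)] smooth_atI[OF h assms(4)]
          vf_apply_at[OF assms(2,4) True]] .
    then show ?thesis using True by (simp add: lie_bracket_def algebra_simps)
  next
    \<comment> \<open>On functions that are not smooth the bracket is 0 by convention; the extra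
      term vanishes because \<open>X p\<close> has the same default.\<close>
    case False
    then show ?thesis using tangent_not_smooth[OF vf_tangent[OF assms(2,4)]] by (simp add: lie_bracket_def)
  qed
qed

lemma lie_bracket_add_right:
  assumes "vector_field M W X" "vector_field M W Y" "vector_field M W Z" "p \<in> W"
  shows "lie_bracket M Z (\<lambda>q. X q + Y q) p = lie_bracket M Z X p + lie_bracket M Z Y p"
  using lie_bracket_add_left[OF assms] lie_bracket_antisym[of Z] by (simp del: plus_fun_apply)

lemma lie_bracket_scale_right:
  assumes "smooth_fun M W h" "vector_field M W X" "vector_field M W Y" "p \<in> W"
  shows "lie_bracket M Y (\<lambda>q. h q *\<^sub>R X q) p = h p *\<^sub>R lie_bracket M Y X p + Y p h *\<^sub>R X p"
  using lie_bracket_scale_left[OF assms] lie_bracket_antisym[of Y] by (simp del: plus_fun_apply)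

end

locale riemannian_mfd = smooth_mfd +
  fixes g :: "'a metric"
  assumes metric: "riemannian_metric M g"
begin

lemma metric_linear: "u \<in> tangent_space M p \<Longrightarrow> linear_on (tangent_space M p) (g p u)"
  and metric_sym: "u \<in> tangent_space M p \<Longrightarrow> v \<in> tangent_space M p \<Longrightarrow> g p u v = g p v u"
  and metric_pos: "u \<in> tangent_space M p \<Longrightarrow> u \<noteq> 0 \<Longrightarrow> g p u u > 0"
  using spec[OF conjunct1[OF metric[unfolded riemannian_metric_def]], of p] by simp_all

lemma metric_smooth:
  "vector_field M W X \<Longrightarrow> vector_field M W Y \<Longrightarrow> smooth_fun M W (\<lambda>p. g p (X p) (Y p))"
  using conjunct2[OF metric[unfolded riemannian_metric_def]] by simp

lemma metric_add_right:
  "u \<in> tangent_space M p \<Longrightarrow> v \<in> tangent_space M p \<Longrightarrow> w \<in> tangent_space M p \<Longrightarrow>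
   g p u (v + w) = g p u v + g p u w"
  using linear_on_add[OF metric_linear] .

lemma metric_add_left:
  "u \<in> tangent_space M p \<Longrightarrow> v \<in> tangent_space M p \<Longrightarrow> w \<in> tangent_space M p \<Longrightarrow>
   g p (u + v) w = g p u w + g p v w"
  using metric_add_right[of w p u v] by (simp add: metric_sym tangent_add del: plus_fun_apply)

lemma metric_scale_right:
  "u \<in> tangent_space M p \<Longrightarrow> v \<in> tangent_space M p \<Longrightarrow> g p u (c *\<^sub>R v) = c * g p u v"
  using linear_on_scale[OF metric_linear] by simp

lemma metric_scale_left:
  "u \<in> tangent_space M p \<Longrightarrow> v \<in> tangent_space M p \<Longrightarrow> g p (c *\<^sub>R u) v = c * g p u v"
  using metric_scale_right[of v p u c] by (simp add: metric_sym tangent_scale)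

lemma metric_sum_right:
  "u \<in> tangent_space M p \<Longrightarrow> (\<And>a. a \<in> A \<Longrightarrow> v a \<in> tangent_space M p) \<Longrightarrow>
   g p u (\<Sum>a\<in>A. v a) = (\<Sum>a\<in>A. g p u (v a))"
  using linear_on_sum[OF subspace_tangent_space metric_linear] .

lemma metric_sum_left:
  assumes "u \<in> tangent_space M p" "\<And>a. a \<in> A \<Longrightarrow> v a \<in> tangent_space M p"
  shows "g p (\<Sum>a\<in>A. v a) u = (\<Sum>a\<in>A. g p (v a) u)"
proof -
  have "g p (\<Sum>a\<in>A. v a) u = g p u (\<Sum>a\<in>A. v a)"
    by (rule metric_sym[OF tangent_sum[OF assms(2)] assms(1)])
  also have "\<dots> = (\<Sum>a\<in>A. g p u (v a))" by (rule metric_sum_right[OF assms])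
  also have "\<dots> = (\<Sum>a\<in>A. g p (v a) u)"
    by (intro sum.cong refl metric_sym[OF assms(1)] assms(2))
  finally show ?thesis .
qed

lemma metric_diff_right:
  "u \<in> tangent_space M p \<Longrightarrow> v \<in> tangent_space M p \<Longrightarrow> w \<in> tangent_space M p \<Longrightarrow>
   g p u (v - w) = g p u v - g p u w"
  using metric_add_right[of u p v "(-1) *\<^sub>R w"] metric_scale_right[of u p w "-1"] tangent_scale[of w p "-1"]
  by (simp del: plus_fun_apply minus_apply)

lemma metric_diff_left:
  "u \<in> tangent_space M p \<Longrightarrow> v \<in> tangent_space M p \<Longrightarrow> w \<in> tangent_space M p \<Longrightarrow>
   g p (u - v) w = g p u w - g p v w"
  using metric_diff_right[of w p u v] by (simp add: metric_sym tangent_diff del: minus_apply)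

lemma metric_neg_left:
  "u \<in> tangent_space M p \<Longrightarrow> v \<in> tangent_space M p \<Longrightarrow> g p (- u) v = - g p u v"
  using metric_scale_left[of u p v "-1"] by simp

lemma metric_neg_right:
  "u \<in> tangent_space M p \<Longrightarrow> v \<in> tangent_space M p \<Longrightarrow> g p u (- v) = - g p u v"
  using metric_scale_right[of u p v "-1"] by simp

lemma metric_zero_right: "u \<in> tangent_space M p \<Longrightarrow> g p u 0 = 0"
  using metric_scale_right[of u p u 0] by simp

lemma metric_zero_left: "u \<in> tangent_space M p \<Longrightarrow> g p 0 u = 0"
  using metric_scale_left[of u p u 0] by simp

lemma orthogonal_independent:
  assumes S: "finite S" "S \<subseteq> tangent_space M p" "0 \<notin> S"
    and orth: "\<And>u v. u \<in> S \<Longrightarrow> v \<in> S \<Longrightarrow> u \<noteq> v \<Longrightarrow> g p u v = 0"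
  shows "independent S"
proof
  assume "dependent S"
  then obtain c v where c: "v \<in> S" "c v \<noteq> 0" "(\<Sum>u\<in>S. c u *\<^sub>R u) = 0"
    unfolding dependent_finite[OF S(1)] by blast
  have vT: "v \<in> tangent_space M p" using c(1) S(2) by blast
  have "0 = g p v (\<Sum>u\<in>S. c u *\<^sub>R u)" using c(3) metric_zero_right[OF vT] by simp
  also have "\<dots> = (\<Sum>u\<in>S. g p v (c u *\<^sub>R u))"
    by (rule metric_sum_right[OF vT]) (use S(2) in \<open>auto intro: tangent_scale\<close>)
  also have "\<dots> = (\<Sum>u\<in>S. if u = v then c v * g p v v else 0)"
  proof (rule sum.cong[OF refl])
    fix u assume u: "u \<in> S"
    then have "u \<in> tangent_space M p" using S(2) by blast
    then show "g p v (c u *\<^sub>R u) = (if u = v then c v * g p v v else 0)"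
      using metric_scale_right[OF vT] orth[OF c(1) u] by auto
  qed
  also have "\<dots> = c v * g p v v" using c(1) S(1) by simp
  finally show False using metric_pos[OF vT] c(1,2) S(3) by auto
qed

text \<open>A nonzero remainder \<open>w\<close> would be orthogonal to every \<open>e a\<close> and
  produce \<open>mdim M + 1\<close> independent vectors in the span of \<open>mdim M\<close>
  coordinate vectors.\<close>

lemma orthonormal_expand:
  assumes e: "\<And>a. a < mdim M \<Longrightarrow> e a \<in> tangent_space M p"
    and on: "\<And>a b. a < mdim M \<Longrightarrow> b < mdim M \<Longrightarrow> g p (e a) (e b) = (if a = b then 1 else 0)"
    and v: "v \<in> tangent_space M p"
  shows "v = (\<Sum>a<mdim M. g p v (e a) *\<^sub>R e a)"
proof (rule ccontr)
  define w where "w = v - (\<Sum>a<mdim M. g p v (e a) *\<^sub>R e a)"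
  assume "v \<noteq> (\<Sum>a<mdim M. g p v (e a) *\<^sub>R e a)"
  then have w0: "w \<noteq> 0" unfolding w_def by (simp del: minus_apply)
  have sT: "(\<Sum>a<mdim M. g p v (e a) *\<^sub>R e a) \<in> tangent_space M p"
    by (intro tangent_sum tangent_scale e) auto
  have wT: "w \<in> tangent_space M p" unfolding w_def using v sT by (rule tangent_diff)
  have we: "g p w (e b) = 0" if b: "b < mdim M" for b
  proof -
    have "g p (\<Sum>a<mdim M. g p v (e a) *\<^sub>R e a) (e b) = (\<Sum>a<mdim M. if a = b then g p v (e b) else 0)"
      using e b on by (subst metric_sum_left) (auto intro!: tangent_scale sum.cong simp: metric_scale_left simp del: sum.delta sum.delta')
    then show ?thesis using b metric_diff_left[OF v sT e[OF b]] unfolding w_def by (simp del: minus_apply)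
  qed
  have inj: "inj_on e {..<mdim M}" using on by (auto simp: inj_on_def) (metis zero_neq_one)
  have w_notin: "w \<notin> e ` {..<mdim M}" using we on by fastforce
  have e0: "e a \<noteq> 0" if "a < mdim M" for a
    using on[OF that that] metric_zero_left[OF e[OF that]] by auto
  have "independent (insert w (e ` {..<mdim M}))"
  proof (rule orthogonal_independent[of _ p])
    fix u v assume "u \<in> insert w (e ` {..<mdim M})" "v \<in> insert w (e ` {..<mdim M})" "u \<noteq> v"
    then show "g p u v = 0" using we on metric_sym[OF wT e] by auto
  qed (use wT e e0 w0 in auto)
  moreover obtain U x where U: "(U, x) \<in> charts M" "p \<in> U" using chart_cover by blast
  let ?C = "(\<lambda>i. coord_vec U x i p) ` {..<mdim M}"
  have "insert w (e ` {..<mdim M}) \<subseteq> span ?C"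
    using wT e unfolding tangent_space_span[OF U] by auto
  ultimately have "card (insert w (e ` {..<mdim M})) \<le> card ?C"
    using independent_span_bound[of ?C] by simp
  also have "\<dots> \<le> mdim M" using card_image_le[of "{..<mdim M}"] by simp
  finally show False using w_notin inj by (simp add: card_image)
qed

lemma metric_orthonormal_expand:
  assumes e: "\<And>a. a < mdim M \<Longrightarrow> e a \<in> tangent_space M p"
    and on: "\<And>a b. a < mdim M \<Longrightarrow> b < mdim M \<Longrightarrow> g p (e a) (e b) = (if a = b then 1 else 0)"
    and u: "u \<in> tangent_space M p" and v: "v \<in> tangent_space M p"
  shows "g p u v = (\<Sum>a<mdim M. g p u (e a) * g p v (e a))"
proof -
  have "g p u v = g p u (\<Sum>a<mdim M. g p v (e a) *\<^sub>R e a)"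
    using orthonormal_expand[OF e on v] by simp
  also have "\<dots> = (\<Sum>a<mdim M. g p u (g p v (e a) *\<^sub>R e a))"
    by (rule metric_sum_right[OF u]) (auto intro: tangent_scale e)
  also have "\<dots> = (\<Sum>a<mdim M. g p u (e a) * g p v (e a))"
    by (intro sum.cong refl) (auto simp: metric_scale_right[OF u e])
  finally show ?thesis .
qed

text \<open>Independence at the single point \<open>p\<close> is enough: the remainder
  \<open>Z\<close> after projection is nonzero at \<open>p\<close>, hence nearby by continuity of
  its squared length, and the domain shrinks at each step. Thanks to the span clause, fields with
  values in a distribution give an orthonormal system in the same distribution.\<close>

lemma gram_schmidt:
  fixes k :: nat
  assumes W: "open W" "p \<in> W" and Y: "\<And>a. a < k \<Longrightarrow> vector_field M W (Y a)"
    and indep: "\<And>a. a < k \<Longrightarrow> Y a p \<notin> span ((\<lambda>b. Y b p) ` {..<a})"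
  shows "\<exists>V f. open V \<and> p \<in> V \<and> V \<subseteq> W \<and> (\<forall>a<k. vector_field M V (f a)) \<and>
     (\<forall>q\<in>V. \<forall>a<k. \<forall>b<k. g q (f a q) (f b q) = (if a = b then 1 else 0)) \<and>
     (\<forall>q\<in>V. \<forall>a<k. f a q \<in> span ((\<lambda>b. Y b q) ` {..<k}))"
  using Y indep
proof (induct k)
  case 0
  then show ?case using W by auto
next
  case (Suc k)
  have "\<exists>V f. open V \<and> p \<in> V \<and> V \<subseteq> W \<and> (\<forall>a<k. vector_field M V (f a)) \<and>
     (\<forall>q\<in>V. \<forall>a<k. \<forall>b<k. g q (f a q) (f b q) = (if a = b then 1 else 0)) \<and>
     (\<forall>q\<in>V. \<forall>a<k. f a q \<in> span ((\<lambda>b. Y b q) ` {..<k}))"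
    by (rule Suc.hyps) (use Suc.prems in auto)
  then obtain V f where Vf: "open V \<and> p \<in> V \<and> V \<subseteq> W \<and> (\<forall>a<k. vector_field M V (f a)) \<and>
     (\<forall>q\<in>V. \<forall>a<k. \<forall>b<k. g q (f a q) (f b q) = (if a = b then 1 else 0)) \<and>
     (\<forall>q\<in>V. \<forall>a<k. f a q \<in> span ((\<lambda>b. Y b q) ` {..<k}))"
    by (elim exE)
  then have V: "open V" "p \<in> V" "V \<subseteq> W"
    and f: "\<And>a. a < k \<Longrightarrow> vector_field M V (f a)"
    and on: "\<And>q a b. q \<in> V \<Longrightarrow> a < k \<Longrightarrow> b < k \<Longrightarrow> g q (f a q) (f b q) = (if a = b then 1 else 0)"
    and sp: "\<And>q a. q \<in> V \<Longrightarrow> a < k \<Longrightarrow> f a q \<in> span ((\<lambda>b. Y b q) ` {..<k})"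
    by simp_all
  have Yk: "vector_field M V (Y k)" using vf_subset[OF Suc.prems(1) V(1,3)] by simp
  define P where "P q = (\<Sum>a<k. g q (Y k q) (f a q) *\<^sub>R f a q)" for q
  define Z where "Z q = Y k q - P q" for q
  have Pv: "vector_field M V P"
    unfolding P_def using f by (intro vf_lincomb V(1) metric_smooth Yk) auto
  have Zv: "vector_field M V Z" unfolding Z_def using Yk Pv by (rule vf_diff)
  have Zf: "g q (Z q) (f b q) = 0" if q: "q \<in> V" and b: "b < k" for q b
  proof -
    have "g q (P q) (f b q) = (\<Sum>a<k. g q (g q (Y k q) (f a q) *\<^sub>R f a q) (f b q))"
      unfolding P_def by (rule metric_sum_left) (auto intro!: tangent_scale vf_tangent[OF f q] b)
    also have "\<dots> = (\<Sum>a<k. if a = b then g q (Y k q) (f b q) else 0)"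
      by (intro sum.cong refl) (simp add: metric_scale_left vf_tangent[OF f q] b on[OF q])
    also have "\<dots> = g q (Y k q) (f b q)" using b by simp
    finally show ?thesis unfolding Z_def
      using metric_diff_left[OF vf_tangent[OF Yk q] vf_tangent[OF Pv q] vf_tangent[OF f[OF b] q]]
      by (simp del: minus_apply)
  qed
  have Psp: "P q \<in> span ((\<lambda>b. Y b q) ` {..<k})" if "q \<in> V" for q
    unfolding P_def by (auto intro!: span_sum span_scale sp[OF that])
  have "Z p \<noteq> 0"
  proof
    assume "Z p = 0"
    then have "Y k p = P p" unfolding Z_def by (simp del: minus_apply)
    then show False using Psp[OF V(2)] Suc.prems(2)[of k] by simp
  qed
  define h where "h q = g q (Z q) (Z q)" for q
  have h: "smooth_fun M V h" unfolding h_def by (rule metric_smooth[OF Zv Zv])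
  define V' where "V' = V \<inter> h -` {0<..}"
  have V'o: "open V'"
    unfolding V'_def using continuous_open_preimage[OF smooth_fun_continuous[OF h] V(1)] by simp
  have V'p: "p \<in> V'" unfolding V'_def h_def using V(2) metric_pos[OF vf_tangent[OF Zv V(2)] \<open>Z p \<noteq> 0\<close>] by simp
  have V'V: "V' \<subseteq> V" unfolding V'_def by blast
  \<comment> \<open>Inverse length of \<open>Z\<close>, written as a real power so that
    \<open>smooth_fun_powr\<close> gives its smoothness.\<close>
  define r where "r q = h q powr (-1/2)" for q
  have r: "smooth_fun M V' r"
    unfolding r_def by (rule smooth_fun_powr[OF smooth_fun_subset[OF h V'o V'V]]) (auto simp: V'_def)
  have rh: "r q * (r q * h q) = 1" if "q \<in> V'" for q
  proof -
    have "h q > 0" using that by (simp add: V'_def)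
    then show ?thesis unfolding r_def by (simp add: powr_half_sqrt powr_minus field_simps)
  qed
  define f' where "f' a q = (if a < k then f a q else r q *\<^sub>R Z q)" for a q
  have f'k: "f' k = (\<lambda>q. r q *\<^sub>R Z q)" and f'a: "\<And>a. a < k \<Longrightarrow> f' a = f a"
    by (auto simp: f'_def fun_eq_iff)
  have vf': "vector_field M V' (f' a)" if "a < Suc k" for a
    using that vf_subset[OF f V'o V'V] vf_scale[OF r vf_subset[OF Zv V'o V'V]]
    by (auto simp: less_Suc_eq f'k f'a)
  have on': "g q (f' a q) (f' b q) = (if a = b then 1 else 0)"
    if q: "q \<in> V'" and ab: "a < Suc k" "b < Suc k" for q a b
  proof -
    have qV: "q \<in> V" using q V'V by blast
    have ZT: "Z q \<in> tangent_space M q" by (rule vf_tangent[OF Zv qV])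
    have kk: "g q (r q *\<^sub>R Z q) (r q *\<^sub>R Z q) = 1"
      using rh[OF q] by (simp add: metric_scale_left metric_scale_right ZT tangent_scale h_def)
    have kb: "g q (r q *\<^sub>R Z q) (f b q) = 0" if "b < k" for b
      using Zf[OF qV that] by (simp add: metric_scale_left ZT vf_tangent[OF f[OF that] qV])
    have bk: "g q (f b q) (r q *\<^sub>R Z q) = 0" if "b < k" for b
      using kb[OF that] metric_sym[OF vf_tangent[OF f[OF that] qV] tangent_scale[OF ZT]] by simp
    show ?thesis using ab kk kb bk on[OF qV] by (auto simp: less_Suc_eq f'k f'a)
  qed
  have sp': "f' a q \<in> span ((\<lambda>b. Y b q) ` {..<Suc k})" if q: "q \<in> V'" and a: "a < Suc k" for q a
  proof -
    have qV: "q \<in> V" using q V'V by blast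
    have mono: "span ((\<lambda>b. Y b q) ` {..<k}) \<subseteq> span ((\<lambda>b. Y b q) ` {..<Suc k})"
      by (intro span_mono image_mono) auto
    have "Z q \<in> span ((\<lambda>b. Y b q) ` {..<Suc k})"
      unfolding Z_def using Psp[OF qV] mono by (intro span_diff) (auto intro: span_base)
    then show ?thesis using sp[OF qV] mono a by (auto simp: less_Suc_eq f'k f'a intro: span_scale)
  qed
  show ?case
    by (intro exI[of _ V'] exI[of _ f'] conjI ballI allI impI V'o V'p subset_trans[OF V'V V(3)]
        vf' on' sp')
qed

end

section \<open>Affine connections and curvature\<close>

text \<open>The simplifier also uses these rules on unapplied functions, turning sums of tangent vectors into
  abstractions.\<close>

declare scaleR_fun_apply [simp del] plus_fun_apply [simp del] zero_fun_apply [simp del]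
  minus_apply [simp del] uminus_apply [simp del]

context riemannian_mfd
begin

section \<open>Orthonormal frames\<close>

lemma orthonormal_frame_vf: "orthonormal_frame M g W e \<Longrightarrow> a < mdim M \<Longrightarrow> vector_field M W (e a)"
  and orthonormal_frame_metric: "orthonormal_frame M g W e \<Longrightarrow> q \<in> W \<Longrightarrow> a < mdim M \<Longrightarrow> b < mdim M \<Longrightarrow>
    g q (e a q) (e b q) = (if a = b then 1 else 0)"
  by (simp_all add: orthonormal_frame_def)

lemma orthonormal_frame_tangent:
  "orthonormal_frame M g W e \<Longrightarrow> a < mdim M \<Longrightarrow> q \<in> W \<Longrightarrow> e a q \<in> tangent_space M q"
  by (rule vf_tangent[OF orthonormal_frame_vf])

lemma orthonormal_frame_subset:
  assumes "orthonormal_frame M g W e" "open V" "V \<subseteq> W"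
  shows "orthonormal_frame M g V e"
  using assms(1,3) vf_subset[OF orthonormal_frame_vf[OF assms(1)] assms(2,3)]
  by (auto simp: orthonormal_frame_def)

lemma frame_expand:
  assumes "orthonormal_frame M g W e" "q \<in> W" "v \<in> tangent_space M q"
  shows "v = (\<Sum>a<mdim M. g q v (e a q) *\<^sub>R e a q)"
  using assms(1,2)
  by (intro orthonormal_expand[OF _ _ assms(3)] orthonormal_frame_tangent orthonormal_frame_metric)

lemma metric_frame_expand:
  assumes "orthonormal_frame M g W e" "q \<in> W" "u \<in> tangent_space M q" "v \<in> tangent_space M q"
  shows "g q u v = (\<Sum>a<mdim M. g q u (e a q) * g q v (e a q))"
  using assms(1,2)
  by (intro metric_orthonormal_expand[OF _ _ assms(3,4)] orthonormal_frame_tangent orthonormal_frame_metric)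

lemma metric_lincomb_left:
  assumes "w \<in> tangent_space M p" "\<And>a. a \<in> A \<Longrightarrow> v a \<in> tangent_space M p"
  shows "g p (\<Sum>a\<in>A. c a *\<^sub>R v a) w = (\<Sum>a\<in>A. c a * g p (v a) w)"
  using assms by (subst metric_sum_left) (auto intro!: tangent_scale sum.cong simp: metric_scale_left)

lemma metric_lincomb_right:
  assumes "w \<in> tangent_space M p" "\<And>a. a \<in> A \<Longrightarrow> v a \<in> tangent_space M p"
  shows "g p w (\<Sum>a\<in>A. c a *\<^sub>R v a) = (\<Sum>a\<in>A. c a * g p w (v a))"
  using assms by (subst metric_sum_right) (auto intro!: tangent_scale sum.cong simp: metric_scale_right)

lemma orthonormal_frame_exists: "\<exists>W e. open W \<and> p \<in> W \<and> orthonormal_frame M g W e"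
proof -
  obtain U x where U: "(U, x) \<in> charts M" "p \<in> U" using chart_cover by blast
  have "coord_vec U x a p \<notin> span ((\<lambda>b. coord_vec U x b p) ` {..<a})" if a: "a < mdim M" for a
  proof
    assume sp: "coord_vec U x a p \<in> span ((\<lambda>b. coord_vec U x b p) ` {..<a})"
    \<comment> \<open>The \<open>a\<close>-th coordinate function is annihilated by the earlier
      coordinate vectors but not by the \<open>a\<close>-th one.\<close>
    have "subspace {v :: 'a tvec. v (\<lambda>q. x q a) = 0}" by (simp add: subspace_def plus_fun_apply zero_fun_apply scaleR_fun_apply)
    then have "span ((\<lambda>b. coord_vec U x b p) ` {..<a}) \<subseteq> {v. v (\<lambda>q. x q a) = 0}"
      using coord_vec_coordinate[OF U _ a] a by (intro span_minimal) auto
    then show False using sp coord_vec_coordinate[OF U a a] by auto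
  qed
  then have "\<exists>V f. open V \<and> p \<in> V \<and> V \<subseteq> U \<and> (\<forall>a<mdim M. vector_field M V (f a)) \<and>
     (\<forall>q\<in>V. \<forall>a<mdim M. \<forall>b<mdim M. g q (f a q) (f b q) = (if a = b then 1 else 0)) \<and>
     (\<forall>q\<in>V. \<forall>a<mdim M. f a q \<in> span ((\<lambda>b. coord_vec U x b q) ` {..<mdim M}))"
    by (intro gram_schmidt chart_open[OF U(1)] U(2) vf_coord_vec[OF U(1)])
  then obtain V f where "open V \<and> p \<in> V \<and> V \<subseteq> U \<and> (\<forall>a<mdim M. vector_field M V (f a)) \<and>
     (\<forall>q\<in>V. \<forall>a<mdim M. \<forall>b<mdim M. g q (f a q) (f b q) = (if a = b then 1 else 0)) \<and>
     (\<forall>q\<in>V. \<forall>a<mdim M. f a q \<in> span ((\<lambda>b. coord_vec U x b q) ` {..<mdim M}))"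
    by (elim exE)
  then show ?thesis
    by (intro exI[of _ V] exI[of _ f]) (simp add: orthonormal_frame_def)
qed

end

text \<open>Closure of vector fields under brackets is carried as an assumption. It does not involve
  \<open>D\<close>: torsion-freeness provides it for a Levi-Civita connection, and it is then at
  hand for the characteristic connection, which has torsion.\<close>

locale affine_mfd = smooth_mfd +
  fixes D :: "'a connection"
  assumes affine: "affine_connection M D"
    and bracket_vf: "\<And>W X Y. vector_field M W X \<Longrightarrow> vector_field M W Y \<Longrightarrow>
      vector_field M W (lie_bracket M X Y)"
begin

lemmas affineD = affine[unfolded affine_connection_def]

lemma conn_vf: "vector_field M W X \<Longrightarrow> vector_field M W Y \<Longrightarrow> vector_field M W (D X Y)"
  using conjunct1[OF affineD] by simp

lemma conn_cong:
  "vector_field M W X \<Longrightarrow> vector_field M W Y \<Longrightarrow> (\<And>q. q \<in> W \<Longrightarrow> X' q = X q) \<Longrightarrow>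
   (\<And>q. q \<in> W \<Longrightarrow> Y' q = Y q) \<Longrightarrow> p \<in> W \<Longrightarrow> D X' Y' p = D X Y p"
  using spec[OF spec[OF spec[OF spec[OF spec[OF conjunct1[OF conjunct2[OF affineD]]]]]], of W X Y X' Y'] by simp

lemma conn_add:
  assumes "vector_field M W X" "vector_field M W Y" "vector_field M W Z" "p \<in> W"
  shows conn_add_left: "D (\<lambda>q. X q + Y q) Z p = D X Z p + D Y Z p"
    and conn_add_right: "D X (\<lambda>q. Y q + Z q) p = D X Y p + D X Z p"
  using spec[OF spec[OF spec[OF spec[OF conjunct1[OF conjunct2[OF conjunct2[OF affineD]]]]]], of W X Y Z] assms
  by (simp_all add: plus_fun_def)

lemma conn_scale:
  assumes "smooth_fun M W f" "vector_field M W X" "vector_field M W Y" "p \<in> W"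
  shows conn_scale_left: "D (\<lambda>q. f q *\<^sub>R X q) Y p = f p *\<^sub>R D X Y p"
    and conn_scale_right: "D X (\<lambda>q. f q *\<^sub>R Y q) p = X p f *\<^sub>R Y p + f p *\<^sub>R D X Y p"
  using spec[OF spec[OF spec[OF spec[OF conjunct2[OF conjunct2[OF conjunct2[OF affineD]]]]]], of W f X Y] assms
  by simp_all

lemma conn_zero_left: "vector_field M W X \<Longrightarrow> p \<in> W \<Longrightarrow> D (\<lambda>q. 0) X p = 0"
  using conn_scale_left[OF smooth_fun_const[OF vf_open], of W X X X p 0] by simp

lemma conn_zero_right: "vector_field M W X \<Longrightarrow> p \<in> W \<Longrightarrow> D X (\<lambda>q. 0) p = 0"
  using conn_scale_right[OF smooth_fun_const[OF vf_open], of W X X X p 0]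
    tangent_fun_const[OF vf_tangent, of W X p 0] by simp

lemma conn_lincomb_left:
  assumes "\<And>a. a \<in> A \<Longrightarrow> smooth_fun M W (c a)" "\<And>a. a \<in> A \<Longrightarrow> vector_field M W (X a)"
    "vector_field M W Y" "p \<in> W"
  shows "D (\<lambda>q. \<Sum>a\<in>A. c a q *\<^sub>R X a q) Y p = (\<Sum>a\<in>A. c a p *\<^sub>R D (X a) Y p)"
  using assms(1,2)
proof (induction A rule: infinite_finite_induct)
  case (insert a A)
  have "D (\<lambda>q. c a q *\<^sub>R X a q + (\<Sum>a\<in>A. c a q *\<^sub>R X a q)) Y p =
    D (\<lambda>q. c a q *\<^sub>R X a q) Y p + D (\<lambda>q. \<Sum>a\<in>A. c a q *\<^sub>R X a q) Y p"
    by (rule conn_add_left[OF vf_scale vf_lincomb[OF vf_open[OF assms(3)]] assms(3,4)])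
      (use insert.prems in auto)
  then show ?case
    using insert conn_scale_left[OF insert.prems(1)[of a] insert.prems(2)[of a] assms(3,4)]
    by simp
qed (use conn_zero_left[OF assms(3,4)] in simp_all)

lemma conn_lincomb_right:
  assumes "\<And>a. a \<in> A \<Longrightarrow> smooth_fun M W (c a)" "\<And>a. a \<in> A \<Longrightarrow> vector_field M W (Y a)"
    "vector_field M W X" "p \<in> W"
  shows "D X (\<lambda>q. \<Sum>a\<in>A. c a q *\<^sub>R Y a q) p = (\<Sum>a\<in>A. X p (c a) *\<^sub>R Y a p + c a p *\<^sub>R D X (Y a) p)"
  using assms(1,2)
proof (induction A rule: infinite_finite_induct)
  case (insert a A)
  have "D X (\<lambda>q. c a q *\<^sub>R Y a q + (\<Sum>a\<in>A. c a q *\<^sub>R Y a q)) p =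
    D X (\<lambda>q. c a q *\<^sub>R Y a q) p + D X (\<lambda>q. \<Sum>a\<in>A. c a q *\<^sub>R Y a q) p"
    by (rule conn_add_right[OF assms(3) vf_scale vf_lincomb[OF vf_open[OF assms(3)]] assms(4)])
      (use insert.prems in auto)
  then show ?case
    using insert conn_scale_right[OF insert.prems(1)[of a] assms(3) insert.prems(2)[of a] assms(4)]
    by simp
qed (use conn_zero_right[OF assms(3,4)] in simp_all)

section \<open>Linearity of the curvature over smooth functions\<close>

lemma curvature_apply:
  "curvature M D X Y Z p = D X (D Y Z) p - D Y (D X Z) p - D (lie_bracket M X Y) Z p"
  by (simp only: curvature_def minus_apply)

lemma curvature_vf:
  assumes "vector_field M W X" "vector_field M W Y" "vector_field M W Z"
  shows "vector_field M W (curvature M D X Y Z)"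
  unfolding curvature_def
  using vf_diff[OF vf_diff[OF conn_vf[OF assms(1) conn_vf[OF assms(2,3)]] conn_vf[OF assms(2) conn_vf[OF assms(1,3)]]]
      conn_vf[OF bracket_vf[OF assms(1,2)] assms(3)]]
  by (simp add: fun_diff_def)

lemma curvature_cong:
  assumes X: "vector_field M W X" and Y: "vector_field M W Y" and Z: "vector_field M W Z"
    and X': "\<And>q. q \<in> W \<Longrightarrow> X' q = X q" and Y': "\<And>q. q \<in> W \<Longrightarrow> Y' q = Y q"
    and Z': "\<And>q. q \<in> W \<Longrightarrow> Z' q = Z q" and p: "p \<in> W"
  shows "curvature M D X' Y' Z' p = curvature M D X Y Z p"
proof -
  have "D X' (D Y' Z') p = D X (D Y Z) p"
    by (rule conn_cong[OF X conn_vf[OF Y Z] X' _ p]) (auto intro: conn_cong[OF Y Z Y' Z'])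
  moreover have "D Y' (D X' Z') p = D Y (D X Z) p"
    by (rule conn_cong[OF Y conn_vf[OF X Z] Y' _ p]) (auto intro: conn_cong[OF X Z X' Z'])
  moreover have "D (lie_bracket M X' Y') Z' p = D (lie_bracket M X Y) Z p"
  proof (rule conn_cong[OF bracket_vf[OF X Y] Z _ Z' p])
    fix q assume q: "q \<in> W"
    show "lie_bracket M X' Y' q = lie_bracket M X Y q"
      by (rule lie_bracket_cong[OF vf_open[OF X] q, symmetric])
        (use vf_tangent[OF X q] vf_tangent[OF Y q] X' Y' in simp_all)
  qed
  ultimately show ?thesis by (simp add: curvature_apply)
qed

lemma curvature_antisym:
  assumes "vector_field M W X" "vector_field M W Y" "vector_field M W Z" "p \<in> W"
  shows "curvature M D X Y Z p = - curvature M D Y X Z p"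
proof -
  have "D (lie_bracket M X Y) Z p = D (\<lambda>q. (-1) *\<^sub>R lie_bracket M Y X q) Z p"
    by (rule conn_cong[OF vf_cscale[OF bracket_vf[OF assms(2,1)]] assms(3) _ _ assms(4)])
      (use lie_bracket_antisym[of X Y] in simp_all)
  also have "\<dots> = (-1) *\<^sub>R D (lie_bracket M Y X) Z p"
    by (rule conn_scale_left[OF smooth_fun_const[OF vf_open[OF assms(1)]] bracket_vf[OF assms(2,1)] assms(3,4)])
  finally show ?thesis by (simp add: curvature_apply)
qed

lemma curvature_add_left:
  assumes "vector_field M W X" "vector_field M W Y" "vector_field M W Z" "vector_field M W V" "p \<in> W"
  shows "curvature M D (\<lambda>q. X q + Y q) Z V p = curvature M D X Z V p + curvature M D Y Z V p"
proof -
  note v = assms(1-4) conn_vf bracket_vf vf_add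
  have "D Z (D (\<lambda>q. X q + Y q) V) p = D Z (\<lambda>q. D X V q + D Y V q) p"
    by (rule conn_cong[OF assms(3) _ _ _ assms(5)]) (use conn_add_left[OF assms(1,2,4)] in \<open>auto intro: v\<close>)
  also have "\<dots> = D Z (D X V) p + D Z (D Y V) p" by (rule conn_add_right[where W=W]) (intro v assms(5))+
  finally have 1: "D Z (D (\<lambda>q. X q + Y q) V) p = D Z (D X V) p + D Z (D Y V) p" .
  have "D (lie_bracket M (\<lambda>q. X q + Y q) Z) V p = D (\<lambda>q. lie_bracket M X Z q + lie_bracket M Y Z q) V p"
    by (rule conn_cong[OF _ assms(4) _ _ assms(5)]) (use lie_bracket_add_left[OF assms(1-3)] in \<open>auto intro: v\<close>)
  also have "\<dots> = D (lie_bracket M X Z) V p + D (lie_bracket M Y Z) V p"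
    by (rule conn_add_left[where W=W]) (intro v assms(5))+
  finally have 2: "D (lie_bracket M (\<lambda>q. X q + Y q) Z) V p = D (lie_bracket M X Z) V p + D (lie_bracket M Y Z) V p" .
  have 3: "D (\<lambda>q. X q + Y q) (D Z V) p = D X (D Z V) p + D Y (D Z V) p"
    by (rule conn_add_left[where W=W]) (intro v assms(5))+
  show ?thesis unfolding curvature_apply 1 2 3 by (simp add: algebra_simps)
qed

text \<open>\<open>D Y\<close> differentiates the factor \<open>f\<close>, and the bracket of
  \<open>f X\<close> with \<open>Y\<close> contains \<open>- Y(f) X\<close>; the two resulting
  multiples of \<open>D X Z\<close> cancel.\<close>

lemma curvature_scale_left:
  assumes f: "smooth_fun M W f" and "vector_field M W X" "vector_field M W Y" "vector_field M W Z" "p \<in> W"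
  shows "curvature M D (\<lambda>q. f q *\<^sub>R X q) Y Z p = f p *\<^sub>R curvature M D X Y Z p"
proof -
  note v = assms(1-4) conn_vf bracket_vf
  have Yf: "smooth_fun M W (\<lambda>q. Y q f)" by (rule vf_apply[OF assms(3) f]) simp
  have "D Y (D (\<lambda>q. f q *\<^sub>R X q) Z) p = D Y (\<lambda>q. f q *\<^sub>R D X Z q) p"
    by (rule conn_cong[OF assms(3) _ _ _ assms(5)]) (use conn_scale_left[OF f assms(2,4)] in \<open>auto intro: v vf_scale\<close>)
  also have "\<dots> = Y p f *\<^sub>R D X Z p + f p *\<^sub>R D Y (D X Z) p"
    by (rule conn_scale_right[where W=W]) (intro v assms(5))+
  finally have 1: "D Y (D (\<lambda>q. f q *\<^sub>R X q) Z) p = Y p f *\<^sub>R D X Z p + f p *\<^sub>R D Y (D X Z) p" .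
  have "D (lie_bracket M (\<lambda>q. f q *\<^sub>R X q) Y) Z p =
      D (\<lambda>q. f q *\<^sub>R lie_bracket M X Y q + (- 1) *\<^sub>R (Y q f *\<^sub>R X q)) Z p"
  proof (rule conn_cong[OF _ assms(4) _ _ assms(5)])
    show "vector_field M W (\<lambda>q. f q *\<^sub>R lie_bracket M X Y q + (- 1) *\<^sub>R (Y q f *\<^sub>R X q))"
      by (intro vf_add vf_scale[OF f] vf_cscale vf_scale[OF Yf] v)
  qed (use lie_bracket_scale_left[OF f assms(2,3)] in simp_all)
  also have "\<dots> = D (\<lambda>q. f q *\<^sub>R lie_bracket M X Y q) Z p + D (\<lambda>q. (- 1) *\<^sub>R (Y q f *\<^sub>R X q)) Z p"
    by (intro conn_add_left[of W] vf_scale[OF f] vf_cscale vf_scale[OF Yf] v assms(5))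
  also have "D (\<lambda>q. f q *\<^sub>R lie_bracket M X Y q) Z p = f p *\<^sub>R D (lie_bracket M X Y) Z p"
    by (rule conn_scale_left[OF f bracket_vf[OF assms(2,3)] assms(4,5)])
  also have "D (\<lambda>q. (- 1) *\<^sub>R (Y q f *\<^sub>R X q)) Z p = (- 1) *\<^sub>R D (\<lambda>q. Y q f *\<^sub>R X q) Z p"
    by (rule conn_scale_left[OF smooth_fun_const[OF vf_open[OF assms(2)]] vf_scale[OF Yf assms(2)] assms(4,5)])
  also have "D (\<lambda>q. Y q f *\<^sub>R X q) Z p = Y p f *\<^sub>R D X Z p"
    by (rule conn_scale_left[OF Yf assms(2,4,5)])
  finally have 2: "D (lie_bracket M (\<lambda>q. f q *\<^sub>R X q) Y) Z p =
    f p *\<^sub>R D (lie_bracket M X Y) Z p + (- 1) *\<^sub>R (Y p f *\<^sub>R D X Z p)" .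
  have 3: "D (\<lambda>q. f q *\<^sub>R X q) (D Y Z) p = f p *\<^sub>R D X (D Y Z) p"
    by (rule conn_scale_left[OF f assms(2) conn_vf[OF assms(3,4)] assms(5)])
  show ?thesis unfolding curvature_apply 1 2 3 by (simp add: algebra_simps)
qed

lemma curvature_add_right:
  assumes "vector_field M W X" "vector_field M W Y" "vector_field M W Z" "vector_field M W V" "p \<in> W"
  shows "curvature M D Z (\<lambda>q. X q + Y q) V p = curvature M D Z X V p + curvature M D Z Y V p"
  using curvature_add_left[OF assms] curvature_antisym[OF assms(3,1,4,5)] curvature_antisym[OF assms(3,2,4,5)]
    curvature_antisym[OF assms(3) vf_add[OF assms(1,2)] assms(4,5)]
  by simp

lemma curvature_scale_right:
  assumes "smooth_fun M W f" "vector_field M W X" "vector_field M W Y" "vector_field M W Z" "p \<in> W"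
  shows "curvature M D Y (\<lambda>q. f q *\<^sub>R X q) Z p = f p *\<^sub>R curvature M D Y X Z p"
  using curvature_scale_left[OF assms] curvature_antisym[OF assms(3,2,4,5)]
    curvature_antisym[OF assms(3) vf_scale[OF assms(1,2)] assms(4,5)]
  by simp

lemma curvature_add:
  assumes "vector_field M W X" "vector_field M W Y" "vector_field M W Z" "vector_field M W V" "p \<in> W"
  shows "curvature M D Z V (\<lambda>q. X q + Y q) p = curvature M D Z V X p + curvature M D Z V Y p"
proof -
  note v = assms(1-4) conn_vf bracket_vf vf_add
  have "D A (D B (\<lambda>q. X q + Y q)) p = D A (D B X) p + D A (D B Y) p"
    if A: "vector_field M W A" and B: "vector_field M W B" for A B
  proof -
    have "D A (D B (\<lambda>q. X q + Y q)) p = D A (\<lambda>q. D B X q + D B Y q) p"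
      by (rule conn_cong[OF A _ _ _ assms(5)]) (use conn_add_right[OF B assms(1,2)] in \<open>auto intro: v B\<close>)
    also have "\<dots> = D A (D B X) p + D A (D B Y) p" by (rule conn_add_right[where W=W]) (intro v A B assms(5))+
    finally show ?thesis .
  qed
  note 1 = this[OF assms(3,4)] this[OF assms(4,3)]
  have 2: "D (lie_bracket M Z V) (\<lambda>q. X q + Y q) p = D (lie_bracket M Z V) X p + D (lie_bracket M Z V) Y p"
    by (rule conn_add_right[where W=W]) (intro v assms(5))+
  show ?thesis unfolding curvature_apply 1 2 by (simp add: algebra_simps)
qed

text \<open>First derivatives of \<open>f\<close> occur symmetrically in the two second covariant
  derivatives and cancel. Its second derivatives combine to the derivative along the bracket of
  \<open>Y\<close> and \<open>Z\<close>, which the bracket term removes.\<close>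

lemma curvature_scale:
  assumes f: "smooth_fun M W f" and X: "vector_field M W X" and Y: "vector_field M W Y"
    and Z: "vector_field M W Z" and p: "p \<in> W"
  shows "curvature M D Y Z (\<lambda>q. f q *\<^sub>R X q) p = f p *\<^sub>R curvature M D Y Z X p"
proof -
  have 1: "D A (D B (\<lambda>q. f q *\<^sub>R X q)) p =
      (A p (\<lambda>q. B q f) *\<^sub>R X p + B p f *\<^sub>R D A X p) + (A p f *\<^sub>R D B X p + f p *\<^sub>R D A (D B X) p)"
    if A: "vector_field M W A" and B: "vector_field M W B" for A B
  proof -
    have Bf: "smooth_fun M W (\<lambda>q. B q f)" by (rule vf_apply[OF B f]) simp
    note w = vf_add[OF vf_scale[OF Bf X] vf_scale[OF f conn_vf[OF B X]]]
    have "D A (D B (\<lambda>q. f q *\<^sub>R X q)) p = D A (\<lambda>q. B q f *\<^sub>R X q + f q *\<^sub>R D B X q) p"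
      by (rule conn_cong[OF A w _ _ p]) (use conn_scale_right[OF f B X] in auto)
    also have "\<dots> = D A (\<lambda>q. B q f *\<^sub>R X q) p + D A (\<lambda>q. f q *\<^sub>R D B X q) p"
      by (rule conn_add_right[OF A vf_scale[OF Bf X] vf_scale[OF f conn_vf[OF B X]] p])
    also have "D A (\<lambda>q. B q f *\<^sub>R X q) p = A p (\<lambda>q. B q f) *\<^sub>R X p + B p f *\<^sub>R D A X p"
      by (rule conn_scale_right[OF Bf A X p])
    also have "D A (\<lambda>q. f q *\<^sub>R D B X q) p = A p f *\<^sub>R D B X p + f p *\<^sub>R D A (D B X) p"
      by (rule conn_scale_right[OF f A conn_vf[OF B X] p])
    finally show ?thesis .
  qed
  have 2: "D (lie_bracket M Y Z) (\<lambda>q. f q *\<^sub>R X q) p =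
      (Y p (\<lambda>q. Z q f) - Z p (\<lambda>q. Y q f)) *\<^sub>R X p + f p *\<^sub>R D (lie_bracket M Y Z) X p"
    using conn_scale_right[OF f bracket_vf[OF Y Z] X p] lie_bracket_apply[OF smooth_atI[OF f p], of Y Z] by simp
  show ?thesis unfolding curvature_apply 1[OF Y Z] 1[OF Z Y] 2 by (simp add: algebra_simps)
qed

text \<open>The map \<open>Q\<close> is abstract, with values belonging to the fixed point
  \<open>p\<close>, so that one induction serves each of the three arguments of the
  curvature.\<close>

lemma tensorial_lincomb:
  assumes add: "\<And>X Y. vector_field M W X \<Longrightarrow> vector_field M W Y \<Longrightarrow> Q (\<lambda>q. X q + Y q) = Q X + Q Y"
    and scale: "\<And>f X. smooth_fun M W f \<Longrightarrow> vector_field M W X \<Longrightarrow> Q (\<lambda>q. f q *\<^sub>R X q) = f p *\<^sub>R Q X"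
    and W: "open W"
    and cX: "\<And>a. a \<in> A \<Longrightarrow> smooth_fun M W (c a)" "\<And>a. a \<in> A \<Longrightarrow> vector_field M W (X a)"
  shows "Q (\<lambda>q. \<Sum>a\<in>A. c a q *\<^sub>R X a q) = (\<Sum>a\<in>A. c a p *\<^sub>R Q (X a) :: 'a tvec)"
proof -
  have zero: "Q (\<lambda>q. 0) = 0"
    using scale[OF smooth_fun_const[OF W] vf_zero[OF W], of 0] by simp
  show ?thesis using cX
  proof (induction A rule: infinite_finite_induct)
    case (insert a A)
    have "Q (\<lambda>q. c a q *\<^sub>R X a q + (\<Sum>a\<in>A. c a q *\<^sub>R X a q)) =
      Q (\<lambda>q. c a q *\<^sub>R X a q) + Q (\<lambda>q. \<Sum>a\<in>A. c a q *\<^sub>R X a q)"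
      by (rule add[OF vf_scale vf_lincomb[OF W]]) (use insert.prems in auto)
    then show ?case using insert scale[of "c a" "X a"] by simp
  qed (use zero in simp_all)
qed

lemma curvature_lincomb:
  assumes W: "open W" "p \<in> W"
    and x: "\<And>b. b < k \<Longrightarrow> smooth_fun M W (x b)" and y: "\<And>b. b < k \<Longrightarrow> smooth_fun M W (y b)"
    and z: "\<And>b. b < k \<Longrightarrow> smooth_fun M W (z b)" and E: "\<And>b. b < k \<Longrightarrow> vector_field M W (E b)"
  shows "curvature M D (\<lambda>q. \<Sum>b<k. x b q *\<^sub>R E b q) (\<lambda>q. \<Sum>c<k. y c q *\<^sub>R E c q) (\<lambda>q. \<Sum>d<k. z d q *\<^sub>R E d q) p
    = (\<Sum>b<(k::nat). \<Sum>c<k. \<Sum>d<k. (x b p * y c p * z d p) *\<^sub>R curvature M D (E b) (E c) (E d) p)"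
proof -
  let ?Y = "\<lambda>q. \<Sum>c<k. y c q *\<^sub>R E c q" and ?Z = "\<lambda>q. \<Sum>d<k. z d q *\<^sub>R E d q"
  have Y: "vector_field M W ?Y" and Z: "vector_field M W ?Z"
    by (rule vf_lincomb[OF W(1)]; use y z E in simp)+
  have "curvature M D (\<lambda>q. \<Sum>b<k. x b q *\<^sub>R E b q) ?Y ?Z p = (\<Sum>b<k. x b p *\<^sub>R curvature M D (E b) ?Y ?Z p)"
    by (rule tensorial_lincomb[where W=W])
      (use curvature_add_left[OF _ _ Y Z W(2)] curvature_scale_left[OF _ _ Y Z W(2)] x E W in auto)
  also have "\<dots> = (\<Sum>b<k. x b p *\<^sub>R (\<Sum>c<k. y c p *\<^sub>R (\<Sum>d<k. z d p *\<^sub>R curvature M D (E b) (E c) (E d) p)))"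
  proof (intro sum.cong refl arg_cong[where f="\<lambda>v. _ *\<^sub>R v"])
    fix b assume "b \<in> {..<k}"
    then have Eb: "vector_field M W (E b)" using E by simp
    have "curvature M D (E b) ?Y ?Z p = (\<Sum>c<k. y c p *\<^sub>R curvature M D (E b) (E c) ?Z p)"
      by (rule tensorial_lincomb[where W=W])
        (use curvature_add_right[OF _ _ Eb Z W(2)] curvature_scale_right[OF _ _ Eb Z W(2)] y E W in auto)
    also have "\<dots> = (\<Sum>c<k. y c p *\<^sub>R (\<Sum>d<k. z d p *\<^sub>R curvature M D (E b) (E c) (E d) p))"
    proof (intro sum.cong refl arg_cong[where f="\<lambda>v. _ *\<^sub>R v"])
      fix c assume "c \<in> {..<k}"
      then have Ec: "vector_field M W (E c)" using E by simp
      show "curvature M D (E b) (E c) ?Z p = (\<Sum>d<k. z d p *\<^sub>R curvature M D (E b) (E c) (E d) p)"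
        by (rule tensorial_lincomb[where W=W])
          (use curvature_add[OF _ _ Eb Ec W(2)] curvature_scale[OF _ _ Eb Ec W(2)] z E W in auto)
    qed
    finally show "curvature M D (E b) ?Y ?Z p =
      (\<Sum>c<k. y c p *\<^sub>R (\<Sum>d<k. z d p *\<^sub>R curvature M D (E b) (E c) (E d) p))" .
  qed
  finally show ?thesis by (simp add: scaleR_sum_right mult.assoc)
qed

end

section \<open>Ricci and scalar curvature in an orthonormal frame\<close>

locale riemannian_affine_mfd = riemannian_mfd M g + affine_mfd M D
  for M :: "'a::{t2_space,second_countable_topology} manifold" and g D
begin

lemma curvature_tangent:
  "vector_field M W X \<Longrightarrow> vector_field M W Y \<Longrightarrow> vector_field M W Z \<Longrightarrow> p \<in> W \<Longrightarrow>
   curvature M D X Y Z p \<in> tangent_space M p"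
  by (rule vf_tangent[OF curvature_vf])

text \<open>The change from \<open>E\<close> to \<open>e\<close> is an orthogonal matrix, which
  eliminates \<open>e\<close> from the trace, and on the right \<open>X\<close> enters only through
  \<open>X p\<close>. This makes the definite description in \<open>ricci\<close> well
  defined.\<close>

lemma curvature_trace:
  assumes E: "orthonormal_frame M g W E" "open W" "p \<in> W"
    and e: "orthonormal_frame M g W' e" "open W'" "p \<in> W'"
    and X: "vector_field M W' X" and v: "v \<in> tangent_space M p"
  shows "(\<Sum>a<mdim M. g p (curvature M D X (e a) (e a) p) v) =
    (\<Sum>b<mdim M. g p (X p) (E b p) * (\<Sum>c<mdim M. g p (curvature M D (E b) (E c) (E c) p) v))"
proof -
  let ?m = "mdim M"
  define V where "V = W \<inter> W'"
  have V: "open V" "p \<in> V" "V \<subseteq> W" "V \<subseteq> W'" unfolding V_def using E e by auto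
  have EV: "orthonormal_frame M g V E" by (rule orthonormal_frame_subset[OF E(1) V(1,3)])
  have eV: "orthonormal_frame M g V e" by (rule orthonormal_frame_subset[OF e(1) V(1,4)])
  have XV: "vector_field M V X" by (rule vf_subset[OF X V(1,4)])
  note Ev = orthonormal_frame_vf[OF EV] and ev = orthonormal_frame_vf[OF eV]
  define A where "A a c q = g q (e a q) (E c q)" for a c q
  define x where "x b q = g q (X q) (E b q)" for b q
  define K where "K b c d = g p (curvature M D (E b) (E c) (E d) p) v" for b c d
  have A: "smooth_fun M V (A a c)" if "a < ?m" "c < ?m" for a c
    unfolding A_def using metric_smooth[OF ev[OF that(1)] Ev[OF that(2)]] .
  have x: "smooth_fun M V (x b)" if "b < ?m" for b
    unfolding x_def using metric_smooth[OF XV Ev[OF that]] .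
  have RT: "curvature M D (E b) (E c) (E d) p \<in> tangent_space M p" if "b < ?m" "c < ?m" "d < ?m" for b c d
    by (rule curvature_tangent[OF Ev[OF that(1)] Ev[OF that(2)] Ev[OF that(3)] V(2)])
  have *: "g p (curvature M D X (e a) (e a) p) v =
    (\<Sum>b<?m. \<Sum>c<?m. \<Sum>d<?m. (x b p * A a c p * A a d p) * K b c d)" if a: "a < ?m" for a
  proof -
    let ?X = "\<lambda>q. \<Sum>b<?m. x b q *\<^sub>R E b q" and ?e = "\<lambda>q. \<Sum>c<?m. A a c q *\<^sub>R E c q"
    have vX: "vector_field M V ?X" and ve: "vector_field M V ?e"
      by (rule vf_lincomb[OF V(1)]; use x A a Ev in simp)+
    have "curvature M D X (e a) (e a) p = curvature M D ?X ?e ?e p"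
    proof (rule curvature_cong[OF vX ve ve _ _ _ V(2)])
      fix q assume q: "q \<in> V"
      show "X q = ?X q" unfolding x_def by (rule frame_expand[OF EV q vf_tangent[OF XV q]])
      show "e a q = ?e q" unfolding A_def by (rule frame_expand[OF EV q vf_tangent[OF ev[OF a] q]])
      then show "e a q = ?e q" .
    qed
    also have "\<dots> = (\<Sum>b<?m. \<Sum>c<?m. \<Sum>d<?m.
        (x b p * A a c p * A a d p) *\<^sub>R curvature M D (E b) (E c) (E d) p)"
      by (rule curvature_lincomb[OF V(1,2)]) (use x A a Ev in auto)
    finally have "g p (curvature M D X (e a) (e a) p) v = g p (\<Sum>b<?m. \<Sum>c<?m. \<Sum>d<?m.
        (x b p * A a c p * A a d p) *\<^sub>R curvature M D (E b) (E c) (E d) p) v" by simp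
    also have "\<dots> = (\<Sum>b<?m. g p (\<Sum>c<?m. \<Sum>d<?m.
        (x b p * A a c p * A a d p) *\<^sub>R curvature M D (E b) (E c) (E d) p) v)"
      by (rule metric_sum_left[OF v]) (auto intro!: tangent_sum tangent_scale RT)
    also have "\<dots> = (\<Sum>b<?m. \<Sum>c<?m. g p (\<Sum>d<?m.
        (x b p * A a c p * A a d p) *\<^sub>R curvature M D (E b) (E c) (E d) p) v)"
      by (rule sum.cong[OF refl], rule metric_sum_left[OF v]) (auto intro!: tangent_sum tangent_scale RT)
    also have "\<dots> = (\<Sum>b<?m. \<Sum>c<?m. \<Sum>d<?m. (x b p * A a c p * A a d p) * K b c d)"
      unfolding K_def
      by (rule sum.cong[OF refl], rule sum.cong[OF refl], rule metric_lincomb_left[OF v]) (auto intro!: RT)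
    finally show ?thesis .
  qed
  \<comment> \<open>Parseval for \<open>E c\<close> and \<open>E d\<close> in the frame
    \<open>e\<close>: the columns of the change of frame are orthonormal.\<close>
  have AA: "(\<Sum>a<?m. A a c p * A a d p) = (if c = d then 1 else 0)" if "c < ?m" "d < ?m" for c d
  proof -
    have Ec: "E c p \<in> tangent_space M p" "E d p \<in> tangent_space M p"
      using vf_tangent[OF Ev V(2)] that by auto
    have "(\<Sum>a<?m. A a c p * A a d p) = (\<Sum>a<?m. g p (E c p) (e a p) * g p (E d p) (e a p))"
      unfolding A_def by (intro sum.cong refl) (use metric_sym[OF vf_tangent[OF ev V(2)]] Ec in auto)
    also have "\<dots> = g p (E c p) (E d p)" by (rule metric_frame_expand[OF eV V(2) Ec, symmetric])
    finally show ?thesis using orthonormal_frame_metric[OF EV V(2) that] by simp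
  qed
  have "(\<Sum>a<?m. g p (curvature M D X (e a) (e a) p) v) =
    (\<Sum>a<?m. \<Sum>b<?m. \<Sum>c<?m. \<Sum>d<?m. (x b p * A a c p * A a d p) * K b c d)"
    using * by simp
  also have "\<dots> = (\<Sum>b<?m. \<Sum>c<?m. \<Sum>d<?m. \<Sum>a<?m. (x b p * A a c p * A a d p) * K b c d)"
    by (subst sum.swap, rule sum.cong[OF refl], subst sum.swap, rule sum.cong[OF refl], rule sum.swap)
  also have "\<dots> = (\<Sum>b<?m. \<Sum>c<?m. \<Sum>d<?m. x b p * K b c d * (\<Sum>a<?m. A a c p * A a d p))"
    by (simp add: sum_distrib_left mult_ac)
  also have "\<dots> = (\<Sum>b<?m. \<Sum>c<?m. \<Sum>d<?m. if d = c then x b p * K b c c else 0)"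
    by (intro sum.cong refl) (auto simp: AA)
  also have "\<dots> = (\<Sum>b<?m. x b p * (\<Sum>c<?m. K b c c))"
    by (simp add: sum_distrib_left)
  finally show ?thesis by (simp add: x_def K_def)
qed

lemma ricci_frame:
  assumes E: "orthonormal_frame M g W E" "open W" "p \<in> W"
    and u: "u \<in> tangent_space M p" and v: "v \<in> tangent_space M p"
  shows "ricci M g D p u v =
    (\<Sum>b<mdim M. g p u (E b p) * (\<Sum>c<mdim M. g p (curvature M D (E b) (E c) (E c) p) v))"
    (is "_ = ?r")
  unfolding ricci_def
proof (rule the_equality)
  fix r assume "\<exists>W e X. open W \<and> p \<in> W \<and> orthonormal_frame M g W e \<and> vector_field M W X \<and> X p = u \<and>
        r = (\<Sum>a<mdim M. g p (curvature M D X (e a) (e a) p) v)"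
  then obtain W' e X where "open W'" "p \<in> W'" "orthonormal_frame M g W' e" "vector_field M W' X" "X p = u"
    "r = (\<Sum>a<mdim M. g p (curvature M D X (e a) (e a) p) v)" by (elim exE conjE)
  then show "r = ?r" using curvature_trace[OF E _ _ _ _ v, of W' e X] by simp
next
  \<comment> \<open>Witness for the existential: \<open>u\<close> is extended with its coefficients
    frozen at \<open>p\<close>.\<close>
  define X where "X q = (\<Sum>b<mdim M. g p u (E b p) *\<^sub>R E b q)" for q
  have X: "vector_field M W X"
    unfolding X_def using orthonormal_frame_vf[OF E(1)] by (intro vf_sum[OF E(2)] vf_cscale) auto
  have Xp: "X p = u" unfolding X_def using frame_expand[OF E(1,3) u] by simp
  show "\<exists>W e X. open W \<and> p \<in> W \<and> orthonormal_frame M g W e \<and> vector_field M W X \<and> X p = u \<and>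
        ?r = (\<Sum>a<mdim M. g p (curvature M D X (e a) (e a) p) v)"
    using curvature_trace[OF E E X v] E X Xp
    by (intro exI[of _ W] exI[of _ E] exI[of _ X]) simp
qed

text \<open>Invariance of the trace: for fixed \<open>b\<close>, summing over \<open>a\<close> is
  Parseval in the frame \<open>e\<close> and leaves the diagonal entry with respect to
  \<open>E\<close>.\<close>

lemma scal_frame:
  assumes E: "orthonormal_frame M g W E" "open W" "p \<in> W"
  shows "scal M g D p =
    (\<Sum>b<mdim M. \<Sum>c<mdim M. g p (curvature M D (E b) (E c) (E c) p) (E b p))"
    (is "_ = ?r")
proof -
  define S where "S b v = (\<Sum>c<mdim M. g p (curvature M D (E b) (E c) (E c) p) v)" for b v
  note Ev = orthonormal_frame_vf[OF E(1)]
  have RT: "curvature M D (E b) (E c) (E d) p \<in> tangent_space M p"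
    if "b < mdim M" "c < mdim M" "d < mdim M" for b c d
    by (rule curvature_tangent[OF Ev[OF that(1)] Ev[OF that(2)] Ev[OF that(3)] E(3)])
  have ex: "(\<Sum>a<mdim M. ricci M g D p (e a p) (e a p)) = ?r"
    if e: "orthonormal_frame M g W' e" "open W'" "p \<in> W'" for W' e
  proof -
    have eT: "e a p \<in> tangent_space M p" if "a < mdim M" for a
      by (rule orthonormal_frame_tangent[OF e(1) that e(3)])
    have ET: "E a p \<in> tangent_space M p" if "a < mdim M" for a
      by (rule orthonormal_frame_tangent[OF E(1) that E(3)])
    have "(\<Sum>a<mdim M. ricci M g D p (e a p) (e a p)) =
      (\<Sum>a<mdim M. \<Sum>b<mdim M. g p (e a p) (E b p) * S b (e a p))"
      unfolding S_def by (intro sum.cong refl ricci_frame[OF E]) (use eT in auto)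
    also have "\<dots> = (\<Sum>b<mdim M. \<Sum>a<mdim M. g p (e a p) (E b p) * S b (e a p))" by (rule sum.swap)
    also have "\<dots> = (\<Sum>b<mdim M. S b (E b p))"
    proof (intro sum.cong refl)
      fix b assume "b \<in> {..<mdim M}"
      then have b: "b < mdim M" by simp
      have "(\<Sum>a<mdim M. g p (e a p) (E b p) * S b (e a p)) =
        (\<Sum>c<mdim M. \<Sum>a<mdim M. g p (E b p) (e a p) * g p (curvature M D (E b) (E c) (E c) p) (e a p))"
        unfolding S_def sum_distrib_left
        by (subst sum.swap) (intro sum.cong refl, use metric_sym[OF eT ET[OF b]] in auto)
      also have "\<dots> = (\<Sum>c<mdim M. g p (E b p) (curvature M D (E b) (E c) (E c) p))"
        by (intro sum.cong refl metric_frame_expand[OF e(1,3), symmetric] ET[OF b] RT[OF b]) auto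
      also have "\<dots> = S b (E b p)"
        unfolding S_def by (intro sum.cong refl metric_sym ET[OF b] RT[OF b]) auto
      finally show "(\<Sum>a<mdim M. g p (e a p) (E b p) * S b (e a p)) = S b (E b p)" .
    qed
    finally show ?thesis by (simp add: S_def)
  qed
  show ?thesis
    unfolding scal_def
  proof (rule the_equality)
    show "\<exists>W e. open W \<and> p \<in> W \<and> orthonormal_frame M g W e \<and>
        ?r = (\<Sum>a<mdim M. ricci M g D p (e a p) (e a p))"
      using ex[OF E] E by (intro exI[of _ W] exI[of _ E]) simp
    fix r assume "\<exists>W e. open W \<and> p \<in> W \<and> orthonormal_frame M g W e \<and>
        r = (\<Sum>a<mdim M. ricci M g D p (e a p) (e a p))"
    then obtain W' e where "open W'" "p \<in> W'" "orthonormal_frame M g W' e"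
      "r = (\<Sum>a<mdim M. ricci M g D p (e a p) (e a p))" by (elim exE conjE)
    then show "r = ?r" using ex by simp
  qed
qed

section \<open>Connection, bracket and curvature components in an orthonormal frame\<close>

definition conn_coeff :: "(nat \<Rightarrow> 'a \<Rightarrow> 'a tvec) \<Rightarrow> 'a \<Rightarrow> nat \<Rightarrow> nat \<Rightarrow> nat \<Rightarrow> real" where
  "conn_coeff E q a b c = g q (D (E a) (E b) q) (E c q)"

definition bracket_coeff :: "(nat \<Rightarrow> 'a \<Rightarrow> 'a tvec) \<Rightarrow> 'a \<Rightarrow> nat \<Rightarrow> nat \<Rightarrow> nat \<Rightarrow> real" where
  "bracket_coeff E q a b c = g q (lie_bracket M (E a) (E b) q) (E c q)"

text \<open>Stated for an arbitrary affine connection, so that it serves both Levi-Civita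
  connections and the characteristic one. Frame fields need not commute, whence the summand with
  \<open>bracket_coeff\<close>.\<close>

lemma curvature_frame:
  assumes E: "orthonormal_frame M g W E" "open W" "p \<in> W"
    and abcd: "a < mdim M" "b < mdim M" "c < mdim M" "d < mdim M"
  shows "g p (curvature M D (E a) (E b) (E c) p) (E d p) =
    E a p (\<lambda>q. conn_coeff E q b c d) - E b p (\<lambda>q. conn_coeff E q a c d) +
    (\<Sum>e<mdim M. conn_coeff E p b c e * conn_coeff E p a e d - conn_coeff E p a c e * conn_coeff E p b e d
      - bracket_coeff E p a b e * conn_coeff E p e c d)"
proof -
  let ?m = "mdim M"
  note Ev = orthonormal_frame_vf[OF E(1)]
  note ET = orthonormal_frame_tangent[OF E(1) _ E(3)]
  \<comment> \<open>The inner derivative is expanded in the frame; the Leibniz rule then produces a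
    directional derivative of a coefficient and a product of two coefficients.\<close>
  have second: "g p (D (E a) (D (E b) (E c)) p) (E d p) =
      E a p (\<lambda>q. conn_coeff E q b c d) + (\<Sum>e<?m. conn_coeff E p b c e * conn_coeff E p a e d)"
    if abc: "a < ?m" "b < ?m" "c < ?m" for a b c
  proof -
    have G: "smooth_fun M W (\<lambda>q. conn_coeff E q b c e)" if "e < ?m" for e
      unfolding conn_coeff_def by (rule metric_smooth[OF conn_vf[OF Ev[OF abc(2)] Ev[OF abc(3)]] Ev[OF that]])
    have DT: "D (E a) (E e) p \<in> tangent_space M p" if "e < ?m" for e
      by (rule vf_tangent[OF conn_vf[OF Ev[OF abc(1)] Ev[OF that]] E(3)])
    have "D (E a) (D (E b) (E c)) p = D (E a) (\<lambda>q. \<Sum>e<?m. conn_coeff E q b c e *\<^sub>R E e q) p"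
    proof (rule conn_cong[OF Ev[OF abc(1)] _ refl _ E(3)])
      show "vector_field M W (\<lambda>q. \<Sum>e<?m. conn_coeff E q b c e *\<^sub>R E e q)"
        by (rule vf_lincomb[OF E(2)]) (use G Ev in auto)
      fix q assume q: "q \<in> W"
      show "D (E b) (E c) q = (\<Sum>e<?m. conn_coeff E q b c e *\<^sub>R E e q)"
        unfolding conn_coeff_def
        by (rule frame_expand[OF E(1) q vf_tangent[OF conn_vf[OF Ev[OF abc(2)] Ev[OF abc(3)]] q]])
    qed
    also have "\<dots> = (\<Sum>e<?m. E a p (\<lambda>q. conn_coeff E q b c e) *\<^sub>R E e p +
        conn_coeff E p b c e *\<^sub>R D (E a) (E e) p)"
      by (rule conn_lincomb_right[OF _ _ Ev[OF abc(1)] E(3)]) (use G Ev in auto)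
    finally have "g p (D (E a) (D (E b) (E c)) p) (E d p) =
      (\<Sum>e<?m. g p (E a p (\<lambda>q. conn_coeff E q b c e) *\<^sub>R E e p +
        conn_coeff E p b c e *\<^sub>R D (E a) (E e) p) (E d p))"
      using ET DT abcd(4) by (subst metric_sum_left[symmetric]) (auto intro!: tangent_add tangent_scale)
    also have "\<dots> = (\<Sum>e<?m. E a p (\<lambda>q. conn_coeff E q b c e) * g p (E e p) (E d p) +
        conn_coeff E p b c e * conn_coeff E p a e d)"
      using ET DT abcd(4)
      by (intro sum.cong refl)
        (simp add: metric_add_left metric_scale_left tangent_scale conn_coeff_def[of E p a])
    also have "\<dots> = (\<Sum>e<?m. (if e = d then E a p (\<lambda>q. conn_coeff E q b c d) else 0) +
        conn_coeff E p b c e * conn_coeff E p a e d)"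
      by (intro sum.cong refl) (use orthonormal_frame_metric[OF E(1,3) _ abcd(4)] in auto)
    finally show ?thesis using abcd(4) by (simp add: sum.distrib)
  qed
  have third: "g p (D (lie_bracket M (E a) (E b)) (E c) p) (E d p) =
      (\<Sum>e<?m. bracket_coeff E p a b e * conn_coeff E p e c d)"
  proof -
    have C: "smooth_fun M W (\<lambda>q. bracket_coeff E q a b e)" if "e < ?m" for e
      unfolding bracket_coeff_def by (rule metric_smooth[OF bracket_vf[OF Ev[OF abcd(1)] Ev[OF abcd(2)]] Ev[OF that]])
    have DT: "D (E e) (E c) p \<in> tangent_space M p" if "e < ?m" for e
      by (rule vf_tangent[OF conn_vf[OF Ev[OF that] Ev[OF abcd(3)]] E(3)])
    have "D (lie_bracket M (E a) (E b)) (E c) p = D (\<lambda>q. \<Sum>e<?m. bracket_coeff E q a b e *\<^sub>R E e q) (E c) p"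
    proof (rule conn_cong[OF _ Ev[OF abcd(3)] _ refl E(3)])
      show "vector_field M W (\<lambda>q. \<Sum>e<?m. bracket_coeff E q a b e *\<^sub>R E e q)"
        by (rule vf_lincomb[OF E(2)]) (use C Ev in auto)
      fix q assume q: "q \<in> W"
      show "lie_bracket M (E a) (E b) q = (\<Sum>e<?m. bracket_coeff E q a b e *\<^sub>R E e q)"
        unfolding bracket_coeff_def
        by (rule frame_expand[OF E(1) q vf_tangent[OF bracket_vf[OF Ev[OF abcd(1)] Ev[OF abcd(2)]] q]])
    qed
    also have "\<dots> = (\<Sum>e<?m. bracket_coeff E p a b e *\<^sub>R D (E e) (E c) p)"
      by (rule conn_lincomb_left[OF _ _ Ev[OF abcd(3)] E(3)]) (use C Ev in auto)
    finally show ?thesis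
      using metric_lincomb_left[OF ET[OF abcd(4)], of "{..<?m}" "\<lambda>e. D (E e) (E c) p"] DT
      by (simp add: conn_coeff_def)
  qed
  have T: "D (E x) (D (E y) (E z)) p \<in> tangent_space M p" if "x < ?m" "y < ?m" "z < ?m" for x y z
    by (rule vf_tangent[OF conn_vf[OF Ev[OF that(1)] conn_vf[OF Ev[OF that(2)] Ev[OF that(3)]]] E(3)])
  have T': "D (lie_bracket M (E a) (E b)) (E c) p \<in> tangent_space M p"
    by (rule vf_tangent[OF conn_vf[OF bracket_vf[OF Ev[OF abcd(1)] Ev[OF abcd(2)]] Ev[OF abcd(3)]] E(3)])
  show ?thesis
    unfolding curvature_apply
    using second[OF abcd(1-3)] second[OF abcd(2,1,3)] third T abcd T' ET
    by (simp add: metric_diff_left tangent_diff sum_subtractf)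
qed

end

locale levi_civita_mfd = riemannian_mfd M g
  for M :: "'a::{t2_space,second_countable_topology} manifold" and g +
  fixes D :: "'a connection"
  assumes levi_civita: "levi_civita M g D"
begin

lemma levi_civita_torsion:
  "vector_field M W X \<Longrightarrow> vector_field M W Y \<Longrightarrow> p \<in> W \<Longrightarrow> lie_bracket M X Y p = D X Y p - D Y X p"
  using conjunct1[OF conjunct2[OF levi_civita[unfolded levi_civita_def]]] by simp

lemma levi_civita_metric:
  "vector_field M W X \<Longrightarrow> vector_field M W Y \<Longrightarrow> vector_field M W Z \<Longrightarrow> p \<in> W \<Longrightarrow>
   X p (\<lambda>q. g q (Y q) (Z q)) = g p (D X Y p) (Z p) + g p (Y p) (D X Z p)"
  using conjunct2[OF conjunct2[OF levi_civita[unfolded levi_civita_def]]] by simp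

end

sublocale levi_civita_mfd \<subseteq> riemannian_affine_mfd M g D
proof
  show aff: "affine_connection M D"
    using conjunct1[OF levi_civita[unfolded levi_civita_def]] .
  fix W X Y assume XY: "vector_field M W X" "vector_field M W Y"
  \<comment> \<open>Torsion-freeness exhibits the bracket as a difference of smooth fields, so that
    symmetry of second partial derivatives is not invoked.\<close>
  have "vector_field M W (D X Y)" "vector_field M W (D Y X)"
    using conjunct1[OF aff[unfolded affine_connection_def]] XY by simp_all
  then have "vector_field M W (\<lambda>q. D X Y q - D Y X q)" by (rule vf_diff)
  then show "vector_field M W (lie_bracket M X Y)"
    by (rule vf_cong) (simp add: levi_civita_torsion[OF XY])
qed

context levi_civita_mfd
begin

text \<open>Inner products of frame fields are constant, so the derivative terms of the Koszul
  formula drop out. Metric compatibility becomes skewness in the last two indices, and three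
  instances of it together with torsion-freeness determine the coefficient.\<close>

lemma koszul_frame:
  assumes E: "orthonormal_frame M g W E" "open W" "p \<in> W"
    and abc: "a < mdim M" "b < mdim M" "c < mdim M"
  shows "2 * conn_coeff E p a b c = bracket_coeff E p a b c - bracket_coeff E p b c a + bracket_coeff E p c a b"
proof -
  note Ev = orthonormal_frame_vf[OF E(1)]
  note ET = orthonormal_frame_tangent[OF E(1) _ E(3)]
  have DT: "D (E a) (E b) p \<in> tangent_space M p" if "a < mdim M" "b < mdim M" for a b
    by (rule vf_tangent[OF conn_vf[OF Ev[OF that(1)] Ev[OF that(2)]] E(3)])
  have skew: "conn_coeff E p a b c + conn_coeff E p a c b = 0"
    if "a < mdim M" "b < mdim M" "c < mdim M" for a b c
  proof -
    have "E a p (\<lambda>q. g q (E b q) (E c q)) = E a p (\<lambda>q. if b = c then 1 else 0)"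
      by (rule tangent_cong[OF ET[OF that(1)] E(2,3)]) (use orthonormal_frame_metric[OF E(1)] that in auto)
    also have "\<dots> = 0" by (rule tangent_fun_const[OF ET[OF that(1)]])
    finally show ?thesis
      using levi_civita_metric[OF Ev[OF that(1)] Ev[OF that(2)] Ev[OF that(3)] E(3)]
        metric_sym[OF ET[OF that(2)] DT[OF that(1,3)]]
      by (simp add: conn_coeff_def)
  qed
  have tor: "bracket_coeff E p a b c = conn_coeff E p a b c - conn_coeff E p b a c"
    if "a < mdim M" "b < mdim M" "c < mdim M" for a b c
    using levi_civita_torsion[OF Ev[OF that(1)] Ev[OF that(2)] E(3)]
      metric_diff_left[OF DT[OF that(1,2)] DT[OF that(2,1)] ET[OF that(3)]]
    by (simp add: conn_coeff_def bracket_coeff_def)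
  show ?thesis
    using skew[OF abc] skew[OF abc(2,3,1)] skew[OF abc(3,1,2)]
    by (simp add: tor abc)
qed

end

section \<open>S-manifolds\<close>

lemma (in smooth_mfd) lie_bracket_lincomb_right:
  assumes "\<And>a. a \<in> A \<Longrightarrow> smooth_fun M W (c a)" "\<And>a. a \<in> A \<Longrightarrow> vector_field M W (Y a)"
    and X: "vector_field M W X" "p \<in> W"
  shows "lie_bracket M X (\<lambda>q. \<Sum>a\<in>A. c a q *\<^sub>R Y a q) p =
    (\<Sum>a\<in>A. c a p *\<^sub>R lie_bracket M X (Y a) p + X p (c a) *\<^sub>R Y a p)"
proof -
  have zero: "lie_bracket M X (\<lambda>q. 0) p = 0"
    using lie_bracket_scale_right[OF smooth_fun_const[OF vf_open[OF X(1)]] X(1) X(1) X(2), of 0]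
      tangent_fun_const[OF vf_tangent[OF X], of 0] by simp
  show ?thesis using assms(1,2)
  proof (induction A rule: infinite_finite_induct)
    case (insert a A)
    have "lie_bracket M X (\<lambda>q. c a q *\<^sub>R Y a q + (\<Sum>a\<in>A. c a q *\<^sub>R Y a q)) p =
      lie_bracket M X (\<lambda>q. c a q *\<^sub>R Y a q) p + lie_bracket M X (\<lambda>q. \<Sum>a\<in>A. c a q *\<^sub>R Y a q) p"
      by (rule lie_bracket_add_right[OF vf_scale vf_lincomb[OF vf_open[OF X(1)]] X])
        (use insert.prems in auto)
    then show ?case
      using insert lie_bracket_scale_right[OF insert.prems(1)[of a] insert.prems(2)[of a] X] by simp
  qed (use zero in simp_all)
qed

text \<open>Meant for the characteristic connection: a pointwise bilinear term differentiates
  nothing, so the Leibniz rules survive.\<close>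

lemma (in affine_mfd) affine_connection_add_tensor:
  assumes vf: "\<And>W X Y. vector_field M W X \<Longrightarrow> vector_field M W Y \<Longrightarrow> vector_field M W (\<lambda>p. S p (X p) (Y p))"
    and add_left: "\<And>p u v w. u \<in> tangent_space M p \<Longrightarrow> v \<in> tangent_space M p \<Longrightarrow> w \<in> tangent_space M p \<Longrightarrow>
      S p (u + v) w = S p u w + S p v w"
    and add_right: "\<And>p u v w. u \<in> tangent_space M p \<Longrightarrow> v \<in> tangent_space M p \<Longrightarrow> w \<in> tangent_space M p \<Longrightarrow>
      S p w (u + v) = S p w u + S p w v"
    and scale_left: "\<And>p c u v. u \<in> tangent_space M p \<Longrightarrow> v \<in> tangent_space M p \<Longrightarrow> S p (c *\<^sub>R u) v = c *\<^sub>R S p u v"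
    and scale_right: "\<And>p c u v. u \<in> tangent_space M p \<Longrightarrow> v \<in> tangent_space M p \<Longrightarrow> S p u (c *\<^sub>R v) = c *\<^sub>R S p u v"
  shows "affine_connection M (\<lambda>X Y p. D X Y p + S p (X p) (Y p))"
  unfolding affine_connection_def
proof (intro conjI allI impI ballI)
  fix W X Y assume "vector_field M W X \<and> vector_field M W Y"
  then show "vector_field M W (\<lambda>p. D X Y p + S p (X p) (Y p))"
    using vf_add[OF conn_vf vf] by blast
next
  fix W X Y X' Y' p
  assume "vector_field M W X \<and> vector_field M W Y \<and> (\<forall>p\<in>W. X' p = X p \<and> Y' p = Y p)" "p \<in> W"
  then show "D X' Y' p + S p (X' p) (Y' p) = D X Y p + S p (X p) (Y p)"
    using conn_cong[of W X Y X' Y' p] by simp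
next
  fix W X Y Z p assume "vector_field M W X \<and> vector_field M W Y \<and> vector_field M W Z" and p: "p \<in> W"
  then have XYZ: "vector_field M W X" "vector_field M W Y" "vector_field M W Z" by auto
  note T = vf_tangent[OF XYZ(1) p] vf_tangent[OF XYZ(2) p] vf_tangent[OF XYZ(3) p]
  show "D (X + Y) Z p + S p ((X + Y) p) (Z p) = D X Z p + S p (X p) (Z p) + (D Y Z p + S p (Y p) (Z p))"
    using conn_add_left[OF XYZ p] add_left[OF T] by (simp add: plus_fun_def[of X Y])
  show "D X (Y + Z) p + S p (X p) ((Y + Z) p) = D X Y p + S p (X p) (Y p) + (D X Z p + S p (X p) (Z p))"
    using conn_add_right[OF XYZ p] add_right[OF T(2,3,1)] by (simp add: plus_fun_def[of Y Z])
next
  fix W f X Y p assume "smooth_fun M W f \<and> vector_field M W X \<and> vector_field M W Y" and p: "p \<in> W"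
  then have fXY: "smooth_fun M W f" "vector_field M W X" "vector_field M W Y" by auto
  note T = vf_tangent[OF fXY(2) p] vf_tangent[OF fXY(3) p]
  show "D (\<lambda>q. f q *\<^sub>R X q) Y p + S p (f p *\<^sub>R X p) (Y p) = f p *\<^sub>R (D X Y p + S p (X p) (Y p))"
    using conn_scale_left[OF fXY p] scale_left[OF T] by (simp add: algebra_simps)
  show "D X (\<lambda>q. f q *\<^sub>R Y q) p + S p (X p) (f p *\<^sub>R Y p) =
      X p f *\<^sub>R Y p + f p *\<^sub>R (D X Y p + S p (X p) (Y p))"
    using conn_scale_right[OF fXY p] scale_right[OF T] by (simp add: algebra_simps)
qed

locale s_mfd = levi_civita_mfd M g Dg
  for M :: "'a::{t2_space,second_countable_topology} manifold" and g Dg +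
  fixes n s :: nat and \<phi> :: "'a \<Rightarrow> 'a tvec \<Rightarrow> 'a tvec"
    and \<xi> :: "nat \<Rightarrow> 'a \<Rightarrow> 'a tvec" and \<eta> :: "nat \<Rightarrow> 'a \<Rightarrow> 'a tvec \<Rightarrow> real"
  assumes S_manifold: "S_manifold M n s \<phi> \<xi> \<eta> g"
begin

lemma metric_f: "metric_f_manifold M n s \<phi> \<xi> \<eta> g"
  using S_manifold by (simp add: S_manifold_def)

lemma mdim_eq: "mdim M = 2 * n + s"
  and endomorphism: "endomorphism M \<phi>"
  and xi_vf_UNIV: "i \<in> {1..s} \<Longrightarrow> vector_field M UNIV (\<xi> i)"
  and eta_one_form: "i \<in> {1..s} \<Longrightarrow> one_form M (\<eta> i)"
  using metric_f by (simp_all add: metric_f_manifold_def)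

lemma f_structure:
  shows ker_at_eq: "ker_at M \<phi> p = span ((\<lambda>i. \<xi> i p) ` {1..s})"
    and eta_xi: "i \<in> {1..s} \<Longrightarrow> j \<in> {1..s} \<Longrightarrow> \<eta> i p (\<xi> j p) = (if i = j then 1 else 0)"
    and eta_phi: "i \<in> {1..s} \<Longrightarrow> v \<in> tangent_space M p \<Longrightarrow> \<eta> i p (\<phi> p v) = 0"
    and phi_phi: "v \<in> tangent_space M p \<Longrightarrow> \<phi> p (\<phi> p v) = - v + (\<Sum>i=1..s. \<eta> i p v *\<^sub>R \<xi> i p)"
    and metric_phi: "u \<in> tangent_space M p \<Longrightarrow> v \<in> tangent_space M p \<Longrightarrow>
      g p (\<phi> p u) (\<phi> p v) = g p u v - (\<Sum>i=1..s. \<eta> i p u * \<eta> i p v)"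
  using metric_f by (simp_all add: metric_f_manifold_def)

lemma phi_linear: "linear_on (tangent_space M p) (\<phi> p)"
  and phi_tangent: "v \<in> tangent_space M p \<Longrightarrow> \<phi> p v \<in> tangent_space M p"
  using spec[OF conjunct1[OF endomorphism[unfolded endomorphism_def]], of p] by auto

lemma phi_vf: "vector_field M W X \<Longrightarrow> vector_field M W (\<lambda>p. \<phi> p (X p))"
  using conjunct2[OF endomorphism[unfolded endomorphism_def]] by simp

lemma eta_linear: "i \<in> {1..s} \<Longrightarrow> linear_on (tangent_space M p) (\<eta> i p)"
  using eta_one_form by (simp add: one_form_def)

lemma eta_smooth: "i \<in> {1..s} \<Longrightarrow> vector_field M W X \<Longrightarrow> smooth_fun M W (\<lambda>p. \<eta> i p (X p))"
  using eta_one_form[of i] by (simp add: one_form_def)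

lemma xi_vf: "i \<in> {1..s} \<Longrightarrow> open W \<Longrightarrow> vector_field M W (\<xi> i)"
  by (rule vf_subset[OF xi_vf_UNIV]) auto

lemma xi_tangent: "i \<in> {1..s} \<Longrightarrow> \<xi> i p \<in> tangent_space M p"
  by (rule vf_tangent[OF xi_vf_UNIV]) auto

lemma xi_ker: "i \<in> {1..s} \<Longrightarrow> \<xi> i p \<in> ker_at M \<phi> p"
  unfolding ker_at_eq by (rule span_base) auto

lemma phi_xi: "i \<in> {1..s} \<Longrightarrow> \<phi> p (\<xi> i p) = 0"
  using xi_ker[of i p] by (simp add: ker_at_def)

lemma phi_zero: "\<phi> p 0 = 0"
  using linear_on_scale[OF phi_linear tangent_zero, of p 0] by simp

text \<open>Since \<phi> kills \<open>\<xi> i\<close>, the left side of the compatibility of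
  \<open>g\<close> with \<phi> is 0, and the sum of products of \<eta> collapses to its
  \<open>i\<close>-th term.\<close>

lemma metric_xi:
  assumes "i \<in> {1..s}" "v \<in> tangent_space M p"
  shows "g p (\<xi> i p) v = \<eta> i p v"
proof -
  have "0 = g p (\<xi> i p) v - (\<Sum>j=1..s. \<eta> j p (\<xi> i p) * \<eta> j p v)"
    using metric_phi[OF xi_tangent[OF assms(1)] assms(2)] metric_zero_left[OF phi_tangent[OF assms(2)]]
    by (simp add: phi_xi[OF assms(1)])
  also have "(\<Sum>j=1..s. \<eta> j p (\<xi> i p) * \<eta> j p v) = (\<Sum>j=1..s. if j = i then \<eta> i p v else 0)"
    using assms(1) by (intro sum.cong refl) (auto simp: eta_xi)
  finally show ?thesis using assms(1) by simp
qed

lemma metric_xi_right: "i \<in> {1..s} \<Longrightarrow> v \<in> tangent_space M p \<Longrightarrow> g p v (\<xi> i p) = \<eta> i p v"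
  using metric_xi[of i v p] metric_sym[of v p "\<xi> i p"] xi_tangent by simp

text \<open>Apply compatibility to \<open>u\<close> and \<open>\<phi> v\<close>. On the left,
  \<open>\<phi> (\<phi> v)\<close> is \<open>- v\<close> up to a combination of the \<xi>, and that
  combination is orthogonal to \<open>\<phi> u\<close>.\<close>

lemma metric_phi_skew:
  assumes u: "u \<in> tangent_space M p" and v: "v \<in> tangent_space M p"
  shows "g p u (\<phi> p v) = - g p (\<phi> p u) v"
proof -
  have "g p (\<phi> p u) (\<phi> p (\<phi> p v)) = g p u (\<phi> p v)"
    using metric_phi[OF u phi_tangent[OF v]] eta_phi[OF _ v] by simp
  moreover have "g p (\<phi> p u) (\<phi> p (\<phi> p v)) =
      g p (\<phi> p u) (- v) + g p (\<phi> p u) (\<Sum>i=1..s. \<eta> i p v *\<^sub>R \<xi> i p)"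
    unfolding phi_phi[OF v]
    by (rule metric_add_right) (auto intro!: phi_tangent u tangent_neg v tangent_sum tangent_scale xi_tangent)
  moreover have "g p (\<phi> p u) (\<Sum>i=1..s. \<eta> i p v *\<^sub>R \<xi> i p) = 0"
    by (subst metric_lincomb_right[OF phi_tangent[OF u]])
      (auto intro: xi_tangent simp: metric_xi_right phi_tangent[OF u] eta_phi[OF _ u])
  ultimately show ?thesis using metric_neg_right[OF phi_tangent[OF u] v] by simp
qed

lemma im_at_tangent: "v \<in> im_at M \<phi> p \<Longrightarrow> v \<in> tangent_space M p"
  unfolding im_at_def using phi_tangent by blast

lemma im_at_eta: "v \<in> im_at M \<phi> p \<Longrightarrow> i \<in> {1..s} \<Longrightarrow> \<eta> i p v = 0"
  unfolding im_at_def using eta_phi by blast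

lemma im_at_phi_phi: "v \<in> im_at M \<phi> p \<Longrightarrow> \<phi> p (\<phi> p v) = - v"
  using phi_phi[OF im_at_tangent] im_at_eta by simp

lemma phi_in_im_at: "v \<in> tangent_space M p \<Longrightarrow> \<phi> p v \<in> im_at M \<phi> p"
  unfolding im_at_def by blast

lemma subspace_im_at: "subspace (im_at M \<phi> p)"
  unfolding subspace_def
proof (intro conjI ballI allI)
  show "0 \<in> im_at M \<phi> p" using phi_in_im_at[OF tangent_zero] phi_zero by simp
  fix u assume "u \<in> im_at M \<phi> p"
  then obtain x where x: "x \<in> tangent_space M p" "u = \<phi> p x" unfolding im_at_def by blast
  show "c *\<^sub>R u \<in> im_at M \<phi> p" for c
    using phi_in_im_at[OF tangent_scale[OF x(1)], of c] linear_on_scale[OF phi_linear x(1)] x(2) by simp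
  fix v assume "v \<in> im_at M \<phi> p"
  then obtain y where y: "y \<in> tangent_space M p" "v = \<phi> p y" unfolding im_at_def by blast
  show "u + v \<in> im_at M \<phi> p"
    using phi_in_im_at[OF tangent_add[OF x(1) y(1)]] linear_on_add[OF phi_linear x(1) y(1)] x(2) y(2) by simp
qed

lemma S_structure:
  assumes "vector_field M W X" "vector_field M W Y" "p \<in> W"
  shows ext_deriv_eta: "j \<in> {1..s} \<Longrightarrow> ext_deriv M (\<eta> j) X Y p = 2 * g p (X p) (\<phi> p (Y p))"
    and nijenhuis_eq: "nijenhuis M \<phi> X Y p + (\<Sum>i=1..s. ext_deriv M (\<eta> i) X Y p *\<^sub>R \<xi> i p) = 0"
proof -
  have "\<forall>p\<in>W. (\<forall>j\<in>{1..s}. 2 * fundamental_form g \<phi> p (X p) (Y p) = ext_deriv M (\<eta> j) X Y p) \<and>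
                nijenhuis M \<phi> X Y p + (\<Sum>i=1..s. ext_deriv M (\<eta> i) X Y p *\<^sub>R \<xi> i p) = 0"
    using conjunct2[OF conjunct2[OF S_manifold[unfolded S_manifold_def]]] assms(1,2) by blast
  from bspec[OF this assms(3)]
  show "j \<in> {1..s} \<Longrightarrow> ext_deriv M (\<eta> j) X Y p = 2 * g p (X p) (\<phi> p (Y p))"
    and "nijenhuis M \<phi> X Y p + (\<Sum>i=1..s. ext_deriv M (\<eta> i) X Y p *\<^sub>R \<xi> i p) = 0"
    by (simp_all add: fundamental_form_def)
qed

lemma char_connection_eq:
  "char_connection s \<phi> \<xi> \<eta> g Dg X Y p = Dg X Y p + (\<Sum>i=1..s. g p (X p) (\<phi> p (Y p)) *\<^sub>R \<xi> i p
     - \<eta> i p (X p) *\<^sub>R \<phi> p (Y p) + \<eta> i p (Y p) *\<^sub>R \<phi> p (X p))"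
  by (simp add: char_connection_def char_torsion_def fundamental_form_def)

lemma affine_char_connection: "affine_connection M (char_connection s \<phi> \<xi> \<eta> g Dg)"
proof -
  define S where "S p u v = (\<Sum>i=1..s. g p u (\<phi> p v) *\<^sub>R \<xi> i p - \<eta> i p u *\<^sub>R \<phi> p v + \<eta> i p v *\<^sub>R \<phi> p u)"
    for p u v
  have "affine_connection M (\<lambda>X Y p. Dg X Y p + S p (X p) (Y p))"
  proof (rule affine_connection_add_tensor)
    fix W X Y assume X: "vector_field M W X" and Y: "vector_field M W Y"
    note o = vf_open[OF X]
    show "vector_field M W (\<lambda>p. S p (X p) (Y p))"
      unfolding S_def
      by (intro vf_sum o vf_add vf_diff vf_scale metric_smooth eta_smooth phi_vf X Y xi_vf)
  next
    fix p u v w assume T: "u \<in> tangent_space M p" "v \<in> tangent_space M p" "w \<in> tangent_space M p"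
    show "S p (u + v) w = S p u w + S p v w"
      unfolding S_def sum.distrib[symmetric]
      using T by (intro sum.cong refl)
        (simp add: metric_add_left phi_tangent linear_on_add[OF phi_linear] linear_on_add[OF eta_linear]
          algebra_simps)
    show "S p w (u + v) = S p w u + S p w v"
      unfolding S_def sum.distrib[symmetric]
      using T by (intro sum.cong refl)
        (simp add: metric_add_right phi_tangent linear_on_add[OF phi_linear] linear_on_add[OF eta_linear]
          algebra_simps)
  next
    fix p u v and c :: real assume T: "u \<in> tangent_space M p" "v \<in> tangent_space M p"
    show "S p (c *\<^sub>R u) v = c *\<^sub>R S p u v"
      unfolding S_def scaleR_sum_right
      using T by (intro sum.cong refl)
        (simp add: metric_scale_left phi_tangent linear_on_scale[OF phi_linear] linear_on_scale[OF eta_linear]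
          algebra_simps)
    show "S p u (c *\<^sub>R v) = c *\<^sub>R S p u v"
      unfolding S_def scaleR_sum_right
      using T by (intro sum.cong refl)
        (simp add: metric_scale_right phi_tangent linear_on_scale[OF phi_linear] linear_on_scale[OF eta_linear]
          algebra_simps)
  qed
  moreover have "(\<lambda>X Y p. Dg X Y p + S p (X p) (Y p)) = char_connection s \<phi> \<xi> \<eta> g Dg"
    by (intro ext) (simp only: S_def char_connection_eq)
  ultimately show ?thesis by simp
qed

end

section \<open>The canonical submersion\<close>

lemma tangent_map_linear:
  shows tangent_map_add: "tangent_map N \<pi> p (u + v) = tangent_map N \<pi> p u + tangent_map N \<pi> p v"
    and tangent_map_scale: "tangent_map N \<pi> p (c *\<^sub>R u) = c *\<^sub>R tangent_map N \<pi> p u"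
  by (auto simp: tangent_map_def fun_eq_iff plus_fun_apply scaleR_fun_apply)

lemma tangent_map_zero: "tangent_map N \<pi> p 0 = 0"
  using tangent_map_scale[of N \<pi> p 0 0] by simp

lemma tangent_map_neg: "tangent_map N \<pi> p (- u) = - tangent_map N \<pi> p u"
  using tangent_map_scale[of N \<pi> p "-1" u] by simp

lemma tangent_map_lincomb:
  "tangent_map N \<pi> p (\<Sum>a\<in>A. c a *\<^sub>R v a) = (\<Sum>a\<in>A. c a *\<^sub>R tangent_map N \<pi> p (v a))"
  by (induction A rule: infinite_finite_induct)
     (auto simp: tangent_map_zero tangent_map_add tangent_map_scale)

locale s_submersion = s_mfd M g Dg n s \<phi> \<xi> \<eta> + N: levi_civita_mfd N g' Dg'
  for M :: "'a::{t2_space,second_countable_topology} manifold" and g Dg n s \<phi> \<xi> \<eta>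
    and N :: "'b::{t2_space,second_countable_topology} manifold" and g' Dg' +
  fixes U :: "'a set" and \<pi> :: "'a \<Rightarrow> 'b"
  assumes submersion: "canonical_submersion M \<phi> g U N g' n \<pi>"
begin

abbreviation d\<pi> :: "'a \<Rightarrow> 'a tvec \<Rightarrow> 'b tvec" where "d\<pi> \<equiv> tangent_map N \<pi>"

lemma mdim_N: "mdim N = 2 * n"
  using submersion by (simp add: canonical_submersion_def)

lemma smooth_fun_pullback: "smooth_fun N V h \<Longrightarrow> smooth_fun M (U \<inter> \<pi> -` V) (h \<circ> \<pi>)"
  using submersion by (simp add: canonical_submersion_def smooth_map_on_def)

lemma open_preimage: "open V \<Longrightarrow> open (U \<inter> \<pi> -` V)"
  using smooth_fun_open[OF smooth_fun_pullback[OF N.smooth_fun_const]] .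

lemma smooth_at_pullback: "smooth_at N (\<pi> q) h \<Longrightarrow> q \<in> U \<Longrightarrow> smooth_at M q (h \<circ> \<pi>)"
  unfolding smooth_at_def[of N] using smooth_fun_pullback smooth_atI by blast

lemma submersion_at:
  assumes "q \<in> U"
  shows tangent_map_image: "d\<pi> q ` tangent_space M q = tangent_space N (\<pi> q)"
    and tangent_map_kernel: "{v \<in> tangent_space M q. d\<pi> q v = 0} = ker_at M \<phi> q"
    and tangent_map_isometry: "u \<in> im_at M \<phi> q \<Longrightarrow> v \<in> im_at M \<phi> q \<Longrightarrow>
      g' (\<pi> q) (d\<pi> q u) (d\<pi> q v) = g q u v"
  using submersion assms by (simp_all add: canonical_submersion_def)

lemma tangent_map_in: "q \<in> U \<Longrightarrow> v \<in> tangent_space M q \<Longrightarrow> d\<pi> q v \<in> tangent_space N (\<pi> q)"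
  using tangent_map_image by blast

lemma tangent_map_xi: "q \<in> U \<Longrightarrow> i \<in> {1..s} \<Longrightarrow> d\<pi> q (\<xi> i q) = 0"
  using xi_ker[of i q] tangent_map_kernel[of q] by blast

text \<open>\<open>- \<phi>^2\<close> is the horizontal projection, and what it removes lies in the
  kernel of d\<pi>.\<close>

lemma tangent_map_phi_phi:
  assumes q: "q \<in> U" and v: "v \<in> tangent_space M q"
  shows "d\<pi> q (\<phi> q (\<phi> q v)) = - d\<pi> q v"
  unfolding phi_phi[OF v] tangent_map_add tangent_map_neg tangent_map_lincomb
  using tangent_map_xi[OF q] by simp

text \<open>The isometry condition concerns pairs of horizontal vectors. Passing to the horizontal
  part extends it to arbitrary \<open>v\<close>, as required for brackets of lifts, which have
  vertical components.\<close>

lemma tangent_map_metric: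
  assumes q: "q \<in> U" and v: "v \<in> tangent_space M q" and u: "u \<in> im_at M \<phi> q"
  shows "g' (\<pi> q) (d\<pi> q v) (d\<pi> q u) = g q v u"
proof -
  have uT: "u \<in> tangent_space M q" by (rule im_at_tangent[OF u])
  have ppT: "\<phi> q (\<phi> q v) \<in> tangent_space M q" by (intro phi_tangent v)
  have pp: "\<phi> q (\<phi> q v) \<in> im_at M \<phi> q" by (intro phi_in_im_at phi_tangent v)
  have "- g' (\<pi> q) (d\<pi> q v) (d\<pi> q u) = g' (\<pi> q) (d\<pi> q (\<phi> q (\<phi> q v))) (d\<pi> q u)"
    unfolding tangent_map_phi_phi[OF q v]
    by (rule N.metric_neg_left[symmetric]) (intro tangent_map_in q v uT)+
  also have "\<dots> = g q (\<phi> q (\<phi> q v)) u" by (rule tangent_map_isometry[OF q pp u])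
  also have "\<dots> = g q v (\<phi> q (\<phi> q u))"
    using metric_phi_skew[OF phi_tangent[OF v] uT] metric_phi_skew[OF v phi_tangent[OF uT]] by simp
  also have "\<dots> = - g q v u" unfolding im_at_phi_phi[OF u] by (rule metric_neg_right[OF v uT])
  finally show ?thesis by simp
qed

section \<open>Projectable vector fields and their brackets\<close>

definition related :: "'a set \<Rightarrow> ('a \<Rightarrow> 'a tvec) \<Rightarrow> ('b \<Rightarrow> 'b tvec) \<Rightarrow> bool" where
  "related W X X' \<longleftrightarrow> (\<forall>q\<in>W. d\<pi> q (X q) = X' (\<pi> q))"

lemma related_apply:
  assumes "related W X X'" "q \<in> W" "smooth_at N (\<pi> q) h"
  shows "X q (h \<circ> \<pi>) = X' (\<pi> q) h"
proof -
  have "d\<pi> q (X q) h = X' (\<pi> q) h" using assms(1,2) by (simp add: related_def)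
  then show ?thesis using assms(3) by (simp add: tangent_map_def)
qed

lemma related_lie_bracket:
  assumes W: "W \<subseteq> U \<inter> \<pi> -` W'" and q: "q \<in> W"
    and X: "vector_field M W X" "vector_field N W' X'" "related W X X'"
    and Y: "vector_field M W Y" "vector_field N W' Y'" "related W Y Y'"
  shows "d\<pi> q (lie_bracket M X Y q) = lie_bracket N X' Y' (\<pi> q)"
proof
  fix h
  show "d\<pi> q (lie_bracket M X Y q) h = lie_bracket N X' Y' (\<pi> q) h"
  proof (cases "smooth_at N (\<pi> q) h")
    case True
    then obtain V where V: "\<pi> q \<in> V" "smooth_fun N V h" unfolding smooth_at_def by blast
    have qU: "q \<in> U" and qW': "\<pi> q \<in> W'" using W q by auto
    have *: "A q (\<lambda>r. B r (h \<circ> \<pi>)) = A' (\<pi> q) (\<lambda>z. B' z h)"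
      if A: "vector_field M W A" "vector_field N W' A'" "related W A A'"
        and B: "vector_field M W B" "vector_field N W' B'" "related W B B'" for A A' B B'
    proof -
      \<comment> \<open>The two inner functions are known to agree only where \<open>h\<close> is
        smooth, because \<open>tangent_map\<close> is 0 on other functions; hence the restriction to
        the preimage of \<open>V\<close>.\<close>
      have "A q (\<lambda>r. B r (h \<circ> \<pi>)) = A q ((\<lambda>z. B' z h) \<circ> \<pi>)"
      proof (rule tangent_cong[OF vf_tangent[OF A(1) q]])
        show "open (W \<inter> (U \<inter> \<pi> -` V))"
          using vf_open[OF A(1)] open_preimage[OF N.smooth_fun_open[OF V(2)]] by (rule open_Int)
        show "q \<in> W \<inter> (U \<inter> \<pi> -` V)" using q qU V(1) by simp
        fix r assume "r \<in> W \<inter> (U \<inter> \<pi> -` V)"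
        then show "B r (h \<circ> \<pi>) = ((\<lambda>z. B' z h) \<circ> \<pi>) r"
          using related_apply[OF B(3), of r h] N.smooth_atI[OF V(2)] by simp
      qed
      also have "\<dots> = A' (\<pi> q) (\<lambda>z. B' z h)"
        by (rule related_apply[OF A(3) q N.vf_apply_at[OF B(2) qW' True]])
      finally show ?thesis .
    qed
    show ?thesis
      using *[OF X Y] *[OF Y X] True smooth_at_pullback[OF True qU]
      by (simp add: tangent_map_def lie_bracket_apply N.lie_bracket_apply)
  qed (simp add: tangent_map_def lie_bracket_def)
qed

text \<open>The images under d\<pi> of a horizontal orthonormal system \<open>f\<close> form an
  orthonormal basis at every image point, but they may vary along a fibre and then define no fields
  on \<open>N\<close>. The change of basis from them to \<open>e'\<close> is smooth on
  \<open>M\<close> and turns \<open>f\<close> into horizontal lifts of \<open>e'\<close>.\<close>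

lemma lifted_frame_exists:
  assumes p: "p \<in> U"
  shows "\<exists>W' e' W e. open W' \<and> \<pi> p \<in> W' \<and> orthonormal_frame N g' W' e' \<and> open W \<and> p \<in> W \<and>
     W \<subseteq> U \<inter> \<pi> -` W' \<and> (\<forall>a<2*n. vector_field M W (e a) \<and> related W (e a) (e' a) \<and>
       (\<forall>q\<in>W. e a q \<in> im_at M \<phi> q))"
proof -
  obtain W1 e' where e1: "open W1" "\<pi> p \<in> W1" "orthonormal_frame N g' W1 e'"
    using N.orthonormal_frame_exists by blast
  obtain V y where V: "(V, y) \<in> charts N" "\<pi> p \<in> V" using N.chart_cover by blast
  define W' where "W' = W1 \<inter> V"
  have W': "open W'" "\<pi> p \<in> W'" "W' \<subseteq> V"
    unfolding W'_def using e1 V N.chart_open[OF V(1)] by auto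
  have e': "orthonormal_frame N g' W' e'"
    by (rule N.orthonormal_frame_subset[OF e1(3) W'(1)]) (simp add: W'_def)
  note e'T = N.orthonormal_frame_tangent[OF e'] and e'v = N.orthonormal_frame_vf[OF e']
  have "\<exists>u. u \<in> tangent_space M p \<and> d\<pi> p u = e' a (\<pi> p)" if "a < 2 * n" for a
    using tangent_map_image[OF p] e'T[of a "\<pi> p"] that W'(2) mdim_N by (metis imageE)
  then obtain u where u: "\<And>a. a < 2 * n \<Longrightarrow> u a \<in> tangent_space M p"
    "\<And>a. a < 2 * n \<Longrightarrow> d\<pi> p (u a) = e' a (\<pi> p)" by metis
  obtain W2 X where W2: "open W2" "p \<in> W2"
    and X: "\<And>a. a < 2 * n \<Longrightarrow> vector_field M W2 (X a)" "\<And>a. a < 2 * n \<Longrightarrow> X a p = u a"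
    using vf_extend_common[of "2 * n" u p, OF u(1)] by metis
  define W3 where "W3 = W2 \<inter> (U \<inter> \<pi> -` W')"
  have W3: "open W3" "p \<in> W3" "W3 \<subseteq> W2" "W3 \<subseteq> U \<inter> \<pi> -` W'"
    unfolding W3_def using W2 open_preimage[OF W'(1)] p W'(2) by auto
  \<comment> \<open>Minus the horizontal projection of \<open>X a\<close>; the sign affects neither
    orthonormality nor spans.\<close>
  define Y where "Y a q = \<phi> q (\<phi> q (X a q))" for a q
  have Yv: "vector_field M W3 (Y a)" if "a < 2 * n" for a
    unfolding Y_def by (intro phi_vf vf_subset[OF X(1)[OF that] W3(1,3)])
  have YT: "Y a q \<in> tangent_space M q" if "a < 2 * n" "q \<in> W3" for a q
    by (rule vf_tangent[OF Yv[OF that(1)] that(2)])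
  have Yim: "Y a q \<in> im_at M \<phi> q" if "a < 2 * n" "q \<in> W3" for a q
    unfolding Y_def using W3(3) that by (intro phi_in_im_at phi_tangent vf_tangent[OF X(1)]) auto
  have Yon: "g p (Y a p) (Y b p) = (if a = b then 1 else 0)" if "a < 2 * n" "b < 2 * n" for a b
  proof -
    have "g p (Y a p) (Y b p) = g' (\<pi> p) (d\<pi> p (Y a p)) (d\<pi> p (Y b p))"
      by (rule tangent_map_isometry[OF p Yim[OF that(1) W3(2)] Yim[OF that(2) W3(2)], symmetric])
    also have "\<dots> = g' (\<pi> p) (- e' a (\<pi> p)) (- e' b (\<pi> p))"
      unfolding Y_def using tangent_map_phi_phi[OF p] u X(2) that by simp
    also have "\<dots> = g' (\<pi> p) (e' a (\<pi> p)) (e' b (\<pi> p))"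
      using e'T[OF _ W'(2)] that mdim_N by (simp add: N.metric_neg_left N.metric_neg_right N.tangent_neg)
    finally show ?thesis using N.orthonormal_frame_metric[OF e' W'(2)] that mdim_N by simp
  qed
  have "Y a p \<notin> span ((\<lambda>b. Y b p) ` {..<a})" if a: "a < 2 * n" for a
  proof
    assume sp: "Y a p \<in> span ((\<lambda>b. Y b p) ` {..<a})"
    note aT = YT[OF a W3(2)]
    have "subspace {v \<in> tangent_space M p. g p v (Y a p) = 0}"
      unfolding subspace_def
      using aT by (auto intro: tangent_zero tangent_add tangent_scale
        simp: metric_zero_left metric_add_left metric_scale_left)
    then have "span ((\<lambda>b. Y b p) ` {..<a}) \<subseteq> {v \<in> tangent_space M p. g p v (Y a p) = 0}"
      using YT[OF _ W3(2)] Yon[OF _ a] a by (intro span_minimal) auto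
    then show False using sp Yon[OF a a] by auto
  qed
  then have "\<exists>V f. open V \<and> p \<in> V \<and> V \<subseteq> W3 \<and> (\<forall>a<2*n. vector_field M V (f a)) \<and>
     (\<forall>q\<in>V. \<forall>a<2*n. \<forall>b<2*n. g q (f a q) (f b q) = (if a = b then 1 else 0)) \<and>
     (\<forall>q\<in>V. \<forall>a<2*n. f a q \<in> span ((\<lambda>b. Y b q) ` {..<2*n}))"
    by (intro gram_schmidt W3(1,2) Yv)
  then obtain W f where Wf: "open W \<and> p \<in> W \<and> W \<subseteq> W3 \<and> (\<forall>a<2*n. vector_field M W (f a)) \<and>
     (\<forall>q\<in>W. \<forall>a<2*n. \<forall>b<2*n. g q (f a q) (f b q) = (if a = b then 1 else 0)) \<and>
     (\<forall>q\<in>W. \<forall>a<2*n. f a q \<in> span ((\<lambda>b. Y b q) ` {..<2*n}))" by (elim exE)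
  then have W: "open W" "p \<in> W" "W \<subseteq> W3"
    and fv: "\<And>a. a < 2 * n \<Longrightarrow> vector_field M W (f a)"
    and fon: "\<And>q a b. q \<in> W \<Longrightarrow> a < 2 * n \<Longrightarrow> b < 2 * n \<Longrightarrow> g q (f a q) (f b q) = (if a = b then 1 else 0)"
    and fsp: "\<And>q a. q \<in> W \<Longrightarrow> a < 2 * n \<Longrightarrow> f a q \<in> span ((\<lambda>b. Y b q) ` {..<2*n})"
    by simp_all
  have WU: "q \<in> U" "\<pi> q \<in> W'" "\<pi> q \<in> V" if "q \<in> W" for q using that W(3) W3(4) W'(3) by auto
  have fim: "f a q \<in> im_at M \<phi> q" if "q \<in> W" "a < 2 * n" for a q
  proof -
    have "span ((\<lambda>b. Y b q) ` {..<2*n}) \<subseteq> im_at M \<phi> q"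
      using Yim that(1) W(3) by (intro span_minimal subspace_im_at) auto
    then show ?thesis using fsp[OF that] by blast
  qed
  have dfT: "d\<pi> q (f a q) \<in> tangent_space N (\<pi> q)" if "q \<in> W" "a < 2 * n" for a q
    by (rule tangent_map_in[OF WU(1)[OF that(1)] im_at_tangent[OF fim[OF that]]])
  \<comment> \<open>Coefficients of \<open>e' b\<close> in the orthonormal basis formed by the
    images of the \<open>f a\<close>.\<close>
  define B where "B a b q = g' (\<pi> q) (d\<pi> q (f a q)) (e' b (\<pi> q))" for a b q
  have B: "smooth_fun M W (B a b)" if a: "a < 2 * n" and b: "b < 2 * n" for a b
  proof -
    \<comment> \<open>The image of \<open>f a\<close> is a field along \<pi> rather than on
      \<open>N\<close>, so smoothness is obtained in coordinates: its \<open>j\<close>-th coordinate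
      is \<open>f a\<close> applied to a pulled-back coordinate function, and \<open>G j\<close>
      lives on \<open>N\<close>.\<close>
    define G where "G j z = g' z (N.coord_vec V y j z) (e' b z)" for j z
    have "smooth_fun M W (\<lambda>q. \<Sum>j<mdim N. f a q ((\<lambda>z. y z j) \<circ> \<pi>) * (G j \<circ> \<pi>) q)"
    proof (intro smooth_fun_sum[OF W(1)] smooth_fun_mult)
      fix j assume "j \<in> {..<mdim N}"
      then have j: "j < mdim N" by simp
      have "smooth_fun M W ((\<lambda>z. y z j) \<circ> \<pi>)"
        by (rule smooth_fun_subset[OF smooth_fun_pullback[OF N.smooth_fun_coordinate[OF V(1) j]] W(1)])
          (use WU in auto)
      from vf_apply[OF fv[OF a] this] show "smooth_fun M W (\<lambda>q. f a q ((\<lambda>z. y z j) \<circ> \<pi>))" by simp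
      have "smooth_fun N W' (G j)"
        unfolding G_def
        by (rule N.metric_smooth[OF N.vf_subset[OF N.vf_coord_vec[OF V(1) j] W'(1,3)] e'v])
          (use b mdim_N in simp)
      from smooth_fun_subset[OF smooth_fun_pullback[OF this] W(1)]
      show "smooth_fun M W (\<lambda>q. (G j \<circ> \<pi>) q)" using WU by (auto simp: comp_def)
    qed
    then show ?thesis
    proof (rule smooth_fun_cong)
      fix q assume q: "q \<in> W"
      have "d\<pi> q (f a q) = (\<Sum>j<mdim N. d\<pi> q (f a q) (\<lambda>z. y z j) *\<^sub>R N.coord_vec V y j (\<pi> q))"
        by (rule N.tangent_expand[OF V(1) WU(3)[OF q] dfT[OF q a]])
      also have "\<dots> = (\<Sum>j<mdim N. f a q ((\<lambda>z. y z j) \<circ> \<pi>) *\<^sub>R N.coord_vec V y j (\<pi> q))"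
        using N.smooth_atI[OF N.smooth_fun_coordinate[OF V(1)] WU(3)[OF q]]
        by (intro sum.cong refl) (simp add: tangent_map_def)
      finally have "B a b q = g' (\<pi> q) (\<Sum>j<mdim N. f a q ((\<lambda>z. y z j) \<circ> \<pi>) *\<^sub>R N.coord_vec V y j (\<pi> q)) (e' b (\<pi> q))"
        by (simp add: B_def)
      also have "\<dots> = (\<Sum>j<mdim N. f a q ((\<lambda>z. y z j) \<circ> \<pi>) * (G j \<circ> \<pi>) q)"
        unfolding G_def comp_def
        by (rule N.metric_lincomb_left)
          (use e'T b mdim_N WU[OF q] N.coord_vec_in[OF V(1)] in auto)
      finally show "(\<Sum>j<mdim N. f a q ((\<lambda>z. y z j) \<circ> \<pi>) * (G j \<circ> \<pi>) q) = B a b q" by simp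
    qed
  qed
  define e where "e b q = (\<Sum>a<2*n. B a b q *\<^sub>R f a q)" for b q
  have "vector_field M W (e b) \<and> related W (e b) (e' b) \<and> (\<forall>q\<in>W. e b q \<in> im_at M \<phi> q)"
    if b: "b < 2 * n" for b
  proof (intro conjI ballI)
    show "vector_field M W (e b)"
      unfolding e_def by (rule vf_lincomb[OF W(1)]) (use B b fv in auto)
    show "e b q \<in> im_at M \<phi> q" if "q \<in> W" for q
      unfolding e_def using fim[OF that]
      by (intro subspace_sum[OF subspace_im_at] subspace_scale[OF subspace_im_at]) auto
    show "related W (e b) (e' b)"
      unfolding related_def
    proof
      fix q assume q: "q \<in> W"
      have on: "g' (\<pi> q) (d\<pi> q (f a q)) (d\<pi> q (f c q)) = (if a = c then 1 else 0)"
        if "a < mdim N" "c < mdim N" for a c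
        using tangent_map_isometry[OF WU(1)[OF q] fim[OF q] fim[OF q]] fon[OF q] that mdim_N by simp
      have e'b: "e' b (\<pi> q) \<in> tangent_space N (\<pi> q)" using e'T b mdim_N WU(2)[OF q] by simp
      have dfT': "d\<pi> q (f a q) \<in> tangent_space N (\<pi> q)" if "a < mdim N" for a
        using dfT[OF q] that mdim_N by simp
      have "e' b (\<pi> q) = (\<Sum>a<mdim N. g' (\<pi> q) (e' b (\<pi> q)) (d\<pi> q (f a q)) *\<^sub>R d\<pi> q (f a q))"
        using dfT' on e'b by (rule N.orthonormal_expand)
      also have "\<dots> = (\<Sum>a<2*n. B a b q *\<^sub>R d\<pi> q (f a q))"
        unfolding B_def mdim_N
        by (intro sum.cong refl) (use N.metric_sym[OF e'b dfT'] mdim_N in auto)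
      finally show "d\<pi> q (e b q) = e' b (\<pi> q)" by (simp add: e_def tangent_map_lincomb)
    qed
  qed
  then show ?thesis
    using W'(1,2) e' W(1,2) subset_trans[OF W(3) W3(4)]
    by (intro exI[of _ W'] exI[of _ e'] exI[of _ W] exI[of _ e]) simp
qed

end

section \<open>Adapted frames\<close>

lemma sum_lessThan_add:
  "(\<Sum>i<(k::nat) + l. f i) = (\<Sum>i<k. f i) + (\<Sum>i<l. f (k + i) :: 'a::comm_monoid_add)"
  by (induction l) (auto simp: ac_simps)

text \<open>The fields \<open>e\<close> are the horizontal lifts of \<open>e'\<close>; their
  orthonormality is inherited through the isometry condition, in \<open>E_frame\<close>.\<close>

locale adapted_frame = s_submersion M g Dg n s \<phi> \<xi> \<eta> N g' Dg' U \<pi>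
  for M :: "'a::{t2_space,second_countable_topology} manifold" and g Dg n s \<phi> \<xi> \<eta>
    and N :: "'b::{t2_space,second_countable_topology} manifold" and g' Dg' U \<pi> +
  fixes W :: "'a set" and W' :: "'b set" and e :: "nat \<Rightarrow> 'a \<Rightarrow> 'a tvec" and e' :: "nat \<Rightarrow> 'b \<Rightarrow> 'b tvec"
  assumes W': "open W'" and e': "orthonormal_frame N g' W' e'"
    and W: "open W" "W \<subseteq> U \<inter> \<pi> -` W'"
    and e: "a < 2 * n \<Longrightarrow> vector_field M W (e a)" "a < 2 * n \<Longrightarrow> related W (e a) (e' a)"
      "a < 2 * n \<Longrightarrow> q \<in> W \<Longrightarrow> e a q \<in> im_at M \<phi> q"
begin

lemma in_W: "q \<in> W \<Longrightarrow> q \<in> U" "q \<in> W \<Longrightarrow> \<pi> q \<in> W'"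
  using W(2) by auto

text \<open>Frame indices start at 0 and the \<xi> at 1, so index \<open>2 * n + i\<close> carries
  \<open>\<xi> (Suc i)\<close>.\<close>

definition E :: "nat \<Rightarrow> 'a \<Rightarrow> 'a tvec" where
  "E a = (if a < 2 * n then e a else \<xi> (Suc a - 2 * n))"

text \<open>The zero field stands for the projection of each \<xi>, so that
  \<open>related_lie_bracket\<close> treats horizontal and vertical indices uniformly.\<close>

definition E' :: "nat \<Rightarrow> 'b \<Rightarrow> 'b tvec" where
  "E' a = (if a < 2 * n then e' a else (\<lambda>z. 0))"

lemma sum_mdim: "(\<Sum>b<mdim M. f b) = (\<Sum>b<2*n. f b) + (\<Sum>i<s. f (2 * n + i) :: 'c::comm_monoid_add)"
  unfolding mdim_eq by (rule sum_lessThan_add)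

lemma xi_index: "\<not> a < 2 * n \<Longrightarrow> a < mdim M \<Longrightarrow> Suc a - 2 * n \<in> {1..s}"
  using mdim_eq by auto

lemma E_hor: "a < 2 * n \<Longrightarrow> E a = e a"
  and E_ver: "\<not> a < 2 * n \<Longrightarrow> E a = \<xi> (Suc a - 2 * n)"
  by (simp_all add: E_def)

lemma E_vf: "a < mdim M \<Longrightarrow> vector_field M W (E a)"
  using e(1) xi_vf[OF xi_index W(1)] by (auto simp: E_def)

lemma E_tangent: "a < mdim M \<Longrightarrow> q \<in> W \<Longrightarrow> E a q \<in> tangent_space M q"
  by (rule vf_tangent[OF E_vf])

lemma E_im: "a < 2 * n \<Longrightarrow> q \<in> W \<Longrightarrow> E a q \<in> im_at M \<phi> q"
  using e(3) by (simp add: E_hor)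

lemma e'_vf: "a < 2 * n \<Longrightarrow> vector_field N W' (e' a)"
  using N.orthonormal_frame_vf[OF e'] mdim_N by simp

lemma E'_vf: "vector_field N W' (E' a)"
  using e'_vf N.vf_zero[OF W'] by (simp add: E'_def)

lemma E_related: "a < mdim M \<Longrightarrow> related W (E a) (E' a)"
  using e(2) tangent_map_xi[OF in_W(1) xi_index]
  by (auto simp: E'_def E_def related_def)

lemma phi_E_ver: "\<not> a < 2 * n \<Longrightarrow> a < mdim M \<Longrightarrow> \<phi> q (E a q) = 0"
  using phi_xi[OF xi_index] by (simp add: E_ver)

lemma metric_E_ver:
  assumes "\<not> a < 2 * n" "a < mdim M" "v \<in> tangent_space M q"
  shows "g q (E a q) v = \<eta> (Suc a - 2 * n) q v" "g q v (E a q) = \<eta> (Suc a - 2 * n) q v"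
  using metric_xi[OF xi_index[OF assms(1,2)] assms(3)] metric_xi_right[OF xi_index[OF assms(1,2)] assms(3)]
  by (simp_all add: E_ver[OF assms(1)])

lemma eta_E:
  assumes "i \<in> {1..s}" "a < mdim M" "q \<in> W"
  shows "\<eta> i q (E a q) = (if Suc a = i + 2 * n then 1 else 0)"
proof (cases "a < 2 * n")
  case True
  then show ?thesis using im_at_eta[OF E_im[OF True assms(3)] assms(1)] assms(1) by simp
next
  case False
  then show ?thesis using eta_xi[OF assms(1) xi_index[OF False assms(2)]] by (auto simp: E_ver)
qed

lemma E_frame: "orthonormal_frame M g W E"
  unfolding orthonormal_frame_def
proof (intro conjI allI impI ballI)
  fix a assume "a < mdim M" then show "vector_field M W (E a)" by (rule E_vf)
next
  fix q a b assume q: "q \<in> W" and a: "a < mdim M" and b: "b < mdim M"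
  note T = E_tangent[OF a q] E_tangent[OF b q]
  consider "a < 2 * n" "b < 2 * n" | "\<not> a < 2 * n" | "\<not> b < 2 * n" by blast
  then show "g q (E a q) (E b q) = (if a = b then 1 else 0)"
  proof cases
    case 1
    have "g q (E a q) (E b q) = g' (\<pi> q) (d\<pi> q (E a q)) (d\<pi> q (E b q))"
      by (rule tangent_map_isometry[OF in_W(1)[OF q] E_im[OF 1(1) q] E_im[OF 1(2) q], symmetric])
    also have "\<dots> = g' (\<pi> q) (e' a (\<pi> q)) (e' b (\<pi> q))"
      using e(2)[OF 1(1)] e(2)[OF 1(2)] q 1 by (simp add: related_def E_hor)
    finally show ?thesis using N.orthonormal_frame_metric[OF e' in_W(2)[OF q]] 1 mdim_N by simp
  next
    case 2
    then show ?thesis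
      using metric_E_ver(1)[OF 2 a T(2)] eta_E[OF xi_index[OF 2 a] b q] by auto
  next
    case 3
    then show ?thesis
      using metric_E_ver(2)[OF 3 b T(1)] eta_E[OF xi_index[OF 3 b] a q] by auto
  qed
qed

text \<open>Matrix of \<phi> in the frame: column \<open>b\<close> holds the components of
  \<open>\<phi> (E b)\<close>. Rows and columns of vertical index vanish, by
  \<open>F_ver\<close>.\<close>

definition F :: "'a \<Rightarrow> nat \<Rightarrow> nat \<Rightarrow> real" where
  "F q a b = g q (E a q) (\<phi> q (E b q))"

lemma F_ver:
  assumes "a < mdim M" "b < mdim M" "q \<in> W" "\<not> (a < 2 * n \<and> b < 2 * n)"
  shows "F q a b = 0"
proof (cases "b < 2 * n")
  case True
  then have a: "\<not> a < 2 * n" using assms(4) by simp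
  show ?thesis
    unfolding F_def metric_E_ver(1)[OF a assms(1) phi_tangent[OF E_tangent[OF assms(2,3)]]]
    by (rule eta_phi[OF xi_index[OF a assms(1)] E_tangent[OF assms(2,3)]])
next
  case False
  show ?thesis unfolding F_def phi_E_ver[OF False assms(2)]
    by (rule metric_zero_right[OF E_tangent[OF assms(1,3)]])
qed

lemma F_skew:
  assumes "a < mdim M" "b < mdim M" "q \<in> W"
  shows "F q b a = - F q a b"
  using metric_phi_skew[OF E_tangent[OF assms(2,3)] E_tangent[OF assms(1,3)]]
    metric_sym[OF phi_tangent[OF E_tangent[OF assms(2,3)]] E_tangent[OF assms(1,3)]]
  by (simp add: F_def)

lemma phi_E_expand:
  assumes "b < 2 * n" "q \<in> W"
  shows "\<phi> q (E b q) = (\<Sum>a<2*n. F q a b *\<^sub>R E a q)"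
proof -
  have b: "b < mdim M" using assms(1) mdim_eq by simp
  note T = phi_tangent[OF E_tangent[OF b assms(2)]]
  have "\<phi> q (E b q) = (\<Sum>a<mdim M. g q (\<phi> q (E b q)) (E a q) *\<^sub>R E a q)"
    by (rule frame_expand[OF E_frame assms(2) T])
  also have "\<dots> = (\<Sum>a<2 * n + s. F q a b *\<^sub>R E a q)"
    unfolding mdim_eq F_def
    by (intro sum.cong refl) (use metric_sym[OF T E_tangent[OF _ assms(2)]] mdim_eq in auto)
  also have "\<dots> = (\<Sum>a<2*n. F q a b *\<^sub>R E a q)"
    unfolding sum_lessThan_add using F_ver[OF _ b assms(2)] mdim_eq by simp
  finally show ?thesis .
qed

text \<open>Matrix form of \<open>\<phi>^2 = -Id\<close> on the horizontal distribution; this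
  contraction evaluates the curvature traces.\<close>

lemma F_square:
  assumes "a < 2 * n" "c < 2 * n" "q \<in> W"
  shows "(\<Sum>b<2*n. F q a b * F q b c) = - (if a = c then 1 else 0)"
proof -
  have a: "a < mdim M" and c: "c < mdim M" using assms mdim_eq by auto
  have T: "b < 2 * n \<Longrightarrow> \<phi> q (E b q) \<in> tangent_space M q" for b
    using phi_tangent[OF E_tangent[OF _ assms(3)]] mdim_eq by simp
  have "g q (E a q) (\<phi> q (\<phi> q (E c q))) = g q (E a q) (\<Sum>b<2*n. F q b c *\<^sub>R \<phi> q (E b q))"
  proof -
    have "\<phi> q (\<phi> q (E c q)) = \<phi> q (\<Sum>b<2*n. F q b c *\<^sub>R E b q)"
      by (simp add: phi_E_expand[OF assms(2,3)])
    also have "\<dots> = (\<Sum>b<2*n. \<phi> q (F q b c *\<^sub>R E b q))"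
      by (rule linear_on_sum[OF subspace_tangent_space phi_linear])
        (use E_tangent[OF _ assms(3)] mdim_eq in \<open>auto intro: tangent_scale\<close>)
    also have "\<dots> = (\<Sum>b<2*n. F q b c *\<^sub>R \<phi> q (E b q))"
      by (intro sum.cong refl linear_on_scale[OF phi_linear] E_tangent[OF _ assms(3)]) (use mdim_eq in auto)
    finally show ?thesis by simp
  qed
  also have "\<dots> = (\<Sum>b<2*n. F q b c * F q a b)"
    unfolding F_def[of q a] by (rule metric_lincomb_right[OF E_tangent[OF a assms(3)]]) (use T in auto)
  finally show ?thesis
    unfolding im_at_phi_phi[OF E_im[OF assms(2,3)]]
      metric_neg_right[OF E_tangent[OF a assms(3)] E_tangent[OF c assms(3)]]
      orthonormal_frame_metric[OF E_frame assms(3) a c]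
    by (simp add: mult.commute)
qed

text \<open>Structure functions of the adapted frame. The vertical entry does not depend on which
  \<xi> is taken, and by \<open>F_ver\<close> it is 0 unless \<open>a\<close> and \<open>b\<close>
  are both horizontal.\<close>

definition C :: "'a \<Rightarrow> nat \<Rightarrow> nat \<Rightarrow> nat \<Rightarrow> real" where
  "C q a b c = (if c < 2 * n then if a < 2 * n \<and> b < 2 * n then N.bracket_coeff e' (\<pi> q) a b c else 0
     else - 2 * F q a b)"

lemma lie_bracket_zero_N:
  assumes "vector_field N W' X" "z \<in> W'"
  shows "lie_bracket N X (\<lambda>z. 0) z = 0" "lie_bracket N (\<lambda>z. 0) X z = 0"
  using N.lie_bracket_lincomb_right[of "{}" W' _ _ X z] assms N.lie_bracket_antisym[of "\<lambda>z. 0" X z] by simp_all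

text \<open>Horizontal components are read on \<open>N\<close> after projection. Vertical ones are
  values of \<eta>, and since \<eta> is constant on the frame fields, only the bracket term of
  \<open>ext_deriv\<close> remains.\<close>

lemma bracket_coeff_E:
  assumes a: "a < mdim M" and b: "b < mdim M" and c: "c < mdim M" and q: "q \<in> W"
  shows "bracket_coeff E q a b c = C q a b c"
proof -
  have T: "lie_bracket M (E a) (E b) q \<in> tangent_space M q"
    by (rule vf_tangent[OF bracket_vf[OF E_vf[OF a] E_vf[OF b]] q])
  show ?thesis
  proof (cases "c < 2 * n")
    case True
    have "bracket_coeff E q a b c = g' (\<pi> q) (d\<pi> q (lie_bracket M (E a) (E b) q)) (d\<pi> q (E c q))"
      unfolding bracket_coeff_def
      by (rule tangent_map_metric[OF in_W(1)[OF q] T E_im[OF True q], symmetric])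
    also have "\<dots> = g' (\<pi> q) (lie_bracket N (E' a) (E' b) (\<pi> q)) (e' c (\<pi> q))"
      using related_lie_bracket[OF W(2) q E_vf[OF a] E'_vf E_related[OF a] E_vf[OF b] E'_vf E_related[OF b]]
        E_related[OF c] q True by (simp add: related_def E'_def)
    also have "\<dots> = (if a < 2 * n \<and> b < 2 * n then N.bracket_coeff e' (\<pi> q) a b c else 0)"
      using lie_bracket_zero_N[OF _ in_W(2)[OF q]] E'_vf e'_vf
        N.metric_zero_left[OF N.vf_tangent[OF e'_vf[OF True] in_W(2)[OF q]]]
        N.vf_zero[OF W']
      by (auto simp: E'_def N.bracket_coeff_def)
    finally show ?thesis using True by (simp add: C_def)
  next
    case False
    define i where "i = Suc c - 2 * n"
    have i: "i \<in> {1..s}" unfolding i_def by (rule xi_index[OF False c])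
    have deriv: "E x q (\<lambda>r. \<eta> i r (E y r)) = 0" if "x < mdim M" "y < mdim M" for x y
    proof -
      have "E x q (\<lambda>r. \<eta> i r (E y r)) = E x q (\<lambda>r. if Suc y = i + 2 * n then 1 else 0)"
        by (rule tangent_cong[OF E_tangent[OF that(1) q] W(1) q]) (rule eta_E[OF i that(2)])
      then show ?thesis using tangent_fun_const[OF E_tangent[OF that(1) q]] by simp
    qed
    have "bracket_coeff E q a b c = \<eta> i q (lie_bracket M (E a) (E b) q)"
      unfolding bracket_coeff_def i_def by (rule metric_E_ver(2)[OF False c T])
    also have "\<dots> = - ext_deriv M (\<eta> i) (E a) (E b) q"
      using deriv[OF a b] deriv[OF b a] by (simp add: ext_deriv_def)
    also have "\<dots> = - 2 * F q a b"
      using ext_deriv_eta[OF E_vf[OF a] E_vf[OF b] q i] by (simp add: F_def)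
    finally show ?thesis using False by (simp add: C_def)
  qed
qed

text \<open>Result of inserting \<open>C\<close> into the Koszul formula. In the mixed cases, the
  derivative of a \<xi> along a lift \<open>X\<close> and that of \<open>X\<close> along the \<xi>
  are both \<open>- \<phi> X\<close>, while \<open>- F q a b\<close> is the component along each
  \<xi> of the derivative of \<open>E b\<close> along \<open>E a\<close>.\<close>

definition G :: "'a \<Rightarrow> nat \<Rightarrow> nat \<Rightarrow> nat \<Rightarrow> real" where
  "G q a b c = (if a < 2 * n \<and> b < 2 * n \<and> c < 2 * n then N.conn_coeff e' (\<pi> q) a b c
     else if a < 2 * n \<and> b < 2 * n then - F q a b
     else if a < 2 * n \<and> c < 2 * n then F q a c
     else if b < 2 * n \<and> c < 2 * n then F q b c else 0)"

lemma conn_coeff_E: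
  assumes a: "a < mdim M" and b: "b < mdim M" and c: "c < mdim M" and q: "q \<in> W"
  shows "conn_coeff E q a b c = G q a b c"
proof -
  have N: "2 * N.conn_coeff e' (\<pi> q) a b c = N.bracket_coeff e' (\<pi> q) a b c
      - N.bracket_coeff e' (\<pi> q) b c a + N.bracket_coeff e' (\<pi> q) c a b"
    if "a < 2 * n" "b < 2 * n" "c < 2 * n"
    by (rule N.koszul_frame[OF e' W' in_W(2)[OF q]]) (use that mdim_N in simp_all)
  have "2 * conn_coeff E q a b c = C q a b c - C q b c a + C q c a b"
    using koszul_frame[OF E_frame W(1) q a b c] bracket_coeff_E[OF _ _ _ q] a b c by simp
  also have "\<dots> = 2 * G q a b c"
    using N F_ver[OF _ _ q] F_skew[OF a c q] a b c
    by (cases "a < 2 * n"; cases "b < 2 * n"; cases "c < 2 * n") (simp_all add: C_def G_def)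
  finally show ?thesis by simp
qed

sublocale char: riemannian_affine_mfd M g "char_connection s \<phi> \<xi> \<eta> g Dg"
  by unfold_locales (auto intro: affine_char_connection bracket_vf)

text \<open>Half the torsion cancels the vertical part of derivatives between lifts, makes every
  \<xi> parallel, and doubles the derivative of a lift \<open>X\<close> along a \<xi> to
  \<open>- 2 \<phi> X\<close>.\<close>

definition H :: "'a \<Rightarrow> nat \<Rightarrow> nat \<Rightarrow> nat \<Rightarrow> real" where
  "H q a b c = (if a < 2 * n \<and> b < 2 * n \<and> c < 2 * n then N.conn_coeff e' (\<pi> q) a b c
     else if \<not> a < 2 * n \<and> b < 2 * n \<and> c < 2 * n then 2 * F q b c else 0)"

lemma sum_eta_E:
  assumes "a < mdim M" "q \<in> W"
  shows "(\<Sum>i=1..s. \<eta> i q (E a q)) = (if a < 2 * n then 0 else 1)"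
proof -
  have "(\<Sum>i=1..s. \<eta> i q (E a q)) = (\<Sum>i\<in>{1..s}. if i = Suc a - 2 * n then if a < 2 * n then 0 else 1 else 0)"
    using eta_E[OF _ assms] by (intro sum.cong refl) auto
  also have "\<dots> = (if a < 2 * n then 0 else 1)" using xi_index[of a] assms(1) by auto
  finally show ?thesis .
qed

lemma char_conn_coeff_E:
  assumes a: "a < mdim M" and b: "b < mdim M" and c: "c < mdim M" and q: "q \<in> W"
  shows "char.conn_coeff E q a b c = H q a b c"
proof -
  note T = E_tangent[OF a q] E_tangent[OF b q] E_tangent[OF c q]
  note pT = phi_tangent[OF T(1)] phi_tangent[OF T(2)]
  have DT: "Dg (E a) (E b) q \<in> tangent_space M q"
    by (rule vf_tangent[OF conn_vf[OF E_vf[OF a] E_vf[OF b]] q])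
  let ?t = "\<lambda>i. F q a b *\<^sub>R \<xi> i q - \<eta> i q (E a q) *\<^sub>R \<phi> q (E b q) + \<eta> i q (E b q) *\<^sub>R \<phi> q (E a q)"
  have tT: "?t i \<in> tangent_space M q" if "i \<in> {1..s}" for i
    by (intro tangent_add tangent_diff tangent_scale pT xi_tangent that)
  have ti: "g q (?t i) (E c q) = F q a b * \<eta> i q (E c q) - \<eta> i q (E a q) * F q c b + \<eta> i q (E b q) * F q c a"
    if i: "i \<in> {1..s}" for i
    using T pT xi_tangent[OF i]
    by (simp add: metric_add_left metric_diff_left metric_scale_left metric_xi[OF i] tangent_scale tangent_diff
        metric_sym[OF pT(1) T(3)] metric_sym[OF pT(2) T(3)] F_def)
  have "g q (\<Sum>i=1..s. ?t i) (E c q) = (\<Sum>i=1..s. g q (?t i) (E c q))"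
    by (rule metric_sum_left[OF T(3) tT])
  also have "\<dots> =
      (\<Sum>i=1..s. F q a b * \<eta> i q (E c q) - \<eta> i q (E a q) * F q c b + \<eta> i q (E b q) * F q c a)"
    by (rule sum.cong[OF refl ti])
  also have "\<dots> = F q a b * (\<Sum>i=1..s. \<eta> i q (E c q)) - (\<Sum>i=1..s. \<eta> i q (E a q)) * F q c b
      + (\<Sum>i=1..s. \<eta> i q (E b q)) * F q c a"
    by (simp add: sum.distrib sum_subtractf sum_distrib_left sum_distrib_right)
  finally have t: "g q (\<Sum>i=1..s. ?t i) (E c q) = (if c < 2 * n then 0 else F q a b)
      - (if a < 2 * n then 0 else F q c b) + (if b < 2 * n then 0 else F q c a)"
    unfolding sum_eta_E[OF a q] sum_eta_E[OF b q] sum_eta_E[OF c q] by simp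
  have "char.conn_coeff E q a b c = G q a b c + g q (\<Sum>i=1..s. ?t i) (E c q)"
    unfolding char.conn_coeff_def char_connection_eq conn_coeff_E[OF a b c q, symmetric] conn_coeff_def
      F_def[symmetric]
    by (rule metric_add_left[OF DT _ T(3)]) (rule tangent_sum[OF tT])
  also have "\<dots> = H q a b c"
    unfolding t using F_ver[OF _ _ q] F_skew[OF a c q] F_skew[OF b c q] a b c
    by (cases "a < 2 * n"; cases "b < 2 * n"; cases "c < 2 * n") (simp_all add: G_def H_def)
  finally show ?thesis .
qed

text \<open>As a \<xi> commutes with the lifts and is killed by \<phi>, normality applied to it and
  \<open>E b\<close> leaves only \<phi> of the bracket of that \<xi> with
  \<open>\<phi> (E b)\<close>. This bracket is the horizontal vector \<open>v\<close> with
  components \<open>E c q (\<lambda>r. F r x b)\<close>, and \<phi> is injective on horizontal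
  vectors.\<close>

lemma xi_deriv_F:
  assumes c: "\<not> c < 2 * n" "c < mdim M" and ab: "a < 2 * n" "b < 2 * n" and q: "q \<in> W"
  shows "E c q (\<lambda>r. F r a b) = 0"
proof -
  have m: "x < 2 * n \<Longrightarrow> x < mdim M" for x using mdim_eq by simp
  have F: "smooth_fun M W (\<lambda>r. F r x b)" if "x < 2 * n" for x
    unfolding F_def by (intro metric_smooth phi_vf E_vf m that ab(2))
  have bracket0: "lie_bracket M (E c) (E x) q = 0" if x: "x < 2 * n" for x
  proof -
    have "bracket_coeff E q c x y = 0" if "y < mdim M" for y
      using bracket_coeff_E[OF c(2) m[OF x] that q] F_ver[OF c(2) m[OF x] q] c(1) by (simp add: C_def)
    then show ?thesis
      using frame_expand[OF E_frame q vf_tangent[OF bracket_vf[OF E_vf[OF c(2)] E_vf[OF m[OF x]]] q]]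
      by (simp add: bracket_coeff_def)
  qed
  define v where "v = (\<Sum>x<2*n. E c q (\<lambda>r. F r x b) *\<^sub>R E x q)"
  have v_im: "v \<in> im_at M \<phi> q"
    unfolding v_def
    by (intro subspace_sum[OF subspace_im_at] subspace_scale[OF subspace_im_at] E_im[OF _ q]) auto
  have phi_b: "vector_field M W (\<lambda>r. \<phi> r (E b r))" by (rule phi_vf[OF E_vf[OF m[OF ab(2)]]])
  have br: "lie_bracket M (E c) (\<lambda>r. \<phi> r (E b r)) q = v"
  proof -
    have "lie_bracket M (E c) (\<lambda>r. \<phi> r (E b r)) q = lie_bracket M (E c) (\<lambda>r. \<Sum>x<2*n. F r x b *\<^sub>R E x r) q"
      by (rule lie_bracket_cong[OF W(1) q])
        (use E_tangent[OF c(2) q] vf_tangent[OF phi_b q] phi_E_expand[OF ab(2)] in auto)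
    also have "\<dots> = (\<Sum>x<2*n. F q x b *\<^sub>R lie_bracket M (E c) (E x) q + E c q (\<lambda>r. F r x b) *\<^sub>R E x q)"
      by (rule lie_bracket_lincomb_right[OF _ _ E_vf[OF c(2)] q]) (use F E_vf m in auto)
    also have "\<dots> = v" unfolding v_def by (intro sum.cong refl) (simp add: bracket0)
    finally show ?thesis .
  qed
  \<comment> \<open>\<phi> of a \<xi> is the zero field, which disposes of two of the four terms of
    \<open>nijenhuis\<close>.\<close>
  have zero: "lie_bracket M (\<lambda>r. \<phi> r (E c r)) Y q = 0" if Y: "vector_field M W Y" for Y
  proof -
    have "lie_bracket M (\<lambda>r. \<phi> r (E c r)) Y q = - lie_bracket M Y (\<lambda>r. 0) q"
      using lie_bracket_antisym[of "\<lambda>r. \<phi> r (E c r)" Y q] phi_E_ver[OF c] by simp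
    then show ?thesis using lie_bracket_lincomb_right[of "{}" W _ _ Y q, OF _ _ Y q] by simp
  qed
  have "ext_deriv M (\<eta> i) (E c) (E b) q = 0" if "i \<in> {1..s}" for i
    using ext_deriv_eta[OF E_vf[OF c(2)] E_vf[OF m[OF ab(2)]] q that] F_ver[OF c(2) m[OF ab(2)] q] c(1)
    by (simp add: F_def)
  then have "nijenhuis M \<phi> (E c) (E b) q = 0"
    using nijenhuis_eq[OF E_vf[OF c(2)] E_vf[OF m[OF ab(2)]] q] by simp
  then have "\<phi> q v = 0"
    unfolding nijenhuis_def zero[OF phi_b] zero[OF E_vf[OF m[OF ab(2)]]] br bracket0[OF ab(2)] phi_zero by simp
  then have "v = 0" using im_at_phi_phi[OF v_im] phi_zero by simp
  then have "0 = g q v (E a q)" using metric_zero_left[OF E_tangent[OF m[OF ab(1)] q]] by simp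
  also have "\<dots> = (\<Sum>x<2*n. E c q (\<lambda>r. F r x b) * g q (E x q) (E a q))"
    unfolding v_def by (rule metric_lincomb_left[OF E_tangent[OF m[OF ab(1)] q]]) (use E_tangent[OF m q] in auto)
  also have "\<dots> = (\<Sum>x<2*n. if x = a then E c q (\<lambda>r. F r a b) else 0)"
    by (intro sum.cong refl) (use orthonormal_frame_metric[OF E_frame q m m[OF ab(1)]] in auto)
  finally show ?thesis using ab(1) by simp
qed

text \<open>Functions constant along the fibres are differentiated on \<open>N\<close>; this matches
  the derivative terms of the two curvatures.\<close>

lemma deriv_pullback:
  assumes a: "a < 2 * n" and q: "q \<in> W" and h: "smooth_fun N W' h"
    and f: "\<And>r. r \<in> W \<Longrightarrow> f r = h (\<pi> r)"
  shows "E a q f = e' a (\<pi> q) h"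
proof -
  have m: "a < mdim M" using a mdim_eq by simp
  have "E a q f = E a q (h \<circ> \<pi>)"
    by (rule tangent_cong[OF E_tangent[OF m q] W(1) q]) (simp add: f)
  also have "\<dots> = e' a (\<pi> q) h"
    using related_apply[OF E_related[OF m] q N.smooth_atI[OF h in_W(2)[OF q]]] a by (simp add: E'_def)
  finally show ?thesis .
qed

lemma deriv_zero:
  assumes "a < mdim M" "q \<in> W" "\<And>r. r \<in> W \<Longrightarrow> f r = 0"
  shows "E a q f = 0"
  using tangent_cong[OF E_tangent[OF assms(1,2)] W(1) assms(2), of f "\<lambda>_. 0"] assms(3)
    tangent_fun_const[OF E_tangent[OF assms(1,2)], of 0] by simp

lemma conn_coeff_N_smooth:
  "a < 2 * n \<Longrightarrow> b < 2 * n \<Longrightarrow> c < 2 * n \<Longrightarrow> smooth_fun N W' (\<lambda>z. N.conn_coeff e' z a b c)"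
  unfolding N.conn_coeff_def by (intro N.metric_smooth N.conn_vf e'_vf)

section \<open>Curvature components in the adapted frame\<close>

definition R :: "'a \<Rightarrow> nat \<Rightarrow> nat \<Rightarrow> nat \<Rightarrow> real" where
  "R p b c d = g p (curvature M Dg (E b) (E c) (E c) p) (E d p)"

definition Rc :: "'a \<Rightarrow> nat \<Rightarrow> nat \<Rightarrow> nat \<Rightarrow> real" where
  "Rc p b c d = g p (curvature M (char_connection s \<phi> \<xi> \<eta> g Dg) (E b) (E c) (E c) p) (E d p)"

definition R' :: "'a \<Rightarrow> nat \<Rightarrow> nat \<Rightarrow> nat \<Rightarrow> real" where
  "R' p b c d = g' (\<pi> p) (curvature N Dg' (e' b) (e' c) (e' c) (\<pi> p)) (e' d (\<pi> p))"

lemma R_eq: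
  assumes bcd: "b < mdim M" "c < mdim M" "d < mdim M" and p: "p \<in> W"
  shows "R p b c d = E b p (\<lambda>q. G q c c d) - E c p (\<lambda>q. G q b c d) +
    (\<Sum>x<2 * n. G p c c x * G p b x d - G p b c x * G p c x d - C p b c x * G p x c d) +
    (\<Sum>x<s. G p c c (2*n+x) * G p b (2*n+x) d - G p b c (2*n+x) * G p c (2*n+x) d
      - C p b c (2*n+x) * G p (2*n+x) c d)"
proof -
  have "E x p (\<lambda>q. conn_coeff E q y z d) = E x p (\<lambda>q. G q y z d)" if "x < mdim M" "y < mdim M" "z < mdim M" for x y z
    by (rule tangent_cong[OF E_tangent[OF that(1) p] W(1) p]) (rule conn_coeff_E[OF that(2,3) bcd(3)])
  then have "R p b c d = E b p (\<lambda>q. G q c c d) - E c p (\<lambda>q. G q b c d) +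
    (\<Sum>x<mdim M. G p c c x * G p b x d - G p b c x * G p c x d - C p b c x * G p x c d)"
    unfolding R_def curvature_frame[OF E_frame W(1) p bcd(1,2,2,3)]
    using bcd p by (simp add: conn_coeff_E bracket_coeff_E)
  then show ?thesis unfolding sum_mdim by simp
qed

lemma Rc_eq:
  assumes bcd: "b < mdim M" "c < mdim M" "d < mdim M" and p: "p \<in> W"
  shows "Rc p b c d = E b p (\<lambda>q. H q c c d) - E c p (\<lambda>q. H q b c d) +
    (\<Sum>x<2 * n. H p c c x * H p b x d - H p b c x * H p c x d - C p b c x * H p x c d) +
    (\<Sum>x<s. H p c c (2*n+x) * H p b (2*n+x) d - H p b c (2*n+x) * H p c (2*n+x) d
      - C p b c (2*n+x) * H p (2*n+x) c d)"
proof -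
  have "E x p (\<lambda>q. char.conn_coeff E q y z d) = E x p (\<lambda>q. H q y z d)"
    if "x < mdim M" "y < mdim M" "z < mdim M" for x y z
    by (rule tangent_cong[OF E_tangent[OF that(1) p] W(1) p]) (rule char_conn_coeff_E[OF that(2,3) bcd(3)])
  then have "Rc p b c d = E b p (\<lambda>q. H q c c d) - E c p (\<lambda>q. H q b c d) +
    (\<Sum>x<mdim M. H p c c x * H p b x d - H p b c x * H p c x d - C p b c x * H p x c d)"
    unfolding Rc_def char.curvature_frame[OF E_frame W(1) p bcd(1,2,2,3)]
    using bcd p by (simp add: char_conn_coeff_E bracket_coeff_E)
  then show ?thesis unfolding sum_mdim by simp
qed

lemma R'_eq:
  assumes bcd: "b < 2 * n" "c < 2 * n" "d < 2 * n" and p: "p \<in> W"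
  shows "R' p b c d = e' b (\<pi> p) (\<lambda>z. N.conn_coeff e' z c c d) - e' c (\<pi> p) (\<lambda>z. N.conn_coeff e' z b c d) +
    (\<Sum>x<2 * n. N.conn_coeff e' (\<pi> p) c c x * N.conn_coeff e' (\<pi> p) b x d
      - N.conn_coeff e' (\<pi> p) b c x * N.conn_coeff e' (\<pi> p) c x d
      - N.bracket_coeff e' (\<pi> p) b c x * N.conn_coeff e' (\<pi> p) x c d)"
  using N.curvature_frame[OF e' W' in_W(2)[OF p], of b c c d] bcd mdim_N by (simp add: R'_def)

lemma index_M: "x < 2 * n \<Longrightarrow> x < mdim M" "x < s \<Longrightarrow> 2 * n + x < mdim M"
  using mdim_eq by auto

lemma F_diag: "a < mdim M \<Longrightarrow> q \<in> W \<Longrightarrow> F q a a = 0"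
  using F_skew[of a a q] by simp

text \<open>The horizontal part of the sum reproduces \<open>R'\<close>. Each \<xi> adds
  \<open>F p b c * F p c d\<close> once from the product of two mixed coefficients and twice from
  the bracket, whose vertical component is \<open>- 2 * F p b c\<close>; hence the 3.\<close>

lemma R_hor:
  assumes "b < 2 * n" "c < 2 * n" "d < 2 * n" and p: "p \<in> W"
  shows "R p b c d = R' p b c d + 3 * real s * (F p b c * F p c d)"
proof -
  note m = assms(1-3)[THEN index_M(1)]
  have d: "E b p (\<lambda>q. G q c c d) = e' b (\<pi> p) (\<lambda>z. N.conn_coeff e' z c c d)"
    "E c p (\<lambda>q. G q b c d) = e' c (\<pi> p) (\<lambda>z. N.conn_coeff e' z b c d)"
    using assms by (auto intro!: deriv_pullback conn_coeff_N_smooth simp: G_def)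
  show ?thesis
    unfolding R_eq[OF m p] R'_eq[OF assms] d
    using assms by (simp add: G_def C_def F_diag[OF m(2) p])
qed

text \<open>By \<open>xi_deriv_F\<close> the derivative along the \<xi> drops out, and what survives
  is minus the square of the matrix \<open>F\<close>.\<close>

lemma R_ver:
  assumes "b < 2 * n" "d < 2 * n" and p: "p \<in> W" and i: "i < s"
  shows "R p b (2 * n + i) d = (if b = d then 1 else 0)"
proof -
  have m: "b < mdim M" "2 * n + i < mdim M" "d < mdim M" using assms index_M by auto
  have "E b p (\<lambda>q. G q (2 * n + i) (2 * n + i) d) = 0"
    by (rule deriv_zero[OF m(1) p]) (simp add: G_def)
  moreover have "(\<lambda>q. G q b (2 * n + i) d) = (\<lambda>q. F q b d)" using assms by (simp add: G_def fun_eq_iff)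
  then have "E (2 * n + i) p (\<lambda>q. G q b (2 * n + i) d) = 0"
    using xi_deriv_F[OF _ m(2) assms(1,2) p] by simp
  ultimately have "R p b (2 * n + i) d = - (\<Sum>x<2*n. F p b x * F p x d)"
    unfolding R_eq[OF m p] using assms F_ver[OF m(1,2) p]
    by (simp add: G_def C_def sum_negf)
  then show ?thesis using F_square[OF assms(1,2) p] by simp
qed

text \<open>The value is the squared length of \<open>\<phi> (E c)\<close>: a plane spanned by a
  \<xi> and a horizontal unit vector has sectional curvature 1.\<close>

lemma R_ver_hor:
  assumes "c < 2 * n" and p: "p \<in> W" and i: "i < s"
  shows "R p (2 * n + i) c (2 * n + i) = 1"
proof -
  have m: "c < mdim M" "2 * n + i < mdim M" using assms index_M by auto
  have "E (2 * n + i) p (\<lambda>q. G q c c (2 * n + i)) = 0"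
    by (rule deriv_zero[OF m(2) p]) (use assms F_diag[OF m(1)] in \<open>simp add: G_def\<close>)
  moreover have "E c p (\<lambda>q. G q (2 * n + i) c (2 * n + i)) = 0"
    by (rule deriv_zero[OF m(1) p]) (simp add: G_def)
  ultimately have "R p (2 * n + i) c (2 * n + i) = (\<Sum>x<2*n. F p c x * F p c x)"
    unfolding R_eq[OF m(2,1,2) p] using assms F_ver[OF m(2,1) p] by (simp add: G_def C_def)
  also have "\<dots> = - (\<Sum>x<2*n. F p c x * F p x c)"
    unfolding sum_negf[symmetric]
    by (intro sum.cong refl) (use F_skew[OF m(1) _ p] index_M(1) in auto)
  finally show ?thesis using F_square[OF assms(1,1) p] by simp
qed

lemma R_ver_ver:
  assumes p: "p \<in> W" and i: "i < s" "j < s"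
  shows "R p (2 * n + i) (2 * n + j) (2 * n + i) = 0"
proof -
  have m: "2 * n + j < mdim M" "2 * n + i < mdim M" using assms index_M by auto
  have "E (2 * n + i) p (\<lambda>q. G q (2 * n + j) (2 * n + j) (2 * n + i)) = 0"
    "E (2 * n + j) p (\<lambda>q. G q (2 * n + i) (2 * n + j) (2 * n + i)) = 0"
    by (intro deriv_zero m p; simp add: G_def)+
  then show ?thesis
    unfolding R_eq[OF m(2,1,2) p] using F_ver[OF m(2,1) p] by (simp add: G_def C_def)
qed

section \<open>Ricci and scalar curvature\<close>

lemma ricci_sum:
  assumes "b < 2 * n" "d < 2 * n" and p: "p \<in> W"
  shows "(\<Sum>c<mdim M. R p b c d) = (\<Sum>c<2*n. R' p b c d) - (if b = d then 2 * real s else 0)"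
proof -
  have "(\<Sum>c<mdim M. R p b c d) =
      (\<Sum>c<2*n. R' p b c d + 3 * real s * (F p b c * F p c d)) + (\<Sum>i<s. if b = d then 1 else 0)"
    unfolding sum_mdim
    by (intro arg_cong2[where f="(+)"] sum.cong refl) (use R_hor[OF assms(1) _ assms(2) p] R_ver[OF assms] in auto)
  also have "\<dots> = (\<Sum>c<2*n. R' p b c d) + 3 * real s * (\<Sum>c<2*n. F p b c * F p c d) + (if b = d then real s else 0)"
    by (simp add: sum.distrib sum_distrib_left)
  finally show ?thesis unfolding F_square[OF assms] by simp
qed

lemma scal_N: "p \<in> W \<Longrightarrow> scal N g' Dg' (\<pi> p) = (\<Sum>b<2*n. \<Sum>c<2*n. R' p b c b)"
  using N.scal_frame[OF e' W' in_W(2)] by (simp add: mdim_N R'_def)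

lemma scal_M:
  assumes p: "p \<in> W"
  shows "scal M g Dg p = scal N g' Dg' (\<pi> p) - 2 * real n * real s"
proof -
  have "scal M g Dg p = (\<Sum>b<mdim M. \<Sum>c<mdim M. R p b c b)"
    unfolding R_def by (rule scal_frame[OF E_frame W(1) p])
  also have "\<dots> = (\<Sum>b<2*n. \<Sum>c<mdim M. R p b c b) + (\<Sum>i<s. \<Sum>c<mdim M. R p (2*n+i) c (2*n+i))"
    by (rule sum_mdim)
  also have "(\<Sum>b<2*n. \<Sum>c<mdim M. R p b c b) = (\<Sum>b<2*n. (\<Sum>c<2*n. R' p b c b) - 2 * real s)"
    by (intro sum.cong refl) (use ricci_sum[OF _ _ p] in auto)
  also have "(\<Sum>i<s. \<Sum>c<mdim M. R p (2*n+i) c (2*n+i)) = (\<Sum>i<s. 2 * real n)"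
  proof (intro sum.cong refl)
    fix i assume "i \<in> {..<s}"
    then show "(\<Sum>c<mdim M. R p (2*n+i) c (2*n+i)) = 2 * real n"
      unfolding sum_mdim using R_ver_hor[OF _ p] R_ver_ver[OF p] by simp
  qed
  \<comment> \<open>The horizontal rows contribute \<open>-4ns\<close> and the vertical rows
    \<open>2ns\<close>.\<close>
  finally show ?thesis by (simp add: scal_N[OF p] sum_subtractf)
qed

lemma scal_char:
  assumes p: "p \<in> W"
  shows "scal M g (char_connection s \<phi> \<xi> \<eta> g Dg) p = scal N g' Dg' (\<pi> p) - 8 * real n * real s"
proof -
  \<comment> \<open>The product of mixed coefficients is now 0, while the bracket component
    \<open>- 2 F\<close> meets the doubled coefficient \<open>2 F\<close> of \<open>H\<close>; hence
    the 4.\<close>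
  have hor: "Rc p b c b = R' p b c b + 4 * real s * (F p b c * F p c b)" if bc: "b < 2 * n" "c < 2 * n" for b c
  proof -
    note m = bc[THEN index_M(1)]
    have d: "E b p (\<lambda>q. H q c c b) = e' b (\<pi> p) (\<lambda>z. N.conn_coeff e' z c c b)"
      "E c p (\<lambda>q. H q b c b) = e' c (\<pi> p) (\<lambda>z. N.conn_coeff e' z b c b)"
      using bc p by (auto intro!: deriv_pullback conn_coeff_N_smooth simp: H_def)
    show ?thesis
      unfolding Rc_eq[OF m m(1) p] R'_eq[OF bc bc(1) p] d using bc by (simp add: H_def C_def)
  qed
  \<comment> \<open>Every \<xi> is parallel, and derivatives of lifts stay horizontal, so each trace
    term with a vertical index vanishes.\<close>
  have ver: "Rc p b c b = 0" if bc: "b < mdim M" "c < mdim M" "\<not> (b < 2 * n \<and> c < 2 * n)" for b c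
  proof -
    have H0: "H q c c b = 0" "H q b c b = 0" for q using bc by (auto simp: H_def)
    then have "E b p (\<lambda>q. H q c c b) = 0" "E c p (\<lambda>q. H q b c b) = 0"
      by (intro deriv_zero p bc; simp)+
    then show ?thesis unfolding Rc_eq[OF bc(1,2,1) p] using bc(3) by (auto simp: H_def)
  qed
  have "scal M g (char_connection s \<phi> \<xi> \<eta> g Dg) p = (\<Sum>b<mdim M. \<Sum>c<mdim M. Rc p b c b)"
    unfolding Rc_def by (rule char.scal_frame[OF E_frame W(1) p])
  also have "\<dots> = (\<Sum>b<2*n. \<Sum>c<2*n. Rc p b c b)"
    using ver index_M unfolding sum_mdim by simp
  also have "\<dots> = (\<Sum>b<2*n. \<Sum>c<2*n. R' p b c b + 4 * real s * (F p b c * F p c b))"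
    using hor by simp
  also have "\<dots> = scal N g' Dg' (\<pi> p) + 4 * real s * (\<Sum>b<2*n. \<Sum>c<2*n. F p b c * F p c b)"
    by (simp add: scal_N[OF p] sum.distrib sum_distrib_left)
  also have "(\<Sum>b<2*n. \<Sum>c<2*n. F p b c * F p c b) = (\<Sum>b<2*n. - 1)"
    using F_square[OF _ _ p] by simp
  finally show ?thesis by simp
qed

text \<open>Horizontal vectors have no component along any \<xi>, and d\<pi> preserves their
  remaining components. Both Ricci tensors thus become bilinear expressions in the same numbers,
  compared entry by entry through \<open>ricci_sum\<close>.\<close>

lemma ricci_M:
  assumes p: "p \<in> W" and u: "u \<in> im_at M \<phi> p" and v: "v \<in> im_at M \<phi> p"
  shows "ricci M g Dg p u v = ricci N g' Dg' (\<pi> p) (d\<pi> p u) (d\<pi> p v) - 2 * real s * g p u v"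
proof -
  note pU = in_W(1)[OF p]
  have uT: "u \<in> tangent_space M p" and vT: "v \<in> tangent_space M p" using im_at_tangent u v by auto
  have ver: "g p w (E (2 * n + i) p) = 0" if "w \<in> im_at M \<phi> p" "i < s" for w i
    using metric_E_ver(2)[OF _ index_M(2)[OF that(2)] im_at_tangent[OF that(1)]]
      im_at_eta[OF that(1) xi_index[OF _ index_M(2)[OF that(2)]]] by simp
  have hor: "g' (\<pi> p) (d\<pi> p w) (e' b (\<pi> p)) = g p w (E b p)" if "w \<in> tangent_space M p" "b < 2 * n" for w b
    using tangent_map_metric[OF pU that(1) E_im[OF that(2) p]] E_related[OF index_M(1)[OF that(2)]] p that(2)
    by (simp add: related_def E'_def)
  have RT: "curvature M Dg (E b) (E c) (E c) p \<in> tangent_space M p" if "b < mdim M" "c < mdim M" for b c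
    by (rule curvature_tangent[OF E_vf[OF that(1)] E_vf[OF that(2)] E_vf[OF that(2)] p])
  have RT': "curvature N Dg' (e' b) (e' c) (e' c) (\<pi> p) \<in> tangent_space N (\<pi> p)" if "b < 2 * n" "c < 2 * n" for b c
    by (rule N.curvature_tangent[OF e'_vf[OF that(1)] e'_vf[OF that(2)] e'_vf[OF that(2)] in_W(2)[OF p]])
  have expand: "g p (curvature M Dg (E b) (E c) (E c) p) v = (\<Sum>d<2*n. g p v (E d p) * R p b c d)"
    if "b < mdim M" "c < mdim M" for b c
  proof -
    have "g p (curvature M Dg (E b) (E c) (E c) p) v = (\<Sum>d<mdim M. R p b c d * g p v (E d p))"
      unfolding R_def by (rule metric_frame_expand[OF E_frame p RT[OF that] vT])
    then show ?thesis unfolding sum_mdim using ver[OF v] by (simp add: mult.commute)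
  qed
  have expand': "g' (\<pi> p) (curvature N Dg' (e' b) (e' c) (e' c) (\<pi> p)) (d\<pi> p v) =
      (\<Sum>d<2*n. g p v (E d p) * R' p b c d)" if "b < 2 * n" "c < 2 * n" for b c
    using N.metric_frame_expand[OF e' in_W(2)[OF p] RT'[OF that] tangent_map_in[OF pU vT]] hor[OF vT]
    by (simp add: mdim_N R'_def mult.commute)
  have "ricci M g Dg p u v =
      (\<Sum>b<mdim M. g p u (E b p) * (\<Sum>c<mdim M. g p (curvature M Dg (E b) (E c) (E c) p) v))"
    by (rule ricci_frame[OF E_frame W(1) p uT vT])
  also have "\<dots> = (\<Sum>b<2*n. g p u (E b p) * (\<Sum>c<mdim M. \<Sum>d<2*n. g p v (E d p) * R p b c d))"
    by (subst sum_mdim) (use ver[OF u] expand index_M(1) in simp)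
  also have "\<dots> = (\<Sum>b<2*n. g p u (E b p) * (\<Sum>d<2*n. g p v (E d p) * (\<Sum>c<mdim M. R p b c d)))"
    by (subst sum.swap) (simp add: sum_distrib_left)
  also have "\<dots> = (\<Sum>b<2*n. g p u (E b p) * ((\<Sum>d<2*n. g p v (E d p) * (\<Sum>c<2*n. R' p b c d))
      - 2 * real s * g p v (E b p)))"
  proof (intro sum.cong refl arg_cong[where f="\<lambda>x. _ * x"])
    fix b assume "b \<in> {..<2*n}"
    then have b: "b < 2 * n" by simp
    have "(\<Sum>d<2*n. g p v (E d p) * (\<Sum>c<mdim M. R p b c d)) =
      (\<Sum>d<2*n. g p v (E d p) * (\<Sum>c<2*n. R' p b c d) - (if b = d then 2 * real s * g p v (E b p) else 0))"
      by (intro sum.cong refl) (auto simp: ricci_sum[OF b _ p] algebra_simps)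
    then show "(\<Sum>d<2*n. g p v (E d p) * (\<Sum>c<mdim M. R p b c d)) =
      (\<Sum>d<2*n. g p v (E d p) * (\<Sum>c<2*n. R' p b c d)) - 2 * real s * g p v (E b p)"
      using b by (simp add: sum_subtractf)
  qed
  also have "\<dots> = (\<Sum>b<2*n. g p u (E b p) * (\<Sum>d<2*n. g p v (E d p) * (\<Sum>c<2*n. R' p b c d)))
      - 2 * real s * (\<Sum>b<2*n. g p u (E b p) * g p v (E b p))"
    by (simp add: right_diff_distrib sum_subtractf sum_distrib_left mult_ac)
  also have "(\<Sum>b<2*n. g p u (E b p) * g p v (E b p)) = g p u v"
    unfolding metric_frame_expand[OF E_frame p uT vT] sum_mdim using ver[OF u] by simp
  also have "(\<Sum>b<2*n. g p u (E b p) * (\<Sum>d<2*n. g p v (E d p) * (\<Sum>c<2*n. R' p b c d))) =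
      ricci N g' Dg' (\<pi> p) (d\<pi> p u) (d\<pi> p v)"
  proof -
    have "ricci N g' Dg' (\<pi> p) (d\<pi> p u) (d\<pi> p v) = (\<Sum>b<2*n. g' (\<pi> p) (d\<pi> p u) (e' b (\<pi> p)) *
        (\<Sum>c<2*n. g' (\<pi> p) (curvature N Dg' (e' b) (e' c) (e' c) (\<pi> p)) (d\<pi> p v)))"
      using N.ricci_frame[OF e' W' in_W(2)[OF p] tangent_map_in[OF pU uT] tangent_map_in[OF pU vT]]
      by (simp add: mdim_N)
    also have "\<dots> = (\<Sum>b<2*n. g p u (E b p) * (\<Sum>c<2*n. \<Sum>d<2*n. g p v (E d p) * R' p b c d))"
      using hor[OF uT] expand' by simp
    also have "\<dots> = (\<Sum>b<2*n. g p u (E b p) * (\<Sum>d<2*n. g p v (E d p) * (\<Sum>c<2*n. R' p b c d)))"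
      by (subst sum.swap) (simp add: sum_distrib_left)
    finally show ?thesis by simp
  qed
  finally show ?thesis .
qed

end

theorem corollary4p18:
  fixes M :: "'a::{t2_space,second_countable_topology} manifold"
    and N :: "'b::{t2_space,second_countable_topology} manifold"
    and n s :: nat
    and \<phi> :: "'a \<Rightarrow> 'a tvec \<Rightarrow> 'a tvec"
    and \<xi> :: "nat \<Rightarrow> 'a \<Rightarrow> 'a tvec"
    and \<eta> :: "nat \<Rightarrow> 'a \<Rightarrow> 'a tvec \<Rightarrow> real"
    and g :: "'a metric" and g' :: "'b metric"
    and U :: "'a set" and \<pi> :: "'a \<Rightarrow> 'b"
    and Dg :: "'a connection" and Dg' :: "'b connection"
  assumes "S_manifold M n s \<phi> \<xi> \<eta> g"
    and "canonical_submersion M \<phi> g U N g' n \<pi>"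
    and "levi_civita M g Dg"
    and "levi_civita N g' Dg'"
  shows "(\<forall>p\<in>U. \<forall>X\<in>im_at M \<phi> p. \<forall>Y\<in>im_at M \<phi> p.
            ricci M g Dg p X Y =
              ricci N g' Dg' (\<pi> p) (tangent_map N \<pi> p X) (tangent_map N \<pi> p Y)
              - 2 * real s * g p X Y) \<and>
         (\<forall>p\<in>U.
            scal N g' Dg' (\<pi> p) = scal M g Dg p + 2 * real n * real s \<and>
            scal M g Dg p + 2 * real n * real s
              = scal M g (char_connection s \<phi> \<xi> \<eta> g Dg) p + 8 * real n * real s)"
proof -
  interpret s_submersion M g Dg n s \<phi> \<xi> \<eta> N g' Dg' U \<pi>
    using assms
    by unfold_locales (auto simp: S_manifold_def metric_f_manifold_def canonical_submersion_def)
  have "(\<forall>X\<in>im_at M \<phi> p. \<forall>Y\<in>im_at M \<phi> p. ricci M g Dg p X Y =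
        ricci N g' Dg' (\<pi> p) (tangent_map N \<pi> p X) (tangent_map N \<pi> p Y) - 2 * real s * g p X Y) \<and>
      scal M g Dg p = scal N g' Dg' (\<pi> p) - 2 * real n * real s \<and>
      scal M g (char_connection s \<phi> \<xi> \<eta> g Dg) p = scal N g' Dg' (\<pi> p) - 8 * real n * real s"
    if "p \<in> U" for p
  proof -
    obtain W' e' W e where fr: "open W' \<and> \<pi> p \<in> W' \<and> orthonormal_frame N g' W' e' \<and> open W \<and> p \<in> W \<and>
       W \<subseteq> U \<inter> \<pi> -` W' \<and> (\<forall>a<2*n. vector_field M W (e a) \<and> related W (e a) (e' a) \<and>
         (\<forall>q\<in>W. e a q \<in> im_at M \<phi> q))"
      using lifted_frame_exists[OF \<open>p \<in> U\<close>] by (elim exE)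
    \<comment> \<open>The claims are pointwise, so each point of \<open>U\<close> may use an adapted
      frame of its own.\<close>
    interpret adapted_frame M g Dg n s \<phi> \<xi> \<eta> N g' Dg' U \<pi> W W' e e'
      by unfold_locales (use fr in simp_all)
    have "p \<in> W" using fr by simp
    then show ?thesis using ricci_M scal_M scal_char by simp
  qed
  then show ?thesis by simp
qed

end
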